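(* Let $G$ be a discrete group. Assume that $FCH(G)=AR(G)$, or equivalently, that $ICC(G)=G/FCH(G)$ has the unique trace property. Let $\sigma\in Z^2(G,\mathbb{T})$. Then $(G,\sigma)$ has the unique trace property whenever $(G,\sigma)$ satisfies Kleppner's condition. Hence, $G$ belongs to $\mathcal{K}_{UT}$.
   Context: For a discrete group $G$ with identity $e$, $Z^2(G,\mathbb{T})$ is the set of normalized 2-cocycles, i.e. maps $\sigma:G\times G\to\mathbb{T}$ with $\sigma(g,e)=\sigma(e,g)=1$ and $\sigma(g,h)\sigma(gh,k)=\sigma(h,k)\sigma(g,hk)$ for all $g,h,k$. With $(\lambda_\sigma(g)\xi)(h)=\sigma(g,g^{-1}h)\xi(g^{-1}h)$ on $\ell^2(G)$, $C_r^*(G,\sigma)$ is the C$^*$-algebra generated by $\lambda_\sigma(G)$. $(G,\sigma)$ has the unique trace property if $C_r^*(G,\sigma)$ has a unique tracial state (namely the canonical one $a\mapsto\langle a\delta_e,\delta_e\rangle$); $G$ has the unique trace property if $(G,1)$ does. An element $g\in G$ is $\sigma$-regular if $\sigma(g,h)=\sigma(h,g)$ whenever $h\in G$ commutes with $g$ (a property of conjugacy classes). $(G,\sigma)$ satisfies Kleppner's condition if every nontrivial $\sigma$-regular conjugacy class of $G$ is infinite. $\mathcal{K}_{UT}$ is the class of groups $G$ such that, for all $\sigma\in Z^2(G,\mathbb{T})$, $(G,\sigma)$ has the unique trace property if and only if $(G,\sigma)$ satisfies Kleppner's condition. A group is ICC if all its nontrivial conjugacy classes are infinite. $FCH(G)$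 (the FC-hypercenter) is the smallest normal subgroup $N$ of $G$ such that $G/N$ is ICC. $AR(G)$ is the amenable radical, i.e. the largest normal amenable subgroup of $G$. $ICC(G):=G/FCH(G)$. *)

theory Defs
  imports "HOL-Analysis.Analysis" "HOL-Algebra.Coset"
begin

section \<open>Groups\<close>

definition conj_class :: "('a, 'b) monoid_scheme \<Rightarrow> 'a \<Rightarrow> 'a set" where
  "conj_class G g = {h \<otimes>\<^bsub>G\<^esub> g \<otimes>\<^bsub>G\<^esub> inv\<^bsub>G\<^esub> h | h. h \<in> carrier G}"

definition icc :: "('a, 'b) monoid_scheme \<Rightarrow> bool" where
  "icc G \<longleftrightarrow> (\<forall>g \<in> carrier G. g \<noteq> \<one>\<^bsub>G\<^esub> \<longrightarrow> infinite (conj_class G g))"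

text \<open>The order on sets is inclusion, so LEAST and GREATEST below give the smallest and the
  largest set with the stated property.\<close>

definition FC_hypercenter :: "('a, 'b) monoid_scheme \<Rightarrow> 'a set" where
  "FC_hypercenter G = (LEAST N. N \<lhd> G \<and> icc (G Mod N))"

definition ICC_quot :: "('a, 'b) monoid_scheme \<Rightarrow> 'a set monoid" where
  "ICC_quot G = G Mod FC_hypercenter G"

text \<open>Elements of real-valued \<open>l\<^sup>\<infinity>(G)\<close> are represented by functions on the whole type
  that are bounded on the carrier; by linearity and positivity, a mean only depends on the
  values of its argument on the carrier.\<close>

definition invariant_mean :: "('a, 'b) monoid_scheme \<Rightarrow> (('a \<Rightarrow> real) \<Rightarrow> real) \<Rightarrow> bool" where
  "invariant_mean G m \<longleftrightarrow>
     m (\<lambda>_. 1) = 1 \<and>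
     (\<forall>f. bounded (f ` carrier G) \<longrightarrow>
        (\<forall>c. m (\<lambda>x. c * f x) = c * m f) \<and>
        (\<forall>f'. bounded (f' ` carrier G) \<longrightarrow> m (\<lambda>x. f x + f' x) = m f + m f') \<and>
        ((\<forall>x \<in> carrier G. 0 \<le> f x) \<longrightarrow> 0 \<le> m f) \<and>
        (\<forall>g \<in> carrier G. m (\<lambda>x. f (g \<otimes>\<^bsub>G\<^esub> x)) = m f))"

definition amenable :: "('a, 'b) monoid_scheme \<Rightarrow> bool" where
  "amenable G \<longleftrightarrow> (\<exists>m. invariant_mean G m)"

definition amenable_radical :: "('a, 'b) monoid_scheme \<Rightarrow> 'a set" where
  "amenable_radical G = (GREATEST N. N \<lhd> G \<and> amenable (G\<lparr>carrier := N\<rparr>))"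

section \<open>Cocycles\<close>

text \<open>Only the values of a cocycle on the carrier are constrained, and only these are used.\<close>

definition cocycles2 :: "('a, 'b) monoid_scheme \<Rightarrow> ('a \<Rightarrow> 'a \<Rightarrow> complex) set" where
  "cocycles2 G = {\<sigma>.
     (\<forall>g \<in> carrier G. \<forall>h \<in> carrier G. cmod (\<sigma> g h) = 1) \<and>
     (\<forall>g \<in> carrier G. \<sigma> g \<one>\<^bsub>G\<^esub> = 1 \<and> \<sigma> \<one>\<^bsub>G\<^esub> g = 1) \<and>
     (\<forall>g \<in> carrier G. \<forall>h \<in> carrier G. \<forall>k \<in> carrier G.
        \<sigma> g h * \<sigma> (g \<otimes>\<^bsub>G\<^esub> h) k = \<sigma> h k * \<sigma> g (h \<otimes>\<^bsub>G\<^esub> k))}"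

definition sigma_regular ::
    "('a, 'b) monoid_scheme \<Rightarrow> ('a \<Rightarrow> 'a \<Rightarrow> complex) \<Rightarrow> 'a \<Rightarrow> bool" where
  "sigma_regular G \<sigma> g \<longleftrightarrow>
     (\<forall>h \<in> carrier G. g \<otimes>\<^bsub>G\<^esub> h = h \<otimes>\<^bsub>G\<^esub> g \<longrightarrow> \<sigma> g h = \<sigma> h g)"

definition Kleppner :: "('a, 'b) monoid_scheme \<Rightarrow> ('a \<Rightarrow> 'a \<Rightarrow> complex) \<Rightarrow> bool" where
  "Kleppner G \<sigma> \<longleftrightarrow>
     (\<forall>g \<in> carrier G. g \<noteq> \<one>\<^bsub>G\<^esub> \<and> sigma_regular G \<sigma> g \<longrightarrow> infinite (conj_class G g))"

section \<open>Bounded operators on square-summable functions\<close>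

text \<open>The Hilbert space over an index set \<open>X\<close> consists of functions on the whole type that vanish
  off \<open>X\<close>. Its bounded operators are extensional functions, so that equality in HOL is equality
  of operators.\<close>

definition ell2 :: "'a set \<Rightarrow> ('a \<Rightarrow> complex) set" where
  "ell2 X = {\<xi>. (\<forall>x. x \<notin> X \<longrightarrow> \<xi> x = 0) \<and> (\<lambda>x. (cmod (\<xi> x))\<^sup>2) summable_on X}"

definition ell2_inner :: "'a set \<Rightarrow> ('a \<Rightarrow> complex) \<Rightarrow> ('a \<Rightarrow> complex) \<Rightarrow> complex" where
  "ell2_inner X \<xi> \<eta> = (\<Sum>\<^sub>\<infinity>x\<in>X. \<xi> x * cnj (\<eta> x))"

definition ell2_norm :: "'a set \<Rightarrow> ('a \<Rightarrow> complex) \<Rightarrow> real" where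
  "ell2_norm X \<xi> = sqrt (\<Sum>\<^sub>\<infinity>x\<in>X. (cmod (\<xi> x))\<^sup>2)"

type_synonym 'a operator = "('a \<Rightarrow> complex) \<Rightarrow> ('a \<Rightarrow> complex)"

definition bounded_ops :: "'a set \<Rightarrow> 'a operator set" where
  "bounded_ops X = {T \<in> ell2 X \<rightarrow>\<^sub>E ell2 X.
     (\<forall>\<xi> \<in> ell2 X. \<forall>\<eta> \<in> ell2 X. T (\<lambda>x. \<xi> x + \<eta> x) = (\<lambda>x. T \<xi> x + T \<eta> x)) \<and>
     (\<forall>c. \<forall>\<xi> \<in> ell2 X. T (\<lambda>x. c * \<xi> x) = (\<lambda>x. c * T \<xi> x)) \<and>
     (\<exists>C. \<forall>\<xi> \<in> ell2 X. ell2_norm X (T \<xi>) \<le> C * ell2_norm X \<xi>)}"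

definition op_id :: "'a set \<Rightarrow> 'a operator" where
  "op_id X = (\<lambda>\<xi> \<in> ell2 X. \<xi>)"

definition op_add :: "'a set \<Rightarrow> 'a operator \<Rightarrow> 'a operator \<Rightarrow> 'a operator" where
  "op_add X S T = (\<lambda>\<xi> \<in> ell2 X. \<lambda>x. S \<xi> x + T \<xi> x)"

definition op_scale :: "'a set \<Rightarrow> complex \<Rightarrow> 'a operator \<Rightarrow> 'a operator" where
  "op_scale X c T = (\<lambda>\<xi> \<in> ell2 X. \<lambda>x. c * T \<xi> x)"

definition op_mult :: "'a set \<Rightarrow> 'a operator \<Rightarrow> 'a operator \<Rightarrow> 'a operator" where
  "op_mult X S T = compose (ell2 X) S T"

definition op_adj :: "'a set \<Rightarrow> 'a operator \<Rightarrow> 'a operator" where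
  "op_adj X T = (THE S. S \<in> bounded_ops X \<and>
     (\<forall>\<xi> \<in> ell2 X. \<forall>\<eta> \<in> ell2 X. ell2_inner X (T \<xi>) \<eta> = ell2_inner X \<xi> (S \<eta>)))"

definition op_norm :: "'a set \<Rightarrow> 'a operator \<Rightarrow> real" where
  "op_norm X T = (SUP \<xi> \<in> {\<xi> \<in> ell2 X. ell2_norm X \<xi> \<le> 1}. ell2_norm X (T \<xi>))"

section \<open>Reduced twisted group C*-algebras and their tracial states\<close>

text \<open>Concrete C*-algebras: norm-closed *-subalgebras of the bounded operators.\<close>

definition cstar_subalgebra :: "'a set \<Rightarrow> 'a operator set \<Rightarrow> bool" where
  "cstar_subalgebra X A \<longleftrightarrow>
     A \<subseteq> bounded_ops X \<and> A \<noteq> {} \<and>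
     (\<forall>S \<in> A. \<forall>T \<in> A. op_add X S T \<in> A \<and> op_mult X S T \<in> A) \<and>
     (\<forall>c. \<forall>T \<in> A. op_scale X c T \<in> A) \<and>
     (\<forall>T \<in> A. op_adj X T \<in> A) \<and>
     (\<forall>T \<in> bounded_ops X.
        (\<forall>\<epsilon> > 0. \<exists>S \<in> A. op_norm X (op_add X T (op_scale X (-1) S)) < \<epsilon>) \<longrightarrow> T \<in> A)"

definition cstar_generated :: "'a set \<Rightarrow> 'a operator set \<Rightarrow> 'a operator set" where
  "cstar_generated X M = \<Inter> {A. cstar_subalgebra X A \<and> M \<subseteq> A}"

definition twisted_regular_rep ::
    "('a, 'b) monoid_scheme \<Rightarrow> ('a \<Rightarrow> 'a \<Rightarrow> complex) \<Rightarrow> 'a \<Rightarrow> 'a operator" where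
  "twisted_regular_rep G \<sigma> g = (\<lambda>\<xi> \<in> ell2 (carrier G). \<lambda>h.
     if h \<in> carrier G
     then \<sigma> g (inv\<^bsub>G\<^esub> g \<otimes>\<^bsub>G\<^esub> h) * \<xi> (inv\<^bsub>G\<^esub> g \<otimes>\<^bsub>G\<^esub> h) else 0)"

definition reduced_cstar ::
    "('a, 'b) monoid_scheme \<Rightarrow> ('a \<Rightarrow> 'a \<Rightarrow> complex) \<Rightarrow> 'a operator set" where
  "reduced_cstar G \<sigma> = cstar_generated (carrier G) (twisted_regular_rep G \<sigma> ` carrier G)"

text \<open>States are meant on a C*-algebra \<open>A\<close> containing the identity operator, where a positive
  functional has norm one iff it is unital. They are extensional on \<open>A\<close>, so that uniqueness in
  HOL means uniqueness as functionals on \<open>A\<close>.\<close>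

definition tracial_state :: "'a set \<Rightarrow> 'a operator set \<Rightarrow> ('a operator \<Rightarrow> complex) \<Rightarrow> bool" where
  "tracial_state X A \<tau> \<longleftrightarrow>
     \<tau> \<in> extensional A \<and>
     (\<forall>S \<in> A. \<forall>T \<in> A. \<tau> (op_add X S T) = \<tau> S + \<tau> T) \<and>
     (\<forall>c. \<forall>T \<in> A. \<tau> (op_scale X c T) = c * \<tau> T) \<and>
     (\<forall>T \<in> A. \<tau> (op_mult X (op_adj X T) T) \<in> \<real>\<^sub>\<ge>\<^sub>0) \<and>
     \<tau> (op_id X) = 1 \<and>
     (\<forall>S \<in> A. \<forall>T \<in> A. \<tau> (op_mult X S T) = \<tau> (op_mult X T S))"

definition unique_trace_property ::
    "('a, 'b) monoid_scheme \<Rightarrow> ('a \<Rightarrow> 'a \<Rightarrow> complex) \<Rightarrow> bool" where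
  "unique_trace_property G \<sigma> \<longleftrightarrow>
     (\<exists>!\<tau>. tracial_state (carrier G) (reduced_cstar G \<sigma>) \<tau>)"

definition group_unique_trace_property :: "('a, 'b) monoid_scheme \<Rightarrow> bool" where
  "group_unique_trace_property G \<longleftrightarrow> unique_trace_property G (\<lambda>_ _. 1)"

definition K_UT :: "('a, 'b) monoid_scheme set" where
  "K_UT = {G. group G \<and>
     (\<forall>\<sigma> \<in> cocycles2 G. unique_trace_property G \<sigma> \<longleftrightarrow> Kleppner G \<sigma>)}"

end

theory Submission
  imports Defs "HOL-Algebra.Generated_Groups"
begin

text \<open>The argument has a dynamical half, about means on \<open>G\<close>, and a half about operators.

Means on \<open>G\<close> form a compact convex semigroup under convolution. Let \<open>K\<close> be a minimal closed
left ideal of it (\<open>min_ideal\<close>), and let \<open>rad\<close> be the normal subgroup of those elements of \<open>G\<close> whose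
translation fixes \<open>K\<close> pointwise. Every point of \<open>K\<close> is a \<open>rad\<close>-invariant mean, so \<open>rad\<close> is amenable. Conversely the
points of \<open>K\<close> fixed by an amenable normal subgroup form a nonempty closed left ideal, which is all of
\<open>K\<close> by minimality; so \<open>rad\<close> is the amenable radical (\<open>amenable_radical_eq_rad\<close>), and the same
argument shows that \<open>G / rad\<close> has no nontrivial amenable normal subgroup. An element with a finite
conjugacy class modulo \<open>rad\<close> also lies in \<open>rad\<close>: the average of its conjugates commutes with convolution,
hence fixes \<open>K\<close>, hence each conjugate fixes the extreme points of \<open>K\<close>. So \<open>G / rad\<close> is ICC and the
FC-hypercenter is contained in the amenable radical.

A trace on the twisted group algebra vanishes at every \<open>t\<close> outside \<open>rad\<close>
(\<open>trace_vanishes_off_rad\<close>). The states of the algebra of all bounded operators that extend the trace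
restrict, on multiplication operators, to a closed left ideal of means; its convolution with a point of
\<open>K\<close> is therefore the whole of \<open>K\<close>. Choosing an extreme point \<open>y\<close> of \<open>K\<close> moved by \<open>t\<close>, one gets an
extension whose mean is concentrated on a set \<open>D\<close> while the preimage of \<open>D\<close> under left multiplication by
\<open>t\<close> is null, and this forces the value at \<open>t\<close> to be zero.

On the FC-hypercenter, Kleppner's condition settles the elements with a finite conjugacy class. If
the trace vanishes on a normal subgroup \<open>N\<close> off the identity and \<open>g\<close> has an infinite class that is finite modulo
\<open>N\<close>, then infinitely many conjugates of \<open>g\<close> are orthogonal in the Hilbert space of the trace, and Bessel's
inequality kills the value at \<open>g\<close>. A maximal such \<open>N\<close> has an ICC quotient, so it contains the
FC-hypercenter (\<open>trace_vanishes_on_FC_hypercenter\<close>). If the FC-hypercenter is the amenable radical, only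
the canonical trace is left.

In the other directions, a nontrivial \<open>\<sigma>\<close>-regular element with a finite class gives a nonscalar central
element and hence a second trace (\<open>Kleppner_if_unique_trace\<close>), and an amenable normal subgroup \<open>N\<close> gives
the trace that is the indicator function of \<open>N\<close> on group elements
(\<open>trace_of_amenable_normal_subgroup\<close>). The first equivalence of the theorem follows by
comparing the amenable radical of \<open>G\<close> with that of \<open>G\<close> modulo its FC-hypercenter.\<close>

section \<open>Compactness in spaces of functions\<close>

lemma compact_functions:
  fixes S :: "'i \<Rightarrow> 'b::topological_space set"
  assumes "\<And>i. compact (S i)"
  shows "compact {f. \<forall>i. f i \<in> S i}"
proof -
  have "compactin (product_topology (\<lambda>i::'i. euclidean :: 'b topology) UNIV) (PiE UNIV S)"
    using assms by (simp add: compactin_PiE compactin_euclidean_iff)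
  moreover have "PiE UNIV S = {f. \<forall>i. f i \<in> S i}"
    by auto
  ultimately show ?thesis
    by (simp add: euclidean_product_topology compactin_euclidean_iff)
qed

lemma continuous_on_coordinate [continuous_intros]:
  "continuous_on S (\<lambda>x::'i \<Rightarrow> 'b::topological_space. x i)"
  by (rule continuous_on_subset[OF continuous_on_product_coordinates]) simp

text \<open>Zorn's lemma for closed sets: the intersection of a chain of nonempty closed subsets of a compact set is
nonempty. It yields both minimal left ideals and extreme points.\<close>
lemma minimal_closed_subset:
  fixes K :: "'b::topological_space set"
  assumes K: "compact K" "closed K" "K \<noteq> {}" "P K"
    and inter: "\<And>C. C \<noteq> {} \<Longrightarrow> (\<And>S. S \<in> C \<Longrightarrow> S \<subseteq> K \<and> P S) \<Longrightarrow> P (\<Inter>C)"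
  obtains M where "closed M" "M \<noteq> {}" "M \<subseteq> K" "P M"
    "\<And>S. closed S \<Longrightarrow> S \<noteq> {} \<Longrightarrow> S \<subseteq> M \<Longrightarrow> P S \<Longrightarrow> S = M"
proof -
  define V where "V S \<longleftrightarrow> closed S \<and> S \<noteq> {} \<and> S \<subseteq> K \<and> P S" for S
  have "\<exists>U\<in>uminus ` Collect V. \<forall>X\<in>uminus ` Collect V. U \<subseteq> X \<longrightarrow> X = U"
  proof (rule subset_Zorn_nonempty)
    show "uminus ` Collect V \<noteq> {}"
      using K by (auto simp: V_def)
    fix C assume C: "C \<noteq> {}" "subset.chain (uminus ` Collect V) C"
    define D where "D = uminus ` C"
    have V: "V S" if "S \<in> D" for S
      using that C(2) by (auto simp: D_def subset.chain_def subset_iff image_iff)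
    have ch: "S \<subseteq> T \<or> T \<subseteq> S" if "S \<in> D" "T \<in> D" for S T
      using that C(2) by (fastforce simp: D_def subset.chain_def)
    have ne: "D \<noteq> {}" using C by (auto simp: D_def)
    have fin: "\<exists>S\<in>D. S \<subseteq> \<Inter>F" if "finite F" "F \<subseteq> D" "F \<noteq> {}" for F
      using that(1,3,2)
    proof (induction F rule: finite_ne_induct)
      case (singleton x) then show ?case by auto
    next
      case (insert x F)
      then obtain S where S: "S \<in> D" "S \<subseteq> \<Inter>F" by auto
      have "S \<subseteq> x \<or> x \<subseteq> S" using ch[OF S(1), of x] insert by auto
      then show ?case using S insert by (metis Inter_insert insert_subset le_inf_iff order_refl order_trans)
    qed
    have "K \<inter> \<Inter>D \<noteq> {}"
    proof (rule compact_imp_fip[OF K(1)])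
      show "closed T" if "T \<in> D" for T using V[OF that] by (simp add: V_def)
      fix F assume F: "finite F" "F \<subseteq> D"
      show "K \<inter> \<Inter>F \<noteq> {}"
      proof (cases "F = {}")
        case True then show ?thesis using K by auto
      next
        case False
        with fin[OF F] obtain S where "S \<in> D" "S \<subseteq> \<Inter>F" by auto
        then show ?thesis using V[of S] unfolding V_def by blast
      qed
    qed
    moreover have "closed (\<Inter>D)" using V by (intro closed_Inter) (simp add: V_def)
    moreover have "P (\<Inter>D)" using inter[OF ne] V by (simp add: V_def)
    moreover have "\<Inter>D \<subseteq> K" 
    proof -
      obtain S where "S \<in> D" using ne by blast
      then show ?thesis using V[of S] Inter_lower[of S D] unfolding V_def by (meson subset_trans)
    qed
    ultimately have VD: "V (\<Inter>D)"
      unfolding V_def by (simp add: inf.absorb2)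
    have "\<Union>C = - \<Inter>D" by (auto simp: D_def)
    then show "\<Union>C \<in> uminus ` Collect V" using VD by blast
  qed
  then obtain U where U: "U \<in> uminus ` Collect V" "\<forall>X\<in>uminus ` Collect V. U \<subseteq> X \<longrightarrow> X = U"
    by (rule bexE)
  from U(1) obtain M where M: "V M" "U = - M" by (rule imageE) simp
  show thesis
  proof (rule that[of M])
    show "closed M" "M \<noteq> {}" "M \<subseteq> K" "P M" using M(1) unfolding V_def by simp_all
    fix S assume S: "closed S" "S \<noteq> {}" "S \<subseteq> M" "P S"
    have "S \<subseteq> K" using S(3) M(1) unfolding V_def by (meson subset_trans)
    then have "V S" using S unfolding V_def by simp
    moreover have "U \<subseteq> - S" using S(3) M(2) by (simp add: Compl_subset_Compl_iff)
    ultimately have "- S = U" using U(2) by (meson imageI mem_Collect_eq)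
    then show "S = M" using M(2) by (simp add: compl_eq_compl_iff)
  qed
qed

definition extreme_in :: "('i \<Rightarrow> real) set \<Rightarrow> ('i \<Rightarrow> real) \<Rightarrow> bool" where
  "extreme_in L y \<longleftrightarrow> y \<in> L \<and>
     (\<forall>a\<in>L. \<forall>b\<in>L. \<forall>s. 0 < s \<and> s < 1 \<and> (\<forall>i. y i = s * a i + (1 - s) * b i) \<longrightarrow> a = y)"

text \<open>The faces of \<open>L\<close>: they contain, with a point, every segment of \<open>L\<close> through that point.\<close>
definition extremal_subset :: "('i \<Rightarrow> real) set \<Rightarrow> ('i \<Rightarrow> real) set \<Rightarrow> bool" where
  "extremal_subset L F \<longleftrightarrow> F \<subseteq> L \<and>
     (\<forall>y\<in>F. \<forall>a\<in>L. \<forall>b\<in>L. \<forall>s. 0 < s \<and> s < 1 \<and> (\<forall>i. y i = s * a i + (1 - s) * b i)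
        \<longrightarrow> a \<in> F \<and> b \<in> F)"

lemma extremal_subsetD:
  assumes "extremal_subset L F" "y \<in> F" "a \<in> L" "b \<in> L" "0 < s" "s < 1"
    "\<And>i. y i = s * a i + (1 - s) * b i"
  shows "a \<in> F" "b \<in> F"
  using assms unfolding extremal_subset_def by meson+

text \<open>An average of two values equals the maximum only if both values do.\<close>
lemma extremal_argmax:
  assumes F: "extremal_subset L F" and "compact F" "F \<noteq> {}"
    and cont: "continuous_on UNIV l"
    and aff: "\<And>y a b s. (\<forall>i. y i = s * a i + (1 - s) * b i) \<Longrightarrow> l y = s * l a + (1 - s) * (l b :: real)"
  shows "\<exists>c. extremal_subset L {y \<in> F. l y = c} \<and> {y \<in> F. l y = c} \<noteq> {} \<and> (\<forall>y\<in>F. l y \<le> c)"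
proof -
  have lF: "continuous_on F l" using cont continuous_on_subset by blast
  have FL: "F \<subseteq> L" using F unfolding extremal_subset_def by (rule conjunct1)
  obtain y0 where y0: "y0 \<in> F" "\<And>y. y \<in> F \<Longrightarrow> l y \<le> l y0"
    using continuous_attains_sup[OF assms(2,3) lF] by blast
  have "extremal_subset L {y \<in> F. l y = l y0}"
    unfolding extremal_subset_def
  proof (intro conjI ballI allI impI)
    show "{y \<in> F. l y = l y0} \<subseteq> L" using FL by blast
    fix y a b s
    assume y: "y \<in> {y \<in> F. l y = l y0}" and ab: "a \<in> L" "b \<in> L"
      and s: "0 < s \<and> s < 1 \<and> (\<forall>i. y i = s * a i + (1 - s) * b i)"
    have abF: "a \<in> F" "b \<in> F" using extremal_subsetD[OF F _ ab, of y s] y s by auto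
    have e: "l y0 = s * l a + (1 - s) * l b" using aff[of y s a b] s y by auto
    have le: "l a \<le> l y0" "l b \<le> l y0" using y0 abF by auto
    have "s * (l y0 - l a) + (1 - s) * (l y0 - l b) = 0" using e by (simp add: algebra_simps)
    moreover have "s * (l y0 - l a) \<ge> 0" "(1 - s) * (l y0 - l b) \<ge> 0" using s le by auto
    ultimately have "s * (l y0 - l a) = 0" "(1 - s) * (l y0 - l b) = 0" by linarith+
    then have "l a = l y0" "l b = l y0" using s by auto
    then show "a \<in> {y \<in> F. l y = l y0}" "b \<in> {y \<in> F. l y = l y0}" using abF by auto
  qed
  then show ?thesis using y0 by blast
qed

text \<open>The proof of the Krein-Milman theorem: a minimal closed extremal subset of the set of maximizers is a
single point, because each coordinate is constant on it.\<close>
lemma extreme_point_maximizing: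
  fixes L :: "('i \<Rightarrow> real) set"
  assumes L: "compact L" "closed L" "L \<noteq> {}"
    and cont: "continuous_on UNIV l"
    and aff: "\<And>y a b s. (\<forall>i. y i = s * a i + (1 - s) * b i) \<Longrightarrow> l y = s * l a + (1 - s) * (l b :: real)"
  obtains y where "extreme_in L y" "\<And>x. x \<in> L \<Longrightarrow> l x \<le> l y"
proof -
  have LL: "extremal_subset L L" unfolding extremal_subset_def by simp
  obtain c where c: "extremal_subset L {y \<in> L. l y = c}" "{y \<in> L. l y = c} \<noteq> {}"
     "\<And>y. y \<in> L \<Longrightarrow> l y \<le> c"
    using extremal_argmax[OF LL L(1,3) cont aff] by blast
  define F where "F = {y \<in> L. l y = c}"
  have clF: "closed F"
    unfolding F_def using L(2) closed_Collect_eq[OF cont continuous_on_const, of c]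
    by (simp add: Collect_conj_eq closed_Int)
  have coF: "compact F" using L(1) clF compact_Int_closed[of L F] by (simp add: F_def Int_absorb1 inf.absorb2)
  obtain M where M: "closed M" "M \<noteq> {}" "M \<subseteq> F" "extremal_subset L M"
    and min: "\<And>S. closed S \<Longrightarrow> S \<noteq> {} \<Longrightarrow> S \<subseteq> M \<Longrightarrow> extremal_subset L S \<Longrightarrow> S = M"
  proof (rule minimal_closed_subset[OF coF clF, of "extremal_subset L"])
    show "F \<noteq> {}" "extremal_subset L F" using c by (auto simp: F_def)
    fix C :: "('i \<Rightarrow> real) set set" assume C: "C \<noteq> {}" "\<And>S. S \<in> C \<Longrightarrow> S \<subseteq> F \<and> extremal_subset L S"
    show "extremal_subset L (\<Inter>C)"
      unfolding extremal_subset_def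
    proof (intro conjI ballI allI impI InterI)
      obtain S where "S \<in> C" using C by blast
      then show "\<Inter>C \<subseteq> L" using C(2)[of S] by (auto simp: F_def)
    next
      fix y a b s S assume y: "y \<in> \<Inter>C" and ab: "a \<in> L" "b \<in> L" and S: "S \<in> C"
        and s: "0 < s \<and> s < 1 \<and> (\<forall>i. y i = s * a i + (1 - s) * b i)"
      have "extremal_subset L S" "y \<in> S" using C(2) S y by auto
      from extremal_subsetD[OF this ab, of s] s show "a \<in> S" "b \<in> S" by auto
    qed
  qed blast
  have coM: "compact M" using coF M compact_Int_closed[of F M] by (simp add: inf.absorb2)
  have uniq: "a = b" if ab: "a \<in> M" "b \<in> M" for a b
  proof
    fix i
    obtain d where d: "extremal_subset L {y \<in> M. y i = d}" "{y \<in> M. y i = d} \<noteq> {}"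
      using extremal_argmax[OF M(4) coM M(2) continuous_on_coordinate[of UNIV i]] by blast
    have "closed {y \<in> M. y i = d}"
      using M(1) closed_Collect_eq[OF continuous_on_coordinate continuous_on_const, of i d]
      by (simp add: Collect_conj_eq closed_Int)
    from min[OF this d(2) _ d(1)] have "{y \<in> M. y i = d} = M" by auto
    then have "a \<in> {y \<in> M. y i = d}" "b \<in> {y \<in> M. y i = d}" using ab by simp_all
    then show "a i = b i" by simp
  qed
  obtain y where y: "y \<in> M" using M by auto
  have "extreme_in L y"
    unfolding extreme_in_def
  proof (intro conjI ballI allI impI)
    show "y \<in> L" using y M by (auto simp: F_def)
    fix a b s assume "a \<in> L" "b \<in> L" "0 < s \<and> s < 1 \<and> (\<forall>i. y i = s * a i + (1 - s) * b i)"
    then have "a \<in> M" using extremal_subsetD[OF M(4) y] by metis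
    then show "a = y" using uniq y by auto
  qed
  moreover have "l y = c" using y M by (auto simp: F_def)
  ultimately show thesis using that c by auto
qed

section \<open>Means and their convolution\<close>

abbreviation bdd :: "'a set \<Rightarrow> ('a \<Rightarrow> real) \<Rightarrow> bool" where
  "bdd X f \<equiv> bounded (f ` X)"

lemma bddI: "(\<And>x. x \<in> X \<Longrightarrow> \<bar>f x\<bar> \<le> c) \<Longrightarrow> bdd X f"
  by (auto simp: bounded_iff)

lemma bddE:
  assumes "bdd X f" obtains c where "c \<ge> 0" "\<And>x. x \<in> X \<Longrightarrow> \<bar>f x\<bar> \<le> c"
proof -
  obtain c where c: "\<And>x. x \<in> X \<Longrightarrow> \<bar>f x\<bar> \<le> c"
    using assms by (auto simp: bounded_iff)
  have "\<bar>f x\<bar> \<le> \<bar>c\<bar>" if "x \<in> X" for x using c[OF that] by linarith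
  then show thesis using that[of "\<bar>c\<bar>"] by simp
qed

lemma bdd_cong: "(\<And>x. x \<in> X \<Longrightarrow> f x = g x) \<Longrightarrow> bdd X f = bdd X g"
  by (metis image_cong)

lemma bdd_const [simp]: "bdd X (\<lambda>_. c)"
  by (rule bddI[of _ _ "\<bar>c\<bar>"]) simp

lemma bdd_cmult [simp]: assumes "bdd X f" shows "bdd X (\<lambda>x. c * f x)"
proof -
  obtain b where "b \<ge> 0" "\<And>x. x \<in> X \<Longrightarrow> \<bar>f x\<bar> \<le> b" using bddE[OF assms] by blast
  then show ?thesis by (intro bddI[of _ _ "\<bar>c\<bar> * b"]) (simp add: abs_mult mult_left_mono)
qed

lemma bdd_add [simp]: assumes "bdd X f" "bdd X g" shows "bdd X (\<lambda>x. f x + g x)"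
proof -
  obtain b where "b \<ge> 0" "\<And>x. x \<in> X \<Longrightarrow> \<bar>f x\<bar> \<le> b" using bddE[OF assms(1)] by blast
  moreover obtain c where "c \<ge> 0" "\<And>x. x \<in> X \<Longrightarrow> \<bar>g x\<bar> \<le> c" using bddE[OF assms(2)] by blast
  ultimately show ?thesis by (intro bddI[of _ _ "b + c"]) fastforce
qed

lemma bdd_diff [simp]: assumes "bdd X f" "bdd X g" shows "bdd X (\<lambda>x. f x - g x)"
  using bdd_add[OF assms(1) bdd_cmult[OF assms(2), of "-1"]] by simp

lemma bdd_mult [simp]: assumes "bdd X f" "bdd X g" shows "bdd X (\<lambda>x. f x * g x)"
proof -
  obtain b where "b \<ge> 0" "\<And>x. x \<in> X \<Longrightarrow> \<bar>f x\<bar> \<le> b" using bddE[OF assms(1)] by blast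
  moreover obtain c where "c \<ge> 0" "\<And>x. x \<in> X \<Longrightarrow> \<bar>g x\<bar> \<le> c" using bddE[OF assms(2)] by blast
  ultimately show ?thesis by (intro bddI[of _ _ "b * c"]) (simp add: abs_mult mult_mono)
qed

lemma bdd_indicator [simp]: "bdd X (indicator E)"
  by (rule bddI[of _ _ 1]) (simp add: indicator_def)

lemma bdd_sum [simp]: "(\<And>i. i \<in> I \<Longrightarrow> bdd X (f i)) \<Longrightarrow> bdd X (\<lambda>x. \<Sum>i\<in>I. f i x)"
  by (induction I rule: infinite_finite_induct) auto

text \<open>Giving unbounded functions the value zero makes the set of means a closed subset of a product
  of compact intervals.\<close>

definition means :: "'a set \<Rightarrow> (('a \<Rightarrow> real) \<Rightarrow> real) set" where
  "means X = {m. (\<forall>f. \<not> bdd X f \<longrightarrow> m f = 0) \<and> m (\<lambda>_. 1) = 1 \<and>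
     (\<forall>f. bdd X f \<longrightarrow>
        (\<forall>c. m (\<lambda>x. c * f x) = c * m f) \<and>
        (\<forall>f'. bdd X f' \<longrightarrow> m (\<lambda>x. f x + f' x) = m f + m f') \<and>
        ((\<forall>x\<in>X. 0 \<le> f x) \<longrightarrow> 0 \<le> m f))}"

lemma meansI:
  assumes "\<And>f. \<not> bdd X f \<Longrightarrow> m f = 0" "m (\<lambda>_. 1) = 1"
    "\<And>f c. bdd X f \<Longrightarrow> m (\<lambda>x. c * f x) = c * m f"
    "\<And>f f'. bdd X f \<Longrightarrow> bdd X f' \<Longrightarrow> m (\<lambda>x. f x + f' x) = m f + m f'"
    "\<And>f. bdd X f \<Longrightarrow> (\<And>x. x \<in> X \<Longrightarrow> 0 \<le> f x) \<Longrightarrow> 0 \<le> m f"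
  shows "m \<in> means X"
  using assms by (simp add: means_def)

lemma mean_unbounded: "m \<in> means X \<Longrightarrow> \<not> bdd X f \<Longrightarrow> m f = 0"
  and mean_one: "m \<in> means X \<Longrightarrow> m (\<lambda>_. 1) = 1"
  and mean_scale: "m \<in> means X \<Longrightarrow> bdd X f \<Longrightarrow> m (\<lambda>x. c * f x) = c * m f"
  and mean_add: "m \<in> means X \<Longrightarrow> bdd X f \<Longrightarrow> bdd X f' \<Longrightarrow> m (\<lambda>x. f x + f' x) = m f + m f'"
  and mean_nonneg: "m \<in> means X \<Longrightarrow> bdd X f \<Longrightarrow> (\<And>x. x \<in> X \<Longrightarrow> 0 \<le> f x) \<Longrightarrow> 0 \<le> m f"
  by (simp_all add: means_def)

lemma mean_const: "m \<in> means X \<Longrightarrow> m (\<lambda>_. c) = c"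
  using mean_scale[of m X "\<lambda>_. 1" c] mean_one[of m X] by simp

lemma mean_diff:
  "m \<in> means X \<Longrightarrow> bdd X f \<Longrightarrow> bdd X g \<Longrightarrow> m (\<lambda>x. f x - g x) = m f - m g"
  using mean_add[of m X f "\<lambda>x. -1 * g x"] mean_scale[of m X g "-1"] bdd_cmult[of g X "-1"] by simp

lemma mean_mono:
  assumes "m \<in> means X" "bdd X f" "bdd X g" "\<And>x. x \<in> X \<Longrightarrow> f x \<le> g x"
  shows "m f \<le> m g"
  using mean_nonneg[of m X "\<lambda>x. g x - f x"] mean_diff[of m X g f] assms by simp

lemma mean_cong:
  assumes "m \<in> means X" "\<And>x. x \<in> X \<Longrightarrow> f x = g x"
  shows "m f = m g"
proof (cases "bdd X f")
  case True
  then have "bdd X g" using bdd_cong[of X f g] assms by simp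
  then show ?thesis using mean_mono[OF assms(1)] True assms(2) by (intro antisym) auto
next
  case False
  then have "\<not> bdd X g" using bdd_cong[of X f g] assms by simp
  then show ?thesis using False assms mean_unbounded by metis
qed

lemma mean_abs_le:
  assumes "m \<in> means X" "\<And>x. x \<in> X \<Longrightarrow> \<bar>f x\<bar> \<le> c"
  shows "\<bar>m f\<bar> \<le> c"
proof -
  have b: "bdd X f" using assms(2) by (rule bddI)
  have "m f \<le> m (\<lambda>_. c)" by (rule mean_mono[OF assms(1) b]) (use assms(2) in force)+
  moreover have "m (\<lambda>_. - c) \<le> m f" by (rule mean_mono[OF assms(1) _ b]) (use assms(2) in force)+
  ultimately show ?thesis by (simp add: mean_const[OF assms(1)])
qed

lemma mean_sum:
  assumes "m \<in> means X" "\<And>i. i \<in> I \<Longrightarrow> bdd X (f i)"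
  shows "m (\<lambda>x. \<Sum>i\<in>I. f i x) = (\<Sum>i\<in>I. m (f i))"
  using assms(2)
proof (induction I rule: infinite_finite_induct)
  case (insert i I)
  then show ?case using mean_add[OF assms(1), of "f i" "\<lambda>x. \<Sum>i\<in>I. f i x"] by simp
qed (simp_all add: mean_const[OF assms(1)])

lemma closed_means: "closed (means X)"
  unfolding means_def
  by (intro closed_Collect_conj closed_Collect_all closed_Collect_imp closed_Collect_eq
      closed_Collect_le open_Collect_const continuous_intros)

lemma compact_means: "compact (means X)"
proof -
  have "\<exists>c. bdd X f \<longrightarrow> (\<forall>x\<in>X. \<bar>f x\<bar> \<le> c)" for f :: "'a \<Rightarrow> real"
    by (metis bddE)
  then obtain c where c: "\<And>f x. bdd X f \<Longrightarrow> x \<in> X \<Longrightarrow> \<bar>f x\<bar> \<le> c f" for f :: "'a \<Rightarrow> real"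
    by metis
  define S where "S f = (if bdd X f then {- c f..c f} else {0})" for f
  have "compact {m. \<forall>f. m f \<in> S f}"
    by (rule compact_functions) (simp add: S_def)
  moreover have "means X \<subseteq> {m. \<forall>f. m f \<in> S f}"
  proof clarify
    fix m f assume m: "m \<in> means X"
    show "m f \<in> S f"
    proof (cases "bdd X f")
      case True
      have "\<bar>m f\<bar> \<le> c f" by (rule mean_abs_le[OF m]) (rule c[OF True])
      then show ?thesis using True by (auto simp: S_def)
    qed (simp add: S_def mean_unbounded[OF m])
  qed
  ultimately show ?thesis
    using compact_Int_closed[OF _ closed_means, of "{m. \<forall>f. m f \<in> S f}" X] by (simp add: inf.absorb2)
qed

definition point_mean :: "'a set \<Rightarrow> 'a \<Rightarrow> ('a \<Rightarrow> real) \<Rightarrow> real" where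
  "point_mean X x f = (if bdd X f then f x else 0)"

lemma point_mean: "x \<in> X \<Longrightarrow> point_mean X x \<in> means X"
  by (rule meansI) (simp_all add: point_mean_def)

lemma convex_comb_means:
  assumes "m \<in> means X" "n \<in> means X" "0 \<le> s" "s \<le> 1"
  shows "(\<lambda>f. s * m f + (1 - s) * n f) \<in> means X"
proof (rule meansI)
  fix f assume f: "bdd X f" "\<And>x. x \<in> X \<Longrightarrow> 0 \<le> f x"
  then have "0 \<le> s * m f" "0 \<le> (1 - s) * n f"
    using assms mean_nonneg[of m X f] mean_nonneg[of n X f] by simp_all
  then show "0 \<le> s * m f + (1 - s) * n f" by linarith
qed (use assms in \<open>simp_all add: mean_unbounded mean_one mean_scale mean_add algebra_simps\<close>)

context group
begin

text \<open>The convolution of \<open>m\<close> and \<open>x\<close> is the barycenter, with respect to \<open>m\<close>, of the translates of \<open>x\<close>. Outside the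
bounded functions all means are zero, which the definition has to preserve.\<close>
definition conv :: "(('a \<Rightarrow> real) \<Rightarrow> real) \<Rightarrow> (('a \<Rightarrow> real) \<Rightarrow> real) \<Rightarrow> ('a \<Rightarrow> real) \<Rightarrow> real" where
  "conv m x f = (if bdd (carrier G) f then m (\<lambda>g. x (\<lambda>u. f (g \<otimes> u))) else 0)"

definition translate :: "'a \<Rightarrow> (('a \<Rightarrow> real) \<Rightarrow> real) \<Rightarrow> ('a \<Rightarrow> real) \<Rightarrow> real" where
  "translate g x f = (if bdd (carrier G) f then x (\<lambda>u. f (g \<otimes> u)) else 0)"

lemma bdd_translate [simp]:
  assumes "bdd (carrier G) f" "g \<in> carrier G" shows "bdd (carrier G) (\<lambda>u. f (g \<otimes> u))"
proof -
  obtain b where "\<And>x. x \<in> carrier G \<Longrightarrow> \<bar>f x\<bar> \<le> b" using bddE[OF assms(1)] by metis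
  then show ?thesis using assms(2) by (intro bddI[of _ _ b]) simp
qed

lemma bdd_orbit [simp]:
  assumes "x \<in> means (carrier G)" "bdd (carrier G) f"
  shows "bdd (carrier G) (\<lambda>g. x (\<lambda>u. f (g \<otimes> u)))"
proof -
  obtain b where b: "\<And>x. x \<in> carrier G \<Longrightarrow> \<bar>f x\<bar> \<le> b" using bddE[OF assms(2)] by metis
  show ?thesis
    by (rule bddI[of _ _ b], rule mean_abs_le[OF assms(1)]) (simp add: b)
qed

lemma conv_means:
  assumes m: "m \<in> means (carrier G)" and x: "x \<in> means (carrier G)"
  shows "conv m x \<in> means (carrier G)"
proof (rule meansI)
  show "conv m x f = 0" if "\<not> bdd (carrier G) f" for f using that by (simp add: conv_def)
  show "conv m x (\<lambda>_. 1) = 1" by (simp add: conv_def mean_one[OF x] mean_one[OF m])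
next
  fix f c assume f: "bdd (carrier G) f"
  have "m (\<lambda>g. x (\<lambda>u. c * f (g \<otimes> u))) = m (\<lambda>g. c * x (\<lambda>u. f (g \<otimes> u)))"
    by (rule mean_cong[OF m]) (simp add: mean_scale[OF x] f)
  then show "conv m x (\<lambda>x. c * f x) = c * conv m x f"
    by (simp add: conv_def f mean_scale[OF m] x)
next
  fix f f' assume f: "bdd (carrier G) f" and f': "bdd (carrier G) f'"
  have "m (\<lambda>g. x (\<lambda>u. f (g \<otimes> u) + f' (g \<otimes> u))) = m (\<lambda>g. x (\<lambda>u. f (g \<otimes> u)) + x (\<lambda>u. f' (g \<otimes> u)))"
    by (rule mean_cong[OF m]) (simp add: mean_add[OF x] f f')
  then show "conv m x (\<lambda>x. f x + f' x) = conv m x f + conv m x f'"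
    by (simp add: conv_def f f' mean_add[OF m] x)
next
  fix f assume f: "bdd (carrier G) f" "\<And>x. x \<in> carrier G \<Longrightarrow> 0 \<le> f x"
  then show "0 \<le> conv m x f"
    by (simp add: conv_def) (intro mean_nonneg[OF m] mean_nonneg[OF x]; simp add: x)
qed

lemma translate_conv_point:
  assumes "g \<in> carrier G" "x \<in> means (carrier G)"
  shows "translate g x = conv (point_mean (carrier G) g) x"
  using assms by (auto simp: translate_def conv_def point_mean_def)

lemma translate_means:
  assumes "g \<in> carrier G" "x \<in> means (carrier G)"
  shows "translate g x \<in> means (carrier G)"
  using assms by (simp add: translate_conv_point conv_means point_mean)

text \<open>Evaluated at \<open>f\<close>, both sides average \<open>x (\<lambda>u. f (g h u))\<close> over \<open>h\<close> and then over \<open>g\<close>.\<close>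
lemma conv_assoc:
  assumes n: "n \<in> means (carrier G)" and m: "m \<in> means (carrier G)" and x: "x \<in> means (carrier G)"
  shows "conv n (conv m x) = conv (conv n m) x"
proof
  fix f
  show "conv n (conv m x) f = conv (conv n m) x f"
  proof (cases "bdd (carrier G) f")
    case True
    have "conv n (conv m x) f = n (\<lambda>g. conv m x (\<lambda>u. f (g \<otimes> u)))" using True by (simp add: conv_def)
    also have "\<dots> = n (\<lambda>g. m (\<lambda>h. x (\<lambda>u. f (g \<otimes> (h \<otimes> u)))))"
      by (rule mean_cong[OF n]) (simp add: conv_def True)
    also have "\<dots> = n (\<lambda>g. m (\<lambda>h. x (\<lambda>u. f ((g \<otimes> h) \<otimes> u))))"
      by (intro mean_cong[OF n] mean_cong[OF m] mean_cong[OF x]) (simp add: m_assoc)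
    also have "\<dots> = conv (conv n m) x f" using True by (simp add: conv_def x)
    finally show ?thesis .
  qed (simp add: conv_def)
qed

lemma translate_mult:
  assumes "g \<in> carrier G" "h \<in> carrier G" "x \<in> means (carrier G)"
  shows "translate g (translate h x) = translate (g \<otimes> h) x"
proof
  fix f
  have "x (\<lambda>u. f (g \<otimes> (h \<otimes> u))) = x (\<lambda>u. f ((g \<otimes> h) \<otimes> u))"
    by (rule mean_cong[OF assms(3)]) (simp add: m_assoc assms)
  then show "translate g (translate h x) f = translate (g \<otimes> h) x f"
    using assms by (simp add: translate_def)
qed

lemma translate_one:
  assumes "x \<in> means (carrier G)" shows "translate \<one> x = x"
proof
  fix f
  have "x (\<lambda>u. f (\<one> \<otimes> u)) = x f"
    by (rule mean_cong[OF assms]) simp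
  then show "translate \<one> x f = x f"
    using mean_unbounded[OF assms] by (simp add: translate_def)
qed

lemma continuous_conv: "continuous_on S (\<lambda>m. conv m x)"
proof (rule continuous_on_coordinatewise_then_product)
  show "continuous_on S (\<lambda>m. conv m x f)" for f
    by (cases "bdd (carrier G) f") (simp_all add: conv_def continuous_on_coordinate)
qed

lemma continuous_translate: "continuous_on S (translate g)"
proof (rule continuous_on_coordinatewise_then_product)
  show "continuous_on S (\<lambda>x. translate g x f)" for f
    by (cases "bdd (carrier G) f") (simp_all add: translate_def continuous_on_coordinate)
qed

end

section \<open>The amenable radical as the kernel of a minimal ideal\<close>

lemma compact_functions_imp_closed:
  fixes K :: "('i \<Rightarrow> 'b::metric_space) set"
  assumes "compact K" shows "closed K"
proof -
  have "Hausdorff_space (product_topology (\<lambda>i::'i. euclidean :: 'b topology) UNIV)"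
    unfolding Hausdorff_space_product_topology by (simp add: Hausdorff_space_euclidean)
  then show ?thesis
    using assms compactin_imp_closedin[of "euclidean :: ('i \<Rightarrow> 'b) topology" K]
    by (simp add: euclidean_product_topology compactin_euclidean_iff)
qed

lemma closed_fixed_points:
  fixes F :: "('i \<Rightarrow> 'b::t2_space) \<Rightarrow> ('i \<Rightarrow> 'b)"
  assumes "continuous_on UNIV F"
  shows "closed {x. F x = x}"
  unfolding fun_eq_iff
  by (intro closed_Collect_all closed_Collect_eq continuous_on_product_then_coordinatewise[OF assms]
      continuous_on_coordinate)

lemma mean_null_set:
  assumes m: "m \<in> means X" and "m (indicator E) = 0" and F: "bdd X F"
  shows "m (\<lambda>g. indicator E g * F g) = 0"
proof -
  obtain c where c: "c \<ge> 0" "\<And>x. x \<in> X \<Longrightarrow> \<bar>F x\<bar> \<le> c" using bddE[OF F] by blast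
  have "m (\<lambda>g. indicator E g * F g) \<le> m (\<lambda>g. c * indicator E g)"
    by (rule mean_mono[OF m]) (use F c in \<open>auto split: split_indicator simp: abs_le_iff\<close>)
  moreover have "m (\<lambda>g. - c * indicator E g) \<le> m (\<lambda>g. indicator E g * F g)"
    by (rule mean_mono[OF m]) (use F c bdd_cmult[of "indicator E" X "- c"] in
      \<open>auto split: split_indicator simp: abs_le_iff minus_le_iff simp del: mult_minus_left\<close>)
  ultimately show ?thesis
    using assms mean_scale[OF m, of "indicator E" c] mean_scale[OF m, of "indicator E" "- c"]
    by simp
qed

text \<open>Conditioning a mean on a set that it charges; this is what splits a barycenter into two parts.\<close>
lemma conditional_mean:
  assumes m: "m \<in> means X" and pos: "m (indicator E) > 0"
  shows "(\<lambda>f. if bdd X f then m (\<lambda>g. indicator E g * f g) / m (indicator E) else 0) \<in> means X"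
proof (rule meansI)
  fix f c assume f: "bdd X f"
  have "m (\<lambda>g. indicator E g * (c * f g)) = c * m (\<lambda>g. indicator E g * f g)"
    using mean_scale[OF m, of "\<lambda>g. indicator E g * f g" c] f by (simp add: algebra_simps)
  then show "(if bdd X (\<lambda>x. c * f x) then m (\<lambda>g. indicator E g * (c * f g)) / m (indicator E) else 0)
      = c * (if bdd X f then m (\<lambda>g. indicator E g * f g) / m (indicator E) else 0)"
    using f by simp
next
  fix f f' assume f: "bdd X f" "bdd X f'"
  have "m (\<lambda>g. indicator E g * (f g + f' g))
      = m (\<lambda>g. indicator E g * f g) + m (\<lambda>g. indicator E g * f' g)"
    using mean_add[OF m, of "\<lambda>g. indicator E g * f g" "\<lambda>g. indicator E g * f' g"] f
    by (simp add: algebra_simps)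
  then show "(if bdd X (\<lambda>x. f x + f' x) then m (\<lambda>g. indicator E g * (f g + f' g)) / m (indicator E) else 0)
      = (if bdd X f then m (\<lambda>g. indicator E g * f g) / m (indicator E) else 0) +
        (if bdd X f' then m (\<lambda>g. indicator E g * f' g) / m (indicator E) else 0)"
    using f by (simp add: add_divide_distrib)
next
  fix f assume f: "bdd X f" "\<And>x. x \<in> X \<Longrightarrow> 0 \<le> f x"
  then have "0 \<le> m (\<lambda>g. indicator E g * f g)"
    by (intro mean_nonneg[OF m]) simp_all
  then show "0 \<le> (if bdd X f then m (\<lambda>g. indicator E g * f g) / m (indicator E) else 0)"
    using pos by simp
qed (use pos in simp_all)

context group
begin

abbreviation "M \<equiv> means (carrier G)"

text \<open>Closed left ideals take the place of closed convex invariant sets of means: they contain the barycenters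
of their orbits by definition, so no separation theorem is needed to find these.\<close>
definition left_ideal :: "(('a \<Rightarrow> real) \<Rightarrow> real) set \<Rightarrow> bool" where
  "left_ideal L \<longleftrightarrow> L \<subseteq> M \<and> (\<forall>m\<in>M. \<forall>x\<in>L. conv m x \<in> L)"

lemma ex_minimal_left_ideal:
  "\<exists>L. closed L \<and> L \<noteq> {} \<and> left_ideal L \<and>
     (\<forall>S. closed S \<longrightarrow> S \<noteq> {} \<longrightarrow> S \<subseteq> L \<longrightarrow> left_ideal S \<longrightarrow> S = L)"
proof -
  have 1: "left_ideal M" by (simp add: left_ideal_def conv_means)
  have ne: "M \<noteq> {}" using point_mean[of \<one> "carrier G"] by blast
  have 2: "left_ideal (\<Inter>C)" if C: "C \<noteq> {}" "\<And>S. S \<in> C \<Longrightarrow> S \<subseteq> M \<and> left_ideal S" for C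
    unfolding left_ideal_def
  proof (intro conjI ballI InterI)
    obtain S where S: "S \<in> C" using C(1) by blast
    have "\<Inter>C \<subseteq> S" using S by (rule Inter_lower)
    moreover have "S \<subseteq> M" using C(2)[OF S] by (rule conjunct1)
    ultimately show "\<Inter>C \<subseteq> M" by (rule subset_trans)
  next
    fix m x S assume "m \<in> M" "x \<in> \<Inter>C" "S \<in> C"
    moreover from this have "left_ideal S" "x \<in> S" using C(2) by (meson InterD)+
    ultimately show "conv m x \<in> S" unfolding left_ideal_def by (meson)
  qed
  show ?thesis
    by (rule minimal_closed_subset[OF compact_means closed_means ne, of left_ideal]) (use 1 2 in blast)+
qed

definition min_ideal :: "(('a \<Rightarrow> real) \<Rightarrow> real) set" where
  "min_ideal = (SOME L. closed L \<and> L \<noteq> {} \<and> left_ideal L \<and>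
     (\<forall>S. closed S \<longrightarrow> S \<noteq> {} \<longrightarrow> S \<subseteq> L \<longrightarrow> left_ideal S \<longrightarrow> S = L))"

lemma min_ideal_closed: "closed min_ideal"
  and min_ideal_nonempty: "min_ideal \<noteq> {}"
  and min_ideal_left_ideal: "left_ideal min_ideal"
  and min_ideal_minimal:
    "closed S \<Longrightarrow> S \<noteq> {} \<Longrightarrow> S \<subseteq> min_ideal \<Longrightarrow> left_ideal S \<Longrightarrow> S = min_ideal"
  using someI_ex[OF ex_minimal_left_ideal] unfolding min_ideal_def[symmetric] by metis+

lemma min_ideal_means: "x \<in> min_ideal \<Longrightarrow> x \<in> M"
  using min_ideal_left_ideal unfolding left_ideal_def by (meson subsetD)

lemma min_ideal_conv: "m \<in> M \<Longrightarrow> x \<in> min_ideal \<Longrightarrow> conv m x \<in> min_ideal"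
  using min_ideal_left_ideal unfolding left_ideal_def by (meson)

lemma min_ideal_translate: "g \<in> carrier G \<Longrightarrow> x \<in> min_ideal \<Longrightarrow> translate g x \<in> min_ideal"
  by (simp add: translate_conv_point min_ideal_means min_ideal_conv point_mean)

lemma min_ideal_compact: "compact min_ideal"
  using compact_Int_closed[OF compact_means min_ideal_closed, of "carrier G"] min_ideal_means
  by (metis inf.absorb_iff2 subsetI)

text \<open>Convolution with a fixed mean on the right is continuous, so the orbit of \<open>x\<close> under a compact left ideal is a
closed left ideal inside the minimal one.\<close>
lemma left_ideal_orbit:
  assumes K: "compact K" "K \<noteq> {}" "left_ideal K" and x: "x \<in> min_ideal"
  shows "(\<lambda>m. conv m x) ` K = min_ideal"
proof (rule min_ideal_minimal)
  have KM: "K \<subseteq> M" using K(3) by (simp add: left_ideal_def)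
  have "compact ((\<lambda>m. conv m x) ` K)"
    by (rule compact_continuous_image[OF continuous_conv K(1)])
  then show "closed ((\<lambda>m. conv m x) ` K)" by (rule compact_functions_imp_closed)
  show "(\<lambda>m. conv m x) ` K \<noteq> {}" using K(2) by simp
  show sub: "(\<lambda>m. conv m x) ` K \<subseteq> min_ideal" using KM x min_ideal_conv by (meson image_subsetI subsetD)
  show "left_ideal ((\<lambda>m. conv m x) ` K)"
    unfolding left_ideal_def
  proof (intro conjI ballI)
    show "(\<lambda>m. conv m x) ` K \<subseteq> M" using sub min_ideal_means by (meson subsetD subsetI)
    fix n y assume n: "n \<in> M" and "y \<in> (\<lambda>m. conv m x) ` K"
    then obtain m where m: "m \<in> K" "y = conv m x" by (rule_tac imageE)
    have "conv n y = conv (conv n m) x" using m n KM x min_ideal_means by (simp add: conv_assoc subset_iff)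
    moreover have "conv n m \<in> K" using K(3) m n unfolding left_ideal_def by meson
    ultimately show "conv n y \<in> (\<lambda>m. conv m x) ` K" by (rule image_eqI)
  qed
qed

lemma min_ideal_eq_orbit: "x \<in> min_ideal \<Longrightarrow> (\<lambda>m. conv m x) ` M = min_ideal"
  by (rule left_ideal_orbit[OF compact_means]) (use point_mean[of \<one> "carrier G"] in \<open>auto simp: left_ideal_def conv_means\<close>)

text \<open>Convexity is inherited from the set of all means, since \<open>m \<mapsto> conv m x\<close> is affine and onto the ideal.\<close>
lemma min_ideal_convex:
  assumes "a \<in> min_ideal" "b \<in> min_ideal" "0 \<le> s" "s \<le> 1"
  shows "(\<lambda>f. s * a f + (1 - s) * b f) \<in> min_ideal"
proof -
  obtain x where x: "x \<in> min_ideal" using min_ideal_nonempty by blast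
  obtain m where m: "m \<in> M" "a = conv m x" using assms(1) min_ideal_eq_orbit[OF x] by (metis imageE)
  obtain n where n: "n \<in> M" "b = conv n x" using assms(2) min_ideal_eq_orbit[OF x] by (metis imageE)
  have "(\<lambda>f. s * a f + (1 - s) * b f) = conv (\<lambda>f. s * m f + (1 - s) * n f) x"
    by (simp add: m n conv_def fun_eq_iff)
  then show ?thesis using min_ideal_conv[OF convex_comb_means[OF m(1) n(1) assms(3,4)] x] by simp
qed

text \<open>The kernel of the action of \<open>G\<close> on its minimal ideal, which turns out to be the amenable radical.\<close>
definition rad :: "'a set" where
  "rad = {g \<in> carrier G. \<forall>x\<in>min_ideal. translate g x = x}"

lemma translate_inv_cancel:
  assumes "g \<in> carrier G" "x \<in> M"
  shows "translate (inv g) (translate g x) = x" "translate g (translate (inv g) x) = x"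
  using assms by (simp_all add: translate_mult translate_one)

lemma subgroup_rad: "subgroup rad G"
proof
  show "rad \<subseteq> carrier G" by (auto simp: rad_def)
  show "\<one> \<in> rad" using translate_one min_ideal_means by (simp add: rad_def)
  show "x \<otimes> y \<in> rad" if "x \<in> rad" "y \<in> rad" for x y
    using that min_ideal_means by (auto simp: rad_def translate_mult[symmetric])
  show "inv x \<in> rad" if "x \<in> rad" for x
  proof -
    have "translate (inv x) z = z" if z: "z \<in> min_ideal" for z
      using \<open>x \<in> rad\<close> z translate_inv_cancel(1)[of x z] min_ideal_means[OF z] by (simp add: rad_def)
    then show ?thesis using that by (simp add: rad_def)
  qed
qed

lemma normal_rad: "rad \<lhd> G"
  unfolding normal_inv_iff
proof (intro conjI ballI subgroup_rad)
  fix x h assume x: "x \<in> carrier G" and h: "h \<in> rad"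
  have hG: "h \<in> carrier G" using h by (simp add: rad_def)
  have "translate (x \<otimes> h \<otimes> inv x) z = z" if z: "z \<in> min_ideal" for z
  proof -
    have "translate (x \<otimes> h \<otimes> inv x) z = translate x (translate h (translate (inv x) z))"
      using x hG z min_ideal_means by (simp add: translate_mult[symmetric] translate_means m_assoc)
    also have "translate h (translate (inv x) z) = translate (inv x) z"
      using h min_ideal_translate[OF _ z, of "inv x"] x by (simp add: rad_def)
    also have "translate x \<dots> = z" using x z min_ideal_means by (simp add: translate_inv_cancel)
    finally show ?thesis .
  qed
  then show "x \<otimes> h \<otimes> inv x \<in> rad" using x hG by (simp add: rad_def)
qed

text \<open>Translation by \<open>n\<close> passes through the average over \<open>g\<close> because \<open>n g = g (g\<^sup>-\<^sup>1 n g)\<close>.\<close>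
lemma conv_translate_swap:
  assumes n: "n \<in> carrier G" and m: "m \<in> M" and x: "x \<in> M"
    and fixed: "\<And>g. g \<in> carrier G \<Longrightarrow> translate (inv g \<otimes> n \<otimes> g) x = x"
  shows "translate n (conv m x) = conv m x"
proof
  fix f
  show "translate n (conv m x) f = conv m x f"
  proof (cases "bdd (carrier G) f")
    case True
    have "translate n (conv m x) f = m (\<lambda>g. x (\<lambda>u. f (n \<otimes> (g \<otimes> u))))"
      using True n by (simp add: translate_def conv_def)
    also have "\<dots> = m (\<lambda>g. x (\<lambda>u. f (g \<otimes> u)))"
    proof (rule mean_cong[OF m])
      fix g assume g: "g \<in> carrier G"
      have "x (\<lambda>u. f (n \<otimes> (g \<otimes> u))) = x (\<lambda>u. f (n \<otimes> g \<otimes> u))"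
        by (rule mean_cong[OF x]) (simp add: n g m_assoc)
      also have "\<dots> = translate (n \<otimes> g) x f" using True by (simp add: translate_def)
      also have "n \<otimes> g = g \<otimes> (inv g \<otimes> n \<otimes> g)" using n g by (simp add: m_assoc[symmetric])
      also have "translate \<dots> x f = translate g x f"
        using n g x fixed by (simp add: translate_mult[symmetric])
      finally show "x (\<lambda>u. f (n \<otimes> (g \<otimes> u))) = x (\<lambda>u. f (g \<otimes> u))" using True by (simp add: translate_def)
    qed
    finally show ?thesis using True by (simp add: conv_def)
  qed (simp add: translate_def conv_def)
qed

text \<open>The points of the minimal ideal that are fixed by \<open>N\<close> form a closed left ideal, and \<open>conv \<mu> x\<close> is one of
them, so they exhaust the minimal ideal. Invariance of \<open>\<mu>\<close> is asked only on functions that factor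
through \<open>G / rad\<close>: the functions \<open>g \<mapsto> translate g x f\<close> do. This covers amenable normal subgroups both of
\<open>G\<close> and of \<open>G / rad\<close>.\<close>
lemma subset_rad:
  assumes N: "N \<lhd> G" and mu: "\<mu> \<in> M"
    and inv: "\<And>n F. n \<in> N \<Longrightarrow> bdd (carrier G) F \<Longrightarrow>
      (\<And>g r. g \<in> carrier G \<Longrightarrow> r \<in> rad \<Longrightarrow> F (g \<otimes> r) = F g) \<Longrightarrow> \<mu> (\<lambda>g. F (n \<otimes> g)) = \<mu> F"
  shows "N \<subseteq> rad"
proof -
  have NG: "N \<subseteq> carrier G" using subgroup.subset[OF normal_imp_subgroup[OF N]] .
  have Nc: "inv g \<otimes> n \<otimes> g \<in> N" if "n \<in> N" "g \<in> carrier G" for n g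
    using normal.inv_op_closed1[OF N that(2,1)] .
  define S where "S = {x \<in> min_ideal. \<forall>n\<in>N. translate n x = x}"
  have "S = min_ideal"
  proof (rule min_ideal_minimal)
    have "closed {x. translate n x = x}" for n
      by (rule closed_fixed_points[OF continuous_translate])
    then have "closed {x. \<forall>n. n \<in> N \<longrightarrow> translate n x = x}"
      by (intro closed_Collect_all closed_Collect_imp open_Collect_const)
    from closed_Int[OF min_ideal_closed this] show "closed S"
      by (simp add: S_def Ball_def Collect_conj_eq)
    show "S \<subseteq> min_ideal" by (simp add: S_def)
    obtain x where x: "x \<in> min_ideal" using min_ideal_nonempty by blast
    have xM: "x \<in> M" using x by (rule min_ideal_means)
    have "translate n (conv \<mu> x) = conv \<mu> x" if n: "n \<in> N" for n
    proof
      fix f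
      show "translate n (conv \<mu> x) f = conv \<mu> x f"
      proof (cases "bdd (carrier G) f")
        case True
        define F where "F g = translate g x f" for g
        have nG: "n \<in> carrier G" using n NG by blast
        have F: "F g = x (\<lambda>u. f (g \<otimes> u))" for g using True by (simp add: F_def translate_def)
        have "translate n (conv \<mu> x) f = \<mu> (\<lambda>g. x (\<lambda>u. f (n \<otimes> (g \<otimes> u))))"
          using True nG by (simp add: translate_def conv_def)
        also have "\<dots> = \<mu> (\<lambda>g. F (n \<otimes> g))"
          unfolding F by (intro mean_cong[OF mu] mean_cong[OF xM]) (simp add: nG m_assoc)
        also have "\<dots> = \<mu> F"
        proof (rule inv[OF n])
          show "bdd (carrier G) F" unfolding F using xM True by simp
          fix g r assume g: "g \<in> carrier G" and r: "r \<in> rad"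
          then show "F (g \<otimes> r) = F g"
            using xM x by (simp add: F_def rad_def translate_mult[symmetric])
        qed
        also have "\<dots> = conv \<mu> x f" using True by (simp add: conv_def F_def[abs_def] translate_def)
        finally show ?thesis .
      qed (simp add: translate_def conv_def)
    qed
    then have "conv \<mu> x \<in> S" using x mu by (simp add: S_def min_ideal_conv)
    then show "S \<noteq> {}" by blast
    show "left_ideal S"
      unfolding left_ideal_def
    proof (intro conjI ballI)
      show "S \<subseteq> M" using min_ideal_means by (auto simp: S_def)
      fix m x assume m: "m \<in> M" and x: "x \<in> S"
      then have "translate n (conv m x) = conv m x" if "n \<in> N" for n
        by (intro conv_translate_swap) (use that NG Nc min_ideal_means in \<open>auto simp: S_def\<close>)
      then show "conv m x \<in> S" using m x by (simp add: S_def min_ideal_conv)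
    qed
  qed
  then show ?thesis using NG by (auto simp: S_def rad_def)
qed

text \<open>If \<open>y\<close> is the barycenter of the translates of \<open>x\<close>, conditioning \<open>m\<close> on \<open>E\<close> and on its complement writes \<open>y\<close> as a
convex combination of two points of the ideal. Both must be \<open>y\<close> when \<open>y\<close> is extreme: the translates
of \<open>x\<close> are concentrated at \<open>y\<close>.\<close>
lemma extreme_conv:
  assumes y: "extreme_in min_ideal y" and x: "x \<in> min_ideal" and m: "m \<in> M"
    and eq: "y = conv m x" and f: "bdd (carrier G) f"
  shows "m (\<lambda>g. indicator E g * translate g x f) = m (indicator E) * y f"
proof -
  define F where "F f g = translate g x f" for f g
  have xM: "x \<in> M" using x by (rule min_ideal_means)
  have Fb: "bdd (carrier G) (F f)" if "bdd (carrier G) f" for f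
    using that xM by (simp add: F_def[abs_def] translate_def)
  have yF: "y f = m (F f)" if "bdd (carrier G) f" for f
    using that by (simp add: eq conv_def F_def[abs_def] translate_def)
  have ind: "indicator E g + indicator (- E) g = (1::real)" for g
    by (simp split: split_indicator)
  have split: "m (indicator E) + m (indicator (- E)) = 1"
    using mean_add[OF m, of "indicator E" "indicator (- E)"] mean_one[OF m] by (simp add: ind)
  have splitF: "m (F f) = m (\<lambda>g. indicator E g * F f g) + m (\<lambda>g. indicator (- E) g * F f g)"
    if f: "bdd (carrier G) f" for f
    using mean_add[OF m, of "\<lambda>g. indicator E g * F f g" "\<lambda>g. indicator (- E) g * F f g"] Fb[OF f]
    by (simp add: distrib_right[symmetric] ind)
  have nn: "m (indicator E) \<ge> 0" "m (indicator (- E)) \<ge> 0"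
    by (rule mean_nonneg[OF m]; simp)+
  consider "m (indicator E) = 0" | "m (indicator (- E)) = 0"
    | "m (indicator E) > 0" "m (indicator (- E)) > 0"
    using nn by fastforce
  then show ?thesis
  proof cases
    case 1
    then show ?thesis using mean_null_set[OF m 1 Fb[OF f]] by (simp add: F_def)
  next
    case 2
    then show ?thesis
      using mean_null_set[OF m 2 Fb[OF f]] split splitF[OF f] yF[OF f] by (simp add: F_def)
  next
    case 3
    define a where "a = m (indicator E)"
    define m1 where "m1 f = (if bdd (carrier G) f then m (\<lambda>g. indicator E g * f g) / m (indicator E) else 0)" for f
    define m2 where "m2 f = (if bdd (carrier G) f then m (\<lambda>g. indicator (- E) g * f g) / m (indicator (- E)) else 0)" for f
    have mM: "m1 \<in> M" "m2 \<in> M"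
      unfolding m1_def[abs_def] m2_def[abs_def] using conditional_mean[OF m] 3 by simp_all
    have conv1: "a * conv m1 x f = m (\<lambda>g. indicator E g * F f g)" if "bdd (carrier G) f" for f
      using that 3 xM by (simp add: conv_def m1_def a_def F_def translate_def)
    have conv2: "(1 - a) * conv m2 x f = m (\<lambda>g. indicator (- E) g * F f g)" if "bdd (carrier G) f" for f
    proof -
      have "1 - a = m (indicator (- E))" using split by (simp add: a_def)
      then show ?thesis using that 3 xM by (simp add: conv_def m2_def F_def translate_def)
    qed
    have sum: "y f = a * conv m1 x f + (1 - a) * conv m2 x f" for f
    proof (cases "bdd (carrier G) f")
      case True
      then show ?thesis using conv1 conv2 splitF yF by simp
    qed (simp add: eq conv_def)
    have "conv m1 x = y"
      using y min_ideal_conv[OF mM(1) x] min_ideal_conv[OF mM(2) x] 3 split sum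
      unfolding extreme_in_def a_def by (metis add_less_same_cancel1 less_add_same_cancel1)
    then show ?thesis using conv1[OF f] by (simp add: a_def F_def)
  qed
qed

lemma ex_moved_extreme_point:
  assumes t: "t \<in> carrier G" "t \<notin> rad"
  obtains y where "extreme_in min_ideal y" "translate t y \<noteq> y"
proof -
  obtain x f where x: "x \<in> min_ideal" "translate t x f \<noteq> x f"
    using t by (auto simp: rad_def fun_eq_iff)
  have f: "bdd (carrier G) f"
  proof (rule ccontr)
    assume "\<not> bdd (carrier G) f"
    then show False using x(2) mean_unbounded[OF min_ideal_means[OF x(1)]] by (simp add: translate_def)
  qed
  define s where "s = sgn (x f - translate t x f)"
  define l where "l y = s * (y f - y (\<lambda>u. f (t \<otimes> u)))" for y
  have l: "l y = s * (y f - translate t y f)" for y using f by (simp add: l_def translate_def)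
  have cont: "continuous_on UNIV l"
    unfolding l_def[abs_def] by (intro continuous_intros)
  have aff: "l y = r * l a + (1 - r) * l b" if "\<forall>i. y i = r * a i + (1 - r) * b i" for y a b r
    unfolding l_def that[rule_format, of f] that[rule_format, of "\<lambda>u. f (t \<otimes> u)"]
    by (simp add: algebra_simps)
  obtain y where y: "extreme_in min_ideal y" "\<And>x. x \<in> min_ideal \<Longrightarrow> l x \<le> l y"
    using extreme_point_maximizing[OF min_ideal_compact min_ideal_closed min_ideal_nonempty cont aff] by blast
  have "0 < l x" using x(2) by (simp add: l s_def sgn_if)
  then have "l y \<noteq> 0" using y(2)[OF x(1)] by simp
  then have "translate t y \<noteq> y" by (auto simp: l)
  then show thesis using that y by blast
qed

end

context group
begin

text \<open>The Cesaro means of an orbit are moved by at most \<open>2 \<parallel>f\<parallel> / (k + 1)\<close> in the coordinate \<open>f\<close>. The points with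
this property form decreasing closed sets, and a common point is fixed.\<close>
lemma average_fixed_point:
  fixes A :: "(('a \<Rightarrow> real) \<Rightarrow> real) \<Rightarrow> ('a \<Rightarrow> real) \<Rightarrow> real"
  assumes A_mem: "\<And>x. x \<in> min_ideal \<Longrightarrow> A x \<in> min_ideal" and cont: "continuous_on UNIV A"
    and lin: "\<And>n y d f. A (\<lambda>f. (\<Sum>j<n. y j f) / d) f = (\<Sum>j<(n::nat). A (y j) f) / (d::real)"
  obtains x where "x \<in> min_ideal" "A x = x"
proof -
  obtain x0 where x0: "x0 \<in> min_ideal" using min_ideal_nonempty by blast
  define a where "a k = (A ^^ k) x0" for k
  have a: "a k \<in> min_ideal" for k
    by (induction k) (simp_all add: a_def x0 A_mem)
  define c where "c k f = (\<Sum>j<Suc k. a j f) / real (Suc k)" for k and f :: "'a \<Rightarrow> real"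
  have c: "c k \<in> min_ideal" for k
  proof (induction k)
    case 0
    have "c 0 = a 0" by (simp add: c_def fun_eq_iff)
    then show ?case using a by simp
  next
    case (Suc k)
    define s where "s = real (Suc k) / real (Suc (Suc k))"
    have s: "0 \<le> s" "s \<le> 1" by (simp_all add: s_def)
    have s1: "1 - s = 1 / real (Suc (Suc k))" by (simp add: s_def field_simps)
    have "c (Suc k) f = s * c k f + (1 - s) * a (Suc k) f" for f
    proof -
      have "s * c k f = (\<Sum>j<Suc k. a j f) / real (Suc (Suc k))"
        by (simp add: s_def c_def del: sum.lessThan_Suc of_nat_Suc)
      then show ?thesis by (simp add: s1 c_def add_divide_distrib)
    qed
    then have "c (Suc k) = (\<lambda>f. s * c k f + (1 - s) * a (Suc k) f)" by (rule ext)
    then show ?case using min_ideal_convex[OF Suc a s] by simp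
  qed
  define F where "F k = {x \<in> min_ideal. \<forall>f b. (\<forall>g\<in>carrier G. \<bar>f g\<bar> \<le> b) \<longrightarrow>
      \<bar>A x f - x f\<bar> \<le> 2 * b / real (Suc k)}" for k
  have clF: "closed (F k)" for k
  proof -
    have "closed {x. \<forall>f b. (\<forall>g\<in>carrier G. \<bar>f g\<bar> \<le> b) \<longrightarrow> \<bar>A x f - x f\<bar> \<le> 2 * b / real (Suc k)}"
      by (intro closed_Collect_all closed_Collect_imp open_Collect_const closed_Collect_le continuous_intros
          continuous_on_product_then_coordinatewise[OF cont])
    from closed_Int[OF min_ideal_closed this] show ?thesis by (simp add: F_def Collect_conj_eq)
  qed
  have cF: "c k \<in> F k" for k
    unfolding F_def
  proof (intro CollectI conjI allI impI c)
    fix f :: "'a \<Rightarrow> real" and b assume b: "\<forall>g\<in>carrier G. \<bar>f g\<bar> \<le> b"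
    have Ac: "A (c k) f = (\<Sum>j<Suc k. a (Suc j) f) / real (Suc k)"
      unfolding c_def lin by (simp add: a_def)
    have "A (c k) f - c k f = (\<Sum>j<Suc k. a (Suc j) f - a j f) / real (Suc k)"
      unfolding Ac unfolding c_def by (simp only: sum_subtractf diff_divide_distrib)
    also have "\<dots> = (a (Suc k) f - a 0 f) / real (Suc k)"
      using sum_lessThan_telescope[of "\<lambda>j. a j f" "Suc k"] by (simp only:)
    finally have e: "A (c k) f - c k f = (a (Suc k) f - a 0 f) / real (Suc k)" .
    have "\<bar>a j f\<bar> \<le> b" for j
      by (rule mean_abs_le[OF min_ideal_means[OF a]]) (use b in simp)
    from this[of "Suc k"] this[of 0] have "\<bar>a (Suc k) f - a 0 f\<bar> \<le> 2 * b" by linarith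
    then show "\<bar>A (c k) f - c k f\<bar> \<le> 2 * b / real (Suc k)"
      unfolding e by (simp add: abs_divide divide_right_mono)
  qed
  have dec: "F k \<subseteq> F j" if "j \<le> k" for j k
  proof
    fix x assume x: "x \<in> F k"
    have "\<bar>A x f - x f\<bar> \<le> 2 * b / real (Suc j)" if b: "\<forall>g\<in>carrier G. \<bar>f g\<bar> \<le> b" for f :: "'a \<Rightarrow> real" and b
    proof -
      have "0 \<le> b" using b one_closed by (meson abs_ge_zero order_trans)
      then have "2 * b / real (Suc k) \<le> 2 * b / real (Suc j)" using \<open>j \<le> k\<close> by (intro divide_left_mono) auto
      moreover have "\<bar>A x f - x f\<bar> \<le> 2 * b / real (Suc k)" using x b unfolding F_def by blast
      ultimately show ?thesis by linarith
    qed
    then show "x \<in> F j" using x by (simp add: F_def)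
  qed
  have "min_ideal \<inter> \<Inter>(range F) \<noteq> {}"
  proof (rule compact_imp_fip[OF min_ideal_compact])
    fix C assume C: "finite C" "C \<subseteq> range F"
    then obtain J where J: "finite J" "C = F ` J" by (meson finite_subset_image)
    obtain k where k: "\<And>j. j \<in> J \<Longrightarrow> j \<le> k" using J(1) by (meson finite_nat_set_iff_bounded_le)
    have "c k \<in> \<Inter>C" using J(2) k cF dec by blast
    then show "min_ideal \<inter> \<Inter>C \<noteq> {}" using c by blast
  qed (use clF in blast)
  then obtain x where x: "\<And>k. x \<in> F k" "x \<in> min_ideal" by blast
  have "A x f = x f" for f
  proof (cases "bdd (carrier G) f")
    case True
    then obtain b where b: "b \<ge> 0" "\<And>g. g \<in> carrier G \<Longrightarrow> \<bar>f g\<bar> \<le> b" using bddE by blast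
    have le: "\<bar>A x f - x f\<bar> \<le> 2 * b / real (Suc k)" for k
      using x(1)[of k] b(2) unfolding F_def by blast
    have "(\<lambda>k. 2 * b / real (Suc k)) \<longlonglongrightarrow> 0"
      using tendsto_mult[OF tendsto_const LIMSEQ_inverse_real_of_nat, of "2 * b"] by (simp add: divide_inverse)
    then have "\<bar>A x f - x f\<bar> \<le> 0"
      by (rule LIMSEQ_le_const) (use le in blast)
    then show ?thesis by simp
  next
    case False
    then show ?thesis
      using mean_unbounded[OF min_ideal_means[OF x(2)]] mean_unbounded[OF min_ideal_means[OF A_mem[OF x(2)]]]
      by simp
  qed
  then show thesis using that x(2) by (meson ext)
qed

text \<open>The action of the conjugates of \<open>g\<close> on the minimal ideal, as maps. Counting maps instead of group
elements amounts to working modulo \<open>rad\<close>.\<close>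
definition conj_maps :: "'a \<Rightarrow> ((('a \<Rightarrow> real) \<Rightarrow> real) \<Rightarrow> ('a \<Rightarrow> real) \<Rightarrow> real) set" where
  "conj_maps g = (\<lambda>h. restrict (translate (h \<otimes> g \<otimes> inv h)) min_ideal) ` carrier G"

text \<open>Let \<open>A\<close> be the average of the finitely many maps by which the conjugates of \<open>g\<close> act. Conjugation permutes
these maps, so \<open>A\<close> commutes with convolution and its fixed points form a closed left ideal, which is
nonempty by the averaging argument and hence everything. An extreme point is thus an average of its
images under the conjugates of \<open>g\<close>, so \<open>g\<close> fixes it; but an element outside \<open>rad\<close> moves some extreme
point.\<close>
lemma finite_conj_maps_imp_rad:
  assumes g: "g \<in> carrier G" and fin: "finite (conj_maps g)"
  shows "g \<in> rad"
proof (rule ccontr)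
  assume notrad: "g \<notin> rad"
  define T where "T = conj_maps g"
  have finT: "finite T" using fin by (simp add: T_def)
  define n where "n = real (card T)"
  have Tmem: "restrict (translate (h \<otimes> g \<otimes> inv h)) min_ideal \<in> T" if "h \<in> carrier G" for h
    using that by (simp add: T_def conj_maps_def)
  have "T \<noteq> {}" using Tmem[of \<one>] by auto
  then have n: "n > 0" using finT by (simp add: n_def card_gt_0_iff)
  have "\<exists>h c. h \<in> carrier G \<and> c = h \<otimes> g \<otimes> inv h \<and> \<theta> = restrict (translate c) min_ideal" if "\<theta> \<in> T" for \<theta>
    using that unfolding T_def conj_maps_def by (elim imageE) (intro exI conjI, assumption, rule refl)
  then have "\<forall>\<theta>\<in>T. \<exists>p. fst p \<in> carrier G \<and> snd p = fst p \<otimes> g \<otimes> inv (fst p) \<and>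
      \<theta> = restrict (translate (snd p)) min_ideal"
    by simp
  from bchoice[OF this] obtain p where p: "\<forall>\<theta>\<in>T. fst (p \<theta>) \<in> carrier G \<and>
      snd (p \<theta>) = fst (p \<theta>) \<otimes> g \<otimes> inv (fst (p \<theta>)) \<and> \<theta> = restrict (translate (snd (p \<theta>))) min_ideal"
    by (rule exE)
  define h where "h \<theta> = fst (p \<theta>)" for \<theta>
  define k where "k \<theta> = snd (p \<theta>)" for \<theta>
  have kh: "h \<theta> \<in> carrier G \<and> k \<theta> = h \<theta> \<otimes> g \<otimes> inv (h \<theta>) \<and>
      \<theta> = restrict (translate (k \<theta>)) min_ideal" if "\<theta> \<in> T" for \<theta>
    using p that unfolding h_def k_def by (rule bspec)
  have kG: "k \<theta> \<in> carrier G" if "\<theta> \<in> T" for \<theta> using kh[OF that] g by auto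
  have kT: "translate (k \<theta>) x = \<theta> x" if "\<theta> \<in> T" "x \<in> min_ideal" for \<theta> x
    using kh[OF that(1)] that(2) by (metis restrict_apply')
  define \<mu> where "\<mu> f = (if bdd (carrier G) f then (\<Sum>\<theta>\<in>T. f (k \<theta>)) / n else 0)" for f
  have mu: "\<mu> \<in> M"
  proof (rule meansI)
    show "\<mu> (\<lambda>_. 1) = 1" using n by (simp add: \<mu>_def n_def)
    fix f f' :: "'a \<Rightarrow> real" and c assume f: "bdd (carrier G) f"
    show "\<mu> (\<lambda>x. c * f x) = c * \<mu> f"
      using f by (simp add: \<mu>_def sum_distrib_left)
    show "\<mu> (\<lambda>x. f x + f' x) = \<mu> f + \<mu> f'" if "bdd (carrier G) f'"
      using f that by (simp add: \<mu>_def sum.distrib add_divide_distrib)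
    show "0 \<le> \<mu> f" if "\<And>x. x \<in> carrier G \<Longrightarrow> 0 \<le> f x"
      using f n that kG by (auto simp: \<mu>_def intro!: sum_nonneg divide_nonneg_pos)
  qed (simp add: \<mu>_def)
  define A where "A x f = (if bdd (carrier G) f then (\<Sum>\<theta>\<in>T. x (\<lambda>u. f (k \<theta> \<otimes> u))) / n else 0)" for x f
  have conv_mu: "conv \<mu> x = A x" if "x \<in> M" for x
    using that by (auto simp: conv_def \<mu>_def A_def)
  have A_mem: "A x \<in> min_ideal" if "x \<in> min_ideal" for x
    using min_ideal_conv[OF mu that] conv_mu[OF min_ideal_means[OF that]] by simp
  have contA: "continuous_on UNIV A"
  proof (rule continuous_on_coordinatewise_then_product)
    show "continuous_on UNIV (\<lambda>x. A x f)" for f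
      by (cases "bdd (carrier G) f") (simp_all add: A_def divide_inverse, intro continuous_intros)
  qed
  obtain x1 where x1: "x1 \<in> min_ideal" "A x1 = x1"
  proof (rule average_fixed_point[OF A_mem contA])
    show "A (\<lambda>f. (\<Sum>j<m. y j f) / d) f = (\<Sum>j<(m::nat). A (y j) f) / d" for m y d f
      by (simp add: A_def sum_divide_distrib[symmetric] sum.swap[of _ T])
  qed blast
  \<comment> \<open>Conjugation by \<open>c\<close>, acting on the finite set of maps; it is used to reorder the average.\<close>
  define \<beta> where "\<beta> c \<theta> = restrict (translate (c \<otimes> k \<theta> \<otimes> inv c)) min_ideal" for c \<theta>
  have \<beta>T: "\<beta> c \<theta> \<in> T" if c: "c \<in> carrier G" and \<theta>: "\<theta> \<in> T" for c \<theta>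
  proof -
    have "c \<otimes> k \<theta> \<otimes> inv c = (c \<otimes> h \<theta>) \<otimes> g \<otimes> inv (c \<otimes> h \<theta>)"
      using kh[OF \<theta>] c g by (simp add: m_assoc inv_mult_group)
    then show ?thesis using Tmem[of "c \<otimes> h \<theta>"] kh[OF \<theta>] c by (simp add: \<beta>_def)
  qed
  have \<beta>app: "\<beta> c \<theta> (translate c x) = translate (c \<otimes> k \<theta>) x"
    if c: "c \<in> carrier G" and \<theta>: "\<theta> \<in> T" and x: "x \<in> min_ideal" for c \<theta> x
  proof -
    have "\<beta> c \<theta> (translate c x) = translate (c \<otimes> k \<theta> \<otimes> inv c) (translate c x)"
      using min_ideal_translate[OF c x] by (simp add: \<beta>_def)
    also have "\<dots> = translate (c \<otimes> k \<theta> \<otimes> inv c \<otimes> c) x"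
      using c kG[OF \<theta>] min_ideal_means[OF x] by (simp add: translate_mult)
    also have "c \<otimes> k \<theta> \<otimes> inv c \<otimes> c = c \<otimes> k \<theta>" using c kG[OF \<theta>] by (simp add: m_assoc)
    finally show ?thesis .
  qed
  have \<beta>inj: "inj_on (\<beta> c) T" if c: "c \<in> carrier G" for c
  proof
    fix \<theta> \<theta>' assume \<theta>: "\<theta> \<in> T" "\<theta>' \<in> T" "\<beta> c \<theta> = \<beta> c \<theta>'"
    have "\<theta> x = \<theta>' x" if x: "x \<in> min_ideal" for x
    proof -
      have xM: "x \<in> M" using x by (rule min_ideal_means)
      have "translate c (translate (k \<theta>) x) = translate c (translate (k \<theta>') x)"
        using \<beta>app[OF c \<theta>(1) x] \<beta>app[OF c \<theta>(2) x] \<theta> c kG xM by (simp add: translate_mult)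
      then have "translate (k \<theta>) x = translate (k \<theta>') x"
        using translate_inv_cancel(1)[OF c] \<theta> kG xM by (metis translate_means)
      then show ?thesis using kT \<theta> x by simp
    qed
    then have "restrict \<theta> min_ideal = restrict \<theta>' min_ideal" by (intro restrict_ext) simp
    then show "\<theta> = \<theta>'" using kh[OF \<theta>(1)] kh[OF \<theta>(2)] by (metis restrict_restrict inf.idem)
  qed
  have swap: "(\<Sum>\<theta>\<in>T. translate (k \<theta> \<otimes> c) x f) = (\<Sum>\<theta>\<in>T. translate (c \<otimes> k \<theta>) x f)"
    if c: "c \<in> carrier G" and x: "x \<in> min_ideal" for c x f
  proof -
    have "\<beta> c ` T = T" using \<beta>T[OF c] by (intro endo_inj_surj finT \<beta>inj c) auto
    then have bij: "bij_betw (\<beta> c) T T" using \<beta>inj[OF c] by (simp add: bij_betw_def)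
    have "(\<Sum>\<theta>\<in>T. translate (k \<theta> \<otimes> c) x f) = (\<Sum>\<theta>\<in>T. \<theta> (translate c x) f)"
      using kT min_ideal_translate[OF c x] kG c min_ideal_means[OF x]
      by (intro sum.cong refl) (simp add: translate_mult[symmetric])
    also have "\<dots> = (\<Sum>\<theta>\<in>T. \<beta> c \<theta> (translate c x) f)"
      by (rule sum.reindex_bij_betw[OF bij, symmetric])
    also have "\<dots> = (\<Sum>\<theta>\<in>T. translate (c \<otimes> k \<theta>) x f)"
      using \<beta>app[OF c _ x] by (intro sum.cong refl) simp
    finally show ?thesis .
  qed
  have comm: "A (conv m x) = conv m (A x)" if m: "m \<in> M" and x: "x \<in> min_ideal" for m x
  proof
    fix f
    have xM: "x \<in> M" using x by (rule min_ideal_means)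
    show "A (conv m x) f = conv m (A x) f"
    proof (cases "bdd (carrier G) f")
      case True
      have b: "bdd (carrier G) (\<lambda>c. x (\<lambda>u. f (k \<theta> \<otimes> (c \<otimes> u))))" if "\<theta> \<in> T" for \<theta>
        using bdd_orbit[OF xM bdd_translate[OF True kG[OF that]]] .
      have "A (conv m x) f = (\<Sum>\<theta>\<in>T. m (\<lambda>c. x (\<lambda>u. f (k \<theta> \<otimes> (c \<otimes> u))))) / n"
        using True kG by (simp add: A_def conv_def)
      also have "\<dots> = m (\<lambda>c. (\<Sum>\<theta>\<in>T. x (\<lambda>u. f (k \<theta> \<otimes> (c \<otimes> u))))) / n"
        using mean_sum[OF m, of T "\<lambda>\<theta> c. x (\<lambda>u. f (k \<theta> \<otimes> (c \<otimes> u)))"] b by simp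
      also have "\<dots> = m (\<lambda>c. (1 / n) * (\<Sum>\<theta>\<in>T. x (\<lambda>u. f (k \<theta> \<otimes> (c \<otimes> u)))))"
        using mean_scale[OF m, of "\<lambda>c. \<Sum>\<theta>\<in>T. x (\<lambda>u. f (k \<theta> \<otimes> (c \<otimes> u)))" "1 / n"] b by simp
      also have "\<dots> = m (\<lambda>c. A x (\<lambda>u. f (c \<otimes> u)))"
      proof (rule mean_cong[OF m])
        fix c assume c: "c \<in> carrier G"
        have 1: "x (\<lambda>u. f (k \<theta> \<otimes> (c \<otimes> u))) = translate (k \<theta> \<otimes> c) x f" if "\<theta> \<in> T" for \<theta>
          using True kG[OF that] c by (simp add: translate_def) (intro mean_cong[OF xM], simp add: m_assoc)
        have 2: "x (\<lambda>u. f (c \<otimes> (k \<theta> \<otimes> u))) = translate (c \<otimes> k \<theta>) x f" if "\<theta> \<in> T" for \<theta>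
          using True kG[OF that] c by (simp add: translate_def) (intro mean_cong[OF xM], simp add: m_assoc)
        show "(1 / n) * (\<Sum>\<theta>\<in>T. x (\<lambda>u. f (k \<theta> \<otimes> (c \<otimes> u)))) = A x (\<lambda>u. f (c \<otimes> u))"
          using swap[OF c x, of f] True c by (simp add: A_def 1 2)
      qed
      also have "\<dots> = conv m (A x) f" using True by (simp add: conv_def)
      finally show ?thesis .
    qed (simp add: A_def conv_def)
  qed
  have "{x \<in> min_ideal. A x = x} = min_ideal"
  proof (rule min_ideal_minimal)
    from closed_Int[OF min_ideal_closed closed_fixed_points[OF contA]]
    show "closed {x \<in> min_ideal. A x = x}" by (simp add: Collect_conj_eq)
    show "{x \<in> min_ideal. A x = x} \<noteq> {}" using x1 by blast
    show "left_ideal {x \<in> min_ideal. A x = x}"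
      unfolding left_ideal_def
      using min_ideal_means by (auto simp: comm min_ideal_conv)
  qed blast
  then have Afix: "A x = x" if "x \<in> min_ideal" for x using that by blast
  obtain y where y: "extreme_in min_ideal y" "translate g y \<noteq> y"
    using ex_moved_extreme_point[OF g notrad] by blast
  have yL: "y \<in> min_ideal" using y(1) by (simp add: extreme_in_def)
  have yM: "y \<in> M" using yL by (rule min_ideal_means)
  have eq: "y = conv \<mu> y" using Afix[OF yL] conv_mu[OF yM] by simp
  define \<theta>0 where "\<theta>0 = restrict (translate (\<one> \<otimes> g \<otimes> inv \<one>)) min_ideal"
  have \<theta>0: "\<theta>0 \<in> T" unfolding \<theta>0_def by (rule Tmem) simp
  have \<theta>0y: "\<theta>0 y = translate g y" using yL g by (simp add: \<theta>0_def)
  \<comment> \<open>Condition the average on the conjugates that act on \<open>y\<close> as \<open>g\<close> does.\<close>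
  define E where "E = {c. translate c y = translate g y}"
  have kE: "k \<theta>0 \<in> E" using kT[OF \<theta>0 yL] \<theta>0y by (simp add: E_def)
  have "(\<Sum>\<theta>\<in>T. indicator E (k \<theta>)) \<ge> (indicator E (k \<theta>0) :: real)"
    by (rule member_le_sum[OF \<theta>0]) (simp_all add: finT)
  then have pos: "\<mu> (indicator E) > 0" using kE n by (simp add: \<mu>_def)
  have "translate g y f = y f" for f
  proof (cases "bdd (carrier G) f")
    case True
    have "\<mu> (\<lambda>c. indicator E c * translate c y f) = \<mu> (indicator E) * y f"
      by (rule extreme_conv[OF y(1) yL mu eq True])
    moreover have "(\<lambda>c. indicator E c * translate c y f) = (\<lambda>c. translate g y f * indicator E c)"
      by (auto simp: E_def indicator_def)
    ultimately show ?thesis using mean_scale[OF mu, of "indicator E" "translate g y f"] pos by simp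
  qed (simp add: translate_def mean_unbounded[OF yM])
  then show False using y(2) by blast
qed

end

section \<open>Amenable radical and FC-hypercenter\<close>

lemma invariant_mean_imp_means:
  assumes "invariant_mean G m"
  shows "(\<lambda>f. if bdd (carrier G) f then m f else 0) \<in> means (carrier G)"
  using assms unfolding invariant_mean_def by (intro meansI) simp_all

lemma invariant_mean_translate:
  assumes "invariant_mean G m" "bdd (carrier G) f" "g \<in> carrier G"
  shows "m (\<lambda>x. f (g \<otimes>\<^bsub>G\<^esub> x)) = m f"
  using assms unfolding invariant_mean_def by blast

text \<open>Writing \<open>u = c u \<cdot> rep u\<close> with \<open>c u\<close> in \<open>H\<close> and \<open>rep u\<close> a chosen element of the coset of \<open>u\<close>, the function
\<open>f\<close> on \<open>H\<close> is extended to \<open>f \<circ> c\<close> on \<open>G\<close>, compatibly with left translation by \<open>H\<close>.\<close>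
lemma (in group) amenable_subgroup_of_fixed_mean:
  assumes H: "subgroup H G" and x: "x \<in> M" and fixed: "\<And>h. h \<in> H \<Longrightarrow> translate h x = x"
  shows "amenable (G\<lparr>carrier := H\<rparr>)"
proof -
  define rep where "rep u = (SOME v. v \<in> H #> u)" for u
  define c where "c u = u \<otimes> inv (rep u)" for u
  have HG: "H \<subseteq> carrier G" using H by (rule subgroup.subset)
  have rep: "rep u \<in> H #> u" if "u \<in> carrier G" for u
    unfolding rep_def by (rule someI[of _ u]) (rule rcos_self[OF that H])
  have cH: "c u \<in> H" if u: "u \<in> carrier G" for u
  proof -
    obtain h where h: "h \<in> H" "rep u = h \<otimes> u" using rep[OF u] by (auto simp: r_coset_def)
    have "c u = inv h" using h u HG by (auto simp: c_def inv_mult_group m_assoc[symmetric])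
    then show ?thesis using h(1) H by (simp add: subgroup.m_inv_closed)
  qed
  have c_mult: "c (h \<otimes> u) = h \<otimes> c u" if h: "h \<in> H" and u: "u \<in> carrier G" for h u
  proof -
    have "H #> (h \<otimes> u) = H #> u"
      using h u HG H by (simp add: coset_mult_assoc[symmetric] coset_join2 subset_iff)
    then have "rep (h \<otimes> u) = rep u" by (simp add: rep_def)
    moreover have "rep u \<in> carrier G" using rep[OF u] u HG by (auto simp: r_coset_def)
    ultimately show ?thesis using h u HG by (auto simp: c_def m_assoc)
  qed
  have b: "bdd (carrier G) (\<lambda>u. f (c u))" if f: "bdd H f" for f
  proof -
    obtain d where "\<And>h. h \<in> H \<Longrightarrow> \<bar>f h\<bar> \<le> d" using bddE[OF f] by metis
    then show ?thesis using cH by (intro bddI[of _ _ d]) simp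
  qed
  have "invariant_mean (G\<lparr>carrier := H\<rparr>) (\<lambda>f. x (\<lambda>u. f (c u)))"
    unfolding invariant_mean_def
  proof (intro conjI allI impI ballI)
    show "x (\<lambda>u. 1) = 1" by (rule mean_one[OF x])
  next
    fix f :: "'a \<Rightarrow> real" assume "bounded (f ` carrier (G\<lparr>carrier := H\<rparr>))"
    then have f: "bdd H f" by simp
    show "x (\<lambda>u. k * f (c u)) = k * x (\<lambda>u. f (c u))" for k by (rule mean_scale[OF x b[OF f]])
    show "x (\<lambda>u. f (c u) + f' (c u)) = x (\<lambda>u. f (c u)) + x (\<lambda>u. f' (c u))"
      if "bounded (f' ` carrier (G\<lparr>carrier := H\<rparr>))" for f'
      using that by (intro mean_add[OF x b[OF f] b]) simp
    show "0 \<le> x (\<lambda>u. f (c u))" if "\<forall>x\<in>carrier (G\<lparr>carrier := H\<rparr>). 0 \<le> f x"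
      using that cH by (intro mean_nonneg[OF x b[OF f]]) simp
    fix h assume "h \<in> carrier (G\<lparr>carrier := H\<rparr>)"
    then have h: "h \<in> H" by simp
    have "x (\<lambda>u. f (h \<otimes> c u)) = x (\<lambda>u. f (c (h \<otimes> u)))"
      by (rule mean_cong[OF x]) (simp add: c_mult[OF h])
    also have "\<dots> = translate h x (\<lambda>u. f (c u))" using b[OF f] by (simp add: translate_def)
    also have "\<dots> = x (\<lambda>u. f (c u))" by (simp add: fixed[OF h])
    finally show "x (\<lambda>u. f (h \<otimes>\<^bsub>G\<lparr>carrier := H\<rparr>\<^esub> c u)) = x (\<lambda>u. f (c u))" by simp
  qed
  then show ?thesis unfolding amenable_def by blast
qed

lemma (in group) amenable_rad: "amenable (G\<lparr>carrier := rad\<rparr>)"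
proof -
  obtain x where "x \<in> min_ideal" using min_ideal_nonempty by blast
  then show ?thesis
    by (intro amenable_subgroup_of_fixed_mean[OF subgroup_rad, of x]) (simp_all add: min_ideal_means rad_def)
qed

lemma (in group) amenable_normal_subset_rad:
  assumes N: "N \<lhd> G" and am: "amenable (G\<lparr>carrier := N\<rparr>)"
  shows "N \<subseteq> rad"
proof -
  obtain m where m: "invariant_mean (G\<lparr>carrier := N\<rparr>) m" using am unfolding amenable_def by blast
  have NG: "N \<subseteq> carrier G" using subgroup.subset[OF normal_imp_subgroup[OF N]] .
  have sub: "bdd N f" if "bdd (carrier G) f" for f :: "'a \<Rightarrow> real"
    using that NG by (meson bounded_subset image_mono)
  define m' where "m' f = (if bdd N f then m f else 0)" for f
  have m': "m' \<in> means N" using invariant_mean_imp_means[OF m] by (simp add: m'_def[abs_def])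
  define \<mu> where "\<mu> f = (if bdd (carrier G) f then m' f else 0)" for f
  have "\<mu> \<in> M"
  proof (rule meansI)
    show "0 \<le> \<mu> f" if "bdd (carrier G) f" "\<And>x. x \<in> carrier G \<Longrightarrow> 0 \<le> f x" for f
      using that mean_nonneg[OF m' sub, of f] NG by (simp add: \<mu>_def subset_iff)
  qed (simp_all add: \<mu>_def mean_one[OF m'] mean_scale[OF m'] mean_add[OF m'] sub)
  then show ?thesis
  proof (rule subset_rad[OF N])
    fix n F assume n: "n \<in> N" and F: "bdd (carrier G) F"
    have "bdd (carrier G) (\<lambda>g. F (n \<otimes> g))" using F n NG by (intro bdd_translate) auto
    then show "\<mu> (\<lambda>g. F (n \<otimes> g)) = \<mu> F"
      using invariant_mean_translate[OF m, of F n] n F sub by (simp add: \<mu>_def m'_def)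
  qed
qed

lemma (in group) amenable_radical_eq_rad: "amenable_radical G = rad"
  unfolding amenable_radical_def
  by (rule Greatest_equality) (use normal_rad amenable_rad amenable_normal_subset_rad in auto)

lemma (in group) r_coset_rep:
  assumes "K \<lhd> G" "C \<in> carrier (G Mod K)" "c \<in> C"
  shows "c \<in> carrier G" "C = K #> c"
proof -
  have K: "subgroup K G" using assms(1) by (rule normal_imp_subgroup)
  obtain x where x: "x \<in> carrier G" "C = K #> x" using assms(2) by (auto simp: carrier_FactGroup)
  then show "c \<in> carrier G" using assms(3) subgroup.subset[OF K] by (auto simp: r_coset_def)
  show "C = K #> c" using repr_independence[of c K x] x assms(3) K by simp
qed

text \<open>A normal subgroup of \<open>G / rad\<close> is a normal subgroup \<open>N\<close> of \<open>G\<close> together with its invariant mean on functions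
that are constant on cosets of \<open>rad\<close>, which is what \<open>subset_rad\<close> asks for.\<close>
lemma (in group) amenable_normal_quotient_rad_trivial:
  assumes P: "P \<lhd> (G Mod rad)" and am: "amenable ((G Mod rad)\<lparr>carrier := P\<rparr>)"
  shows "P \<subseteq> {rad}"
proof -
  interpret rad: normal rad G by (rule normal_rad)
  have sP: "subgroup P (G Mod rad)" using P by (rule normal_imp_subgroup)
  obtain m where m: "invariant_mean ((G Mod rad)\<lparr>carrier := P\<rparr>) m" using am unfolding amenable_def by blast
  define m' where "m' f = (if bdd P f then m f else 0)" for f
  have m': "m' \<in> means P" using invariant_mean_imp_means[OF m] by (simp add: m'_def[abs_def])
  have PQ: "C \<in> carrier (G Mod rad)" if "C \<in> P" for C using subgroup.subset[OF sP] that by blast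
  define s where "s C = (SOME c. c \<in> C)" for C :: "'a set"
  have s: "s C \<in> C" "s C \<in> carrier G" "C = rad #> s C" if C: "C \<in> P" for C
  proof -
    have "C \<noteq> {}" using rad.rcosets_non_empty PQ[OF C] by (simp add: FactGroup_def)
    then show 1: "s C \<in> C" unfolding s_def by (simp add: some_in_eq)
    show "s C \<in> carrier G" "C = rad #> s C" using r_coset_rep[OF normal_rad PQ[OF C] 1] by simp_all
  qed
  have sub: "bdd P (\<lambda>C. f (s C))" if f: "bdd (carrier G) f" for f :: "'a \<Rightarrow> real"
  proof -
    obtain d where "\<And>h. h \<in> carrier G \<Longrightarrow> \<bar>f h\<bar> \<le> d" using bddE[OF f] by metis
    then show ?thesis using s by (intro bddI[of _ _ d]) simp
  qed
  define \<mu> where "\<mu> f = (if bdd (carrier G) f then m' (\<lambda>C. f (s C)) else 0)" for f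
  have mu: "\<mu> \<in> M"
  proof (rule meansI)
    show "\<mu> (\<lambda>_. 1) = 1" by (simp add: \<mu>_def mean_one[OF m'])
    show "\<mu> (\<lambda>x. c * f x) = c * \<mu> f" if "bdd (carrier G) f" for c f
      using that mean_scale[OF m' sub] by (simp add: \<mu>_def)
    show "\<mu> (\<lambda>x. f x + f' x) = \<mu> f + \<mu> f'" if "bdd (carrier G) f" "bdd (carrier G) f'" for f f'
      using that mean_add[OF m' sub sub] by (simp add: \<mu>_def)
    show "0 \<le> \<mu> f" if "bdd (carrier G) f" "\<And>x. x \<in> carrier G \<Longrightarrow> 0 \<le> f x" for f
      using that mean_nonneg[OF m' sub, of f] s by (simp add: \<mu>_def)
  qed (simp add: \<mu>_def)
  have N: "\<Union>P \<lhd> G" using rad.factgroup_subgroup_union_normal[OF P] .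
  have char: "\<Union>P = {x \<in> carrier G. rad #> x \<in> P}" by (rule rad.factgroup_subgroup_union_char[OF sP])
  have "\<Union>P \<subseteq> rad"
  proof (rule subset_rad[OF N mu])
    fix n F assume n: "n \<in> \<Union>P" and F: "bdd (carrier G) F"
      and inv: "\<And>g r. g \<in> carrier G \<Longrightarrow> r \<in> rad \<Longrightarrow> F (g \<otimes> r) = F g"
    have nG: "n \<in> carrier G" and nP: "rad #> n \<in> P" using n char by auto
    have cosets: "F a = F b" if "a \<in> rad #> b" "b \<in> carrier G" for a b
    proof -
      obtain r where r: "r \<in> rad" "a = r \<otimes> b" using \<open>a \<in> rad #> b\<close> by (auto simp: r_coset_def)
      have "a = b \<otimes> (inv b \<otimes> r \<otimes> b)"
        using r \<open>b \<in> carrier G\<close> subgroup.mem_carrier[OF subgroup_rad] by (simp add: m_assoc[symmetric])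
      then show ?thesis using inv[OF \<open>b \<in> carrier G\<close>] rad.inv_op_closed1[OF \<open>b \<in> carrier G\<close> r(1)] by simp
    qed
    have Fn: "bdd (carrier G) (\<lambda>g. F (n \<otimes> g))" using F nG by simp
    have "m' (\<lambda>C. F (n \<otimes> s C)) = m' (\<lambda>C. F (s ((rad #> n) <#> C)))"
    proof (rule mean_cong[OF m'])
      fix C assume C: "C \<in> P"
      have "(rad #> n) <#> C = (rad #> n) <#> (rad #> s C)" using s(3)[OF C] by simp
      also have "\<dots> = rad #> (n \<otimes> s C)" using nG s(2)[OF C] by (rule rad.rcos_sum)
      finally have e: "(rad #> n) <#> C = rad #> (n \<otimes> s C)" .
      have "(rad #> n) <#> C \<in> P" using subgroup.m_closed[OF sP nP C] by simp
      from s(1)[OF this] show "F (n \<otimes> s C) = F (s ((rad #> n) <#> C))"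
        using cosets[of "s ((rad #> n) <#> C)" "n \<otimes> s C"] nG s(2)[OF C] by (simp add: e)
    qed
    also have "\<dots> = m' (\<lambda>C. F (s C))"
    proof -
      have "bdd P (\<lambda>C. F (s ((rad #> n) <#> C)))"
      proof -
        obtain d where "\<And>h. h \<in> carrier G \<Longrightarrow> \<bar>F h\<bar> \<le> d" using bddE[OF F] by metis
        moreover have "(rad #> n) <#> C \<in> P" if "C \<in> P" for C
          using subgroup.m_closed[OF sP nP that] by simp
        ultimately show ?thesis using s by (intro bddI[of _ _ d]) simp
      qed
      then show ?thesis
        using invariant_mean_translate[OF m, of "\<lambda>C. F (s C)" "rad #> n"] nP sub[OF F]
        by (simp add: m'_def)
    qed
    finally show "\<mu> (\<lambda>g. F (n \<otimes> g)) = \<mu> F" using F Fn by (simp add: \<mu>_def)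
  qed
  show ?thesis
  proof
    fix C assume C: "C \<in> P"
    have "s C \<in> rad" using \<open>\<Union>P \<subseteq> rad\<close> s(1)[OF C] C by blast
    then have "C = rad" using s(3)[OF C] coset_join2[OF s(2)[OF C] subgroup_rad] by simp
    then show "C \<in> {rad}" by simp
  qed
qed

lemma (in group) conj_class_FactGroup:
  assumes K: "K \<lhd> G" and g: "g \<in> carrier G"
  shows "conj_class (G Mod K) (K #> g) = (\<lambda>c. K #> c) ` conj_class G g"
proof -
  interpret K: normal K G by (rule K)
  interpret Q: group "G Mod K" by (rule K.factorgroup_is_group)
  interpret h: group_hom G "G Mod K" "\<lambda>a. K #> a"
    by unfold_locales (rule K.r_coset_hom_Mod)
  have "K #> (h \<otimes> g \<otimes> inv h) = (K #> h) \<otimes>\<^bsub>G Mod K\<^esub> (K #> g) \<otimes>\<^bsub>G Mod K\<^esub> inv\<^bsub>G Mod K\<^esub> (K #> h)"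
    if "h \<in> carrier G" for h
    using that g h.hom_mult h.hom_inv by (metis inv_closed m_closed)
  then show ?thesis
    unfolding conj_class_def carrier_FactGroup by force
qed

text \<open>A \<open>K\<close>-invariant function factors through the quotient, so it takes finitely many values on the class. This transfers finiteness of a
class in \<open>G / K\<close> to classes in further quotients and to actions that factor through \<open>G / K\<close>.\<close>
lemma (in group) finite_quotient_class:
  assumes K: "K \<lhd> G" and g: "g \<in> carrier G" and fin: "finite (conj_class (G Mod K) (K #> g))"
    and inv: "\<And>k a. k \<in> K \<Longrightarrow> a \<in> carrier G \<Longrightarrow> \<Phi> (k \<otimes> a) = \<Phi> a"
  shows "finite (\<Phi> ` conj_class G g)"
proof -
  define \<Psi> where "\<Psi> C = \<Phi> (SOME c. c \<in> C)" for C
  have "\<Phi> c = \<Psi> (K #> c)" if c: "c \<in> conj_class G g" for c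
  proof -
    have cG: "c \<in> carrier G" using c g by (auto simp: conj_class_def)
    have "(SOME d. d \<in> K #> c) \<in> K #> c"
      using rcos_self[OF cG normal_imp_subgroup[OF K]] by (rule someI)
    then show ?thesis using inv cG by (auto simp: \<Psi>_def r_coset_def)
  qed
  then have "\<Phi> ` conj_class G g = \<Psi> ` conj_class (G Mod K) (K #> g)"
    unfolding conj_class_FactGroup[OF K g] by (auto simp: image_image)
  then show ?thesis using fin by simp
qed

lemma (in group) icc_quotient_iff:
  assumes K: "K \<lhd> G"
  shows "icc (G Mod K) \<longleftrightarrow> (\<forall>g\<in>carrier G. g \<notin> K \<longrightarrow> infinite (conj_class (G Mod K) (K #> g)))"
proof -
  have "K #> g = K \<longleftrightarrow> g \<in> K" if "g \<in> carrier G" for g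
    using that coset_join1 coset_join2 normal_imp_subgroup[OF K] by metis
  then show ?thesis unfolding icc_def by (auto simp: carrier_FactGroup)
qed

lemma (in group) icc_quotient_rad: "icc (G Mod rad)"
  unfolding icc_quotient_iff[OF normal_rad]
proof (intro ballI impI notI)
  fix g assume g: "g \<in> carrier G" "g \<notin> rad" and fin: "finite (conj_class (G Mod rad) (rad #> g))"
  have "finite ((\<lambda>c. restrict (translate c) min_ideal) ` conj_class G g)"
  proof (rule finite_quotient_class[OF normal_rad g(1) fin])
    fix k a assume k: "k \<in> rad" and a: "a \<in> carrier G"
    show "restrict (translate (k \<otimes> a)) min_ideal = restrict (translate a) min_ideal"
    proof (rule restrict_ext)
      fix x assume x: "x \<in> min_ideal"
      have "translate (k \<otimes> a) x = translate k (translate a x)"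
        using k a x min_ideal_means by (simp add: translate_mult rad_def)
      then show "translate (k \<otimes> a) x = translate a x"
        using k min_ideal_translate[OF a x] by (simp add: rad_def)
    qed
  qed
  moreover have "(\<lambda>c. restrict (translate c) min_ideal) ` conj_class G g = conj_maps g"
    by (auto simp: conj_maps_def conj_class_def)
  ultimately show False using finite_conj_maps_imp_rad g by auto
qed

text \<open>The intersection of all normal subgroups with ICC quotient has an ICC quotient: an element outside the
intersection lies outside some member \<open>N\<close>, and its class is already infinite modulo \<open>N\<close>.\<close>
lemma (in group) FC_hypercenter:
  shows normal_FC_hypercenter: "FC_hypercenter G \<lhd> G"
    and FC_hypercenter_least: "\<And>N. N \<lhd> G \<Longrightarrow> icc (G Mod N) \<Longrightarrow> FC_hypercenter G \<subseteq> N"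
proof -
  define \<N> where "\<N> = {N. N \<lhd> G \<and> icc (G Mod N)}"
  have ne: "\<N> \<noteq> {}" using normal_rad icc_quotient_rad by (auto simp: \<N>_def)
  have n: "\<Inter>\<N> \<lhd> G"
    unfolding normal_inv_iff
  proof (intro conjI ballI)
    show "subgroup (\<Inter>\<N>) G"
      by (rule subgroups_Inter) (use ne in \<open>auto simp: \<N>_def normal_imp_subgroup\<close>)
    show "x \<otimes> h \<otimes> inv x \<in> \<Inter>\<N>" if "x \<in> carrier G" "h \<in> \<Inter>\<N>" for x h
      using that by (auto simp: \<N>_def normal_inv_iff)
  qed
  have i: "icc (G Mod \<Inter>\<N>)"
    unfolding icc_quotient_iff[OF n]
  proof (intro ballI impI notI)
    fix g assume g: "g \<in> carrier G" "g \<notin> \<Inter>\<N>"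
      and fin: "finite (conj_class (G Mod \<Inter>\<N>) (\<Inter>\<N> #> g))"
    obtain N where N: "N \<in> \<N>" "g \<notin> N" using g by blast
    then have N': "N \<lhd> G" "icc (G Mod N)" by (auto simp: \<N>_def)
    have sN: "subgroup N G" using N'(1) by (rule normal_imp_subgroup)
    have "finite ((\<lambda>c. N #> c) ` conj_class G g)"
    proof (rule finite_quotient_class[OF n g(1) fin])
      fix k a assume k: "k \<in> \<Inter>\<N>" and a: "a \<in> carrier G"
      have kN: "k \<in> N" using k N by blast
      then have "N #> (k \<otimes> a) = N #> k #> a"
        using a sN by (simp add: coset_mult_assoc subgroup.subset subgroup.mem_carrier[OF sN])
      then show "N #> (k \<otimes> a) = N #> a" using kN coset_join2[OF _ sN] subgroup.mem_carrier[OF sN] by simp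
    qed
    then show False
      using N' N(2) g(1) by (simp add: icc_quotient_iff conj_class_FactGroup)
  qed
  have e: "FC_hypercenter G = \<Inter>\<N>"
    unfolding FC_hypercenter_def by (rule Least_equality) (use n i in \<open>auto simp: \<N>_def\<close>)
  show "FC_hypercenter G \<lhd> G" using n by (simp add: e)
  show "FC_hypercenter G \<subseteq> N" if "N \<lhd> G" "icc (G Mod N)" for N
    using that by (auto simp: e \<N>_def)
qed

lemma (in group) FC_hypercenter_subset_rad: "FC_hypercenter G \<subseteq> rad"
  by (rule FC_hypercenter_least[OF normal_rad icc_quotient_rad])

lemma (in group) amenable_image:
  assumes K: "K \<lhd> G" and N: "N \<lhd> G" and am: "amenable (G\<lparr>carrier := N\<rparr>)"
  shows "(\<lambda>a. K #> a) ` N \<lhd> (G Mod K)" "amenable ((G Mod K)\<lparr>carrier := (\<lambda>a. K #> a) ` N\<rparr>)"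
proof -
  interpret K: normal K G by (rule K)
  interpret N: normal N G by (rule N)
  interpret Q: group "G Mod K" by (rule K.factorgroup_is_group)
  have h: "group_hom G (G Mod K) (\<lambda>a. K #> a)"
    by unfold_locales (rule K.r_coset_hom_Mod)
  show "(\<lambda>a. K #> a) ` N \<lhd> (G Mod K)"
    by (rule N.surj_hom_normal_subgroup[OF h]) (simp add: carrier_FactGroup)
  obtain m where m: "invariant_mean (G\<lparr>carrier := N\<rparr>) m" using am unfolding amenable_def by blast
  define m' where "m' f = (if bdd N f then m f else 0)" for f
  have m': "m' \<in> means N" using invariant_mean_imp_means[OF m] by (simp add: m'_def[abs_def])
  define P where "P = (\<lambda>a. K #> a) ` N"
  have b: "bdd N (\<lambda>n. f (K #> n))" if "bdd P f" for f
    using that by (simp add: P_def image_image)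
  have "invariant_mean ((G Mod K)\<lparr>carrier := P\<rparr>) (\<lambda>f. m' (\<lambda>n. f (K #> n)))"
    unfolding invariant_mean_def
  proof (intro conjI allI impI ballI)
    show "m' (\<lambda>n. 1) = 1" by (rule mean_one[OF m'])
  next
    fix f :: "'a set \<Rightarrow> real" assume "bounded (f ` carrier ((G Mod K)\<lparr>carrier := P\<rparr>))"
    then have f: "bdd P f" by simp
    show "m' (\<lambda>u. k * f (K #> u)) = k * m' (\<lambda>u. f (K #> u))" for k by (rule mean_scale[OF m' b[OF f]])
    show "m' (\<lambda>u. f (K #> u) + f' (K #> u)) = m' (\<lambda>u. f (K #> u)) + m' (\<lambda>u. f' (K #> u))"
      if "bounded (f' ` carrier ((G Mod K)\<lparr>carrier := P\<rparr>))" for f'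
      using that by (intro mean_add[OF m' b[OF f] b]) simp
    show "0 \<le> m' (\<lambda>u. f (K #> u))" if "\<forall>x\<in>carrier ((G Mod K)\<lparr>carrier := P\<rparr>). 0 \<le> f x"
      using that by (intro mean_nonneg[OF m' b[OF f]]) (simp add: P_def)
    fix C assume "C \<in> carrier ((G Mod K)\<lparr>carrier := P\<rparr>)"
    then obtain n where n: "n \<in> N" "C = K #> n" by (auto simp: P_def)
    have bn: "bdd N (\<lambda>u. f (K #> (n \<otimes> u)))"
    proof -
      obtain d where "\<And>h. h \<in> P \<Longrightarrow> \<bar>f h\<bar> \<le> d" using bddE[OF f] by metis
      then show ?thesis using n N.m_closed by (intro bddI[of _ _ d]) (auto simp: P_def)
    qed
    have "m' (\<lambda>u. f (C <#> (K #> u))) = m' (\<lambda>u. f (K #> (n \<otimes> u)))"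
      by (rule mean_cong[OF m']) (simp add: n K.rcos_sum)
    also have "\<dots> = m' (\<lambda>u. f (K #> u))"
      using invariant_mean_translate[OF m, of "\<lambda>u. f (K #> u)" n] n b[OF f] bn by (simp add: m'_def)
    finally show "m' (\<lambda>u. f (C \<otimes>\<^bsub>(G Mod K)\<lparr>carrier := P\<rparr>\<^esub> (K #> u))) = m' (\<lambda>u. f (K #> u))" by simp
  qed
  then show "amenable ((G Mod K)\<lparr>carrier := (\<lambda>a. K #> a) ` N\<rparr>)"
    unfolding amenable_def P_def by blast
qed

section \<open>The Hilbert space of square-summable functions\<close>

definition sqsum :: "('a \<Rightarrow> complex) \<Rightarrow> bool" where
  "sqsum f \<longleftrightarrow> (\<lambda>x. (cmod (f x))\<^sup>2) summable_on UNIV"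

lemma ell2_iff: "f \<in> ell2 X \<longleftrightarrow> (\<forall>x. x \<notin> X \<longrightarrow> f x = 0) \<and> sqsum f"
proof -
  have "(\<lambda>x. (cmod (f x))\<^sup>2) summable_on X \<longleftrightarrow> sqsum f" if "\<forall>x. x \<notin> X \<longrightarrow> f x = 0"
    unfolding sqsum_def by (rule summable_on_cong_neutral) (use that in auto)
  then show ?thesis by (auto simp: ell2_def)
qed

lemma sqsum_le:
  assumes "sqsum f" "\<And>x. cmod (g x) \<le> c * cmod (f x)"
  shows "sqsum g"
proof -
  have "(\<lambda>x. c\<^sup>2 * (cmod (f x))\<^sup>2) summable_on UNIV"
    using assms(1) unfolding sqsum_def by (rule summable_on_cmult_right)
  then show ?thesis
    unfolding sqsum_def
  proof (rule summable_on_comparison_test)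
    show "(cmod (g x))\<^sup>2 \<le> c\<^sup>2 * (cmod (f x))\<^sup>2" for x
      using power_mono[OF assms(2), of x 2] by (simp add: power_mult_distrib)
  qed simp
qed

lemma sqsum_add:
  assumes "sqsum f" "sqsum g" shows "sqsum (\<lambda>x. f x + g x)"
proof -
  have "(\<lambda>x. 2 * ((cmod (f x))\<^sup>2 + (cmod (g x))\<^sup>2)) summable_on UNIV"
    using assms unfolding sqsum_def by (intro summable_on_cmult_right summable_on_add)
  then show ?thesis
    unfolding sqsum_def
  proof (rule summable_on_comparison_test)
    fix x
    have "(cmod (f x + g x))\<^sup>2 \<le> (cmod (f x) + cmod (g x))\<^sup>2"
      by (rule power_mono[OF norm_triangle_ineq]) simp
    also have "\<dots> \<le> 2 * ((cmod (f x))\<^sup>2 + (cmod (g x))\<^sup>2)"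
      using zero_le_power2[of "cmod (f x) - cmod (g x)"] by (simp add: power2_eq_square algebra_simps)
    finally show "(cmod (f x + g x))\<^sup>2 \<le> 2 * ((cmod (f x))\<^sup>2 + (cmod (g x))\<^sup>2)" .
  qed simp
qed

lemma sqsum_cmult: "sqsum f \<Longrightarrow> sqsum (\<lambda>x. c * f x)"
  by (rule sqsum_le[of f _ "cmod c"]) (simp_all add: norm_mult)

text \<open>Substituting an injective map only selects and reorders coordinates.\<close>
lemma sqsum_comp:
  assumes "sqsum f" "inj_on p X"
  shows "sqsum (\<lambda>x. if x \<in> X then f (p x) else 0)"
    "(\<Sum>\<^sub>\<infinity>x. (cmod (if x \<in> X then f (p x) else 0))\<^sup>2) \<le> (\<Sum>\<^sub>\<infinity>x. (cmod (f x))\<^sup>2)"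
proof -
  have 1: "(\<lambda>x. (cmod (f x))\<^sup>2) summable_on p ` X"
    using assms(1) unfolding sqsum_def by (rule summable_on_subset_banach) simp
  then have 2: "(\<lambda>x. (cmod (f (p x)))\<^sup>2) summable_on X"
    using summable_on_reindex[OF assms(2), of "\<lambda>x. (cmod (f x))\<^sup>2"] by (simp add: o_def)
  moreover have "(\<lambda>x. (cmod (if x \<in> X then f (p x) else 0))\<^sup>2) summable_on UNIV
      \<longleftrightarrow> (\<lambda>x. (cmod (f (p x)))\<^sup>2) summable_on X"
    by (rule summable_on_cong_neutral) auto
  ultimately show "sqsum (\<lambda>x. if x \<in> X then f (p x) else 0)" unfolding sqsum_def by simp
  have "(\<Sum>\<^sub>\<infinity>x. (cmod (if x \<in> X then f (p x) else 0))\<^sup>2) = (\<Sum>\<^sub>\<infinity>x\<in>X. (cmod (f (p x)))\<^sup>2)"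
    by (rule infsum_cong_neutral) auto
  also have "\<dots> = (\<Sum>\<^sub>\<infinity>x\<in>p ` X. (cmod (f x))\<^sup>2)"
    using infsum_reindex[OF assms(2), of "\<lambda>x. (cmod (f x))\<^sup>2"] by (simp add: o_def)
  also have "\<dots> \<le> (\<Sum>\<^sub>\<infinity>x. (cmod (f x))\<^sup>2)"
    by (rule infsum_mono_neutral[OF 1]) (use assms(1) in \<open>auto simp: sqsum_def\<close>)
  finally show "(\<Sum>\<^sub>\<infinity>x. (cmod (if x \<in> X then f (p x) else 0))\<^sup>2) \<le> (\<Sum>\<^sub>\<infinity>x. (cmod (f x))\<^sup>2)" .
qed

lemma sqsum_mult_summable:
  assumes "sqsum f" "sqsum g"
  shows "(\<lambda>x. f x * cnj (g x)) summable_on UNIV"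
proof -
  have "(\<lambda>x. norm (f x * cnj (g x))) summable_on UNIV"
    by (rule abs_summable_product)
      (use assms in \<open>simp_all add: sqsum_def norm_mult power2_eq_square\<close>)
  then show ?thesis by (rule abs_summable_summable)
qed

typedef 'a l2 = "{f :: 'a \<Rightarrow> complex. sqsum f}" morphisms fn Abs_l2
  by (rule exI[of _ "\<lambda>_. 0"]) (simp add: sqsum_def)

lemma sqsum_fn [simp]: "sqsum (fn v)" using fn by blast
lemma fn_Abs: "sqsum f \<Longrightarrow> fn (Abs_l2 f) = f" by (simp add: Abs_l2_inverse)
lemma l2_eqI: "(\<And>x. fn v x = fn w x) \<Longrightarrow> v = w" by (meson ext fn_inject)

definition cscale :: "complex \<Rightarrow> 'a l2 \<Rightarrow> 'a l2" where "cscale c v = Abs_l2 (\<lambda>x. c * fn v x)"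

definition cinner :: "'a l2 \<Rightarrow> 'a l2 \<Rightarrow> complex" where
  "cinner v w = (\<Sum>\<^sub>\<infinity>x. fn v x * cnj (fn w x))"

lemma fn_cscale [simp]: "fn (cscale c v) x = c * fn v x"
  by (simp add: cscale_def fn_Abs sqsum_cmult)

lemma cinner_summable: "(\<lambda>x. fn v x * cnj (fn w x)) summable_on UNIV"
  by (rule sqsum_mult_summable) simp_all

lemma cinner_self: "cinner v v = complex_of_real (\<Sum>\<^sub>\<infinity>x. (cmod (fn v x))\<^sup>2)"
proof -
  have "cinner v v = (\<Sum>\<^sub>\<infinity>x. complex_of_real ((cmod (fn v x))\<^sup>2))"
    unfolding cinner_def by (simp only: complex_norm_square)
  also have "\<dots> = complex_of_real (\<Sum>\<^sub>\<infinity>x. (cmod (fn v x))\<^sup>2)"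
    using has_sum_of_real[OF has_sum_infsum[OF sqsum_fn[of v, unfolded sqsum_def]], where 'a = complex]
    by (rule infsumI)
  finally show ?thesis .
qed

lemma cinner_commute: "cinner v w = cnj (cinner w v)"
  unfolding cinner_def by (simp add: infsum_cnj[symmetric] mult.commute)

instantiation l2 :: (type) real_inner
begin

definition zero_l2 :: "'a l2" where "zero_l2 = Abs_l2 (\<lambda>_. 0)"
definition plus_l2 :: "'a l2 \<Rightarrow> 'a l2 \<Rightarrow> 'a l2" where "plus_l2 v w = Abs_l2 (\<lambda>x. fn v x + fn w x)"
definition scaleR_l2 :: "real \<Rightarrow> 'a l2 \<Rightarrow> 'a l2" where "scaleR_l2 r v = cscale (complex_of_real r) v"
definition uminus_l2 :: "'a l2 \<Rightarrow> 'a l2" where "uminus_l2 v = cscale (-1) v"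
definition minus_l2 :: "'a l2 \<Rightarrow> 'a l2 \<Rightarrow> 'a l2" where "minus_l2 v w = v + (- w)"
definition inner_l2 :: "'a l2 \<Rightarrow> 'a l2 \<Rightarrow> real" where "inner_l2 v w = Re (cinner v w)"
definition norm_l2 :: "'a l2 \<Rightarrow> real" where "norm_l2 v = sqrt (inner v v)"
definition sgn_l2 :: "'a l2 \<Rightarrow> 'a l2" where "sgn_l2 v = scaleR (inverse (norm v)) v"
definition dist_l2 :: "'a l2 \<Rightarrow> 'a l2 \<Rightarrow> real" where "dist_l2 v w = norm (v - w)"
definition uniformity_l2 :: "('a l2 \<times> 'a l2) filter" where
  "uniformity_l2 = (INF e\<in>{0<..}. principal {(x, y). dist x y < e})"
definition open_l2 :: "'a l2 set \<Rightarrow> bool" where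
  "open_l2 U = (\<forall>x\<in>U. \<forall>\<^sub>F (x', y) in uniformity. x' = x \<longrightarrow> y \<in> U)"

lemma fn_zero: "fn 0 x = 0"
  by (simp add: zero_l2_def fn_Abs sqsum_def)
lemma fn_plus: "fn (v + w) x = fn v x + fn w x"
  by (simp add: plus_l2_def fn_Abs sqsum_add)

instance
proof
  fix u v w :: "'a l2" and r s :: real
  show "u + v + w = u + (v + w)" "u + v = v + u" "0 + v = v" "- v + v = 0" "u - v = u + - v"
    "r *\<^sub>R (v + w) = r *\<^sub>R v + r *\<^sub>R w" "(r + s) *\<^sub>R v = r *\<^sub>R v + s *\<^sub>R v"
    "r *\<^sub>R s *\<^sub>R v = (r * s) *\<^sub>R v" "1 *\<^sub>R v = v"
    by (rule l2_eqI; simp add: fn_zero fn_plus minus_l2_def uminus_l2_def scaleR_l2_def algebra_simps)+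
  show "dist v w = norm (v - w)" "sgn v = scaleR (inverse (norm v)) v" "norm v = sqrt (inner v v)"
    by (simp_all add: dist_l2_def sgn_l2_def norm_l2_def)
  show "uniformity = (INF e\<in>{0<..}. principal {(x, y). dist (x::'a l2) y < e})"
    by (rule uniformity_l2_def)
  show "open U = (\<forall>x\<in>U. \<forall>\<^sub>F (x', y) in uniformity. x' = x \<longrightarrow> y \<in> U)" for U :: "'a l2 set"
    by (rule open_l2_def)
  show "inner v w = inner w v"
    unfolding inner_l2_def by (subst cinner_commute) simp
  have "cinner (u + v) w = cinner u w + cinner v w"
    unfolding cinner_def fn_plus distrib_right by (rule infsum_add) (rule cinner_summable)+
  then show "inner (u + v) w = inner u w + inner v w" by (simp add: inner_l2_def)
  have "cinner (r *\<^sub>R v) w = complex_of_real r * cinner v w"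
    unfolding cinner_def scaleR_l2_def fn_cscale mult.assoc by (rule infsum_cmult_right) (rule cinner_summable)
  then show "inner (r *\<^sub>R v) w = r * inner v w" by (simp add: inner_l2_def)
  have eq: "inner v v = (\<Sum>\<^sub>\<infinity>x. (cmod (fn v x))\<^sup>2)" by (simp add: inner_l2_def cinner_self)
  show "0 \<le> inner v v" unfolding eq by (rule infsum_nonneg) simp
  show "inner v v = 0 \<longleftrightarrow> v = 0"
  proof
    assume "inner v v = 0"
    then have "(\<Sum>\<^sub>\<infinity>x. (cmod (fn v x))\<^sup>2) \<le> 0" by (simp add: eq)
    moreover have "(\<lambda>x. (cmod (fn v x))\<^sup>2) summable_on UNIV" using sqsum_fn[of v] by (simp add: sqsum_def)
    ultimately have "(cmod (fn v x))\<^sup>2 = 0" for x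
      using nonneg_infsum_le_0D[of "\<lambda>x. (cmod (fn v x))\<^sup>2" UNIV x] by simp
    then have "fn v x = 0" for x by (metis norm_eq_zero power_eq_0_iff)
    then show "v = 0" by (intro l2_eqI) (simp only: fn_zero)
  next
    assume v0: "v = 0"
    show "inner v v = 0" unfolding eq by (simp add: v0 fn_zero)
  qed
qed

end

lemma fn_scaleR: "fn (r *\<^sub>R v) x = complex_of_real r * fn v x"
  by (simp add: scaleR_l2_def)
lemma fn_uminus: "fn (- v) x = - fn v x"
  by (simp add: uminus_l2_def)
lemma fn_minus: "fn (v - w) x = fn v x - fn w x"
  unfolding minus_l2_def fn_plus fn_uminus by simp

lemmas fn_simps [simp] = fn_zero fn_plus fn_scaleR fn_uminus fn_minus

lemma norm_l2_sq: "(norm (v::'a l2))\<^sup>2 = (\<Sum>\<^sub>\<infinity>x. (cmod (fn v x))\<^sup>2)"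
  using power2_norm_eq_inner[of v] by (simp add: inner_l2_def cinner_self)

lemma cinner_add_left: "cinner (u + v) w = cinner u w + cinner v w"
  unfolding cinner_def fn_plus distrib_right by (rule infsum_add) (rule cinner_summable)+

lemma cinner_add_right: "cinner w (u + v) = cinner w u + cinner w v"
  by (metis cinner_add_left cinner_commute complex_cnj_add)

lemma cinner_cscale_left [simp]: "cinner (cscale c v) w = c * cinner v w"
  unfolding cinner_def fn_cscale mult.assoc by (rule infsum_cmult_right) (rule cinner_summable)

lemma cinner_cscale_right [simp]: "cinner v (cscale c w) = cnj c * cinner v w"
  by (metis cinner_cscale_left cinner_commute complex_cnj_mult)

lemma cinner_self_norm: "cinner v v = complex_of_real ((norm v)\<^sup>2)"
  by (simp add: cinner_self norm_l2_sq)

lemma norm_cscale [simp]: "norm (cscale c v) = cmod c * norm v"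
proof -
  have "complex_of_real ((norm (cscale c v))\<^sup>2) = complex_of_real ((cmod c * norm v)\<^sup>2)"
    unfolding cinner_self_norm[symmetric] power_mult_distrib of_real_mult complex_norm_square[of c]
    by (simp add: mult.assoc)
  then have "(norm (cscale c v))\<^sup>2 = (cmod c * norm v)\<^sup>2" by (simp only: of_real_eq_iff)
  then show ?thesis by (rule power2_eq_imp_eq) simp_all
qed

lemma cscale_cscale [simp]: "cscale c (cscale d v) = cscale (c * d) v"
  by (rule l2_eqI) simp
lemma cscale_one [simp]: "cscale 1 v = v"
  by (rule l2_eqI) simp
lemma cscale_add: "cscale c (v + w) = cscale c v + cscale c w"
  by (rule l2_eqI) (simp add: algebra_simps)
lemma scaleR_eq_cscale: "r *\<^sub>R v = cscale (complex_of_real r) v"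
  by (rule l2_eqI) simp

lemma cmod_cinner_le: "cmod (cinner v w) \<le> norm v * norm w"
proof (cases "cinner v w = 0")
  case False
  define c where "c = cnj (cinner v w) / cmod (cinner v w)"
  have c1: "cmod c = 1" using False by (simp add: c_def norm_divide)
  have "c * cinner v w = complex_of_real (cmod (cinner v w))"
    using False complex_norm_square[of "cinner v w"]
    by (simp add: c_def power2_eq_square mult.commute divide_simps)
  then have "cmod (cinner v w) = inner (cscale c v) w" by (simp add: inner_l2_def)
  also have "\<dots> \<le> norm (cscale c v) * norm w" by (rule norm_cauchy_schwarz)
  also have "\<dots> = norm v * norm w" by (simp add: c1)
  finally show ?thesis .
qed simp

lemma bounded_bilinear_cinner: "bounded_bilinear cinner"
proof
  show "cinner (a + a') b = cinner a b + cinner a' b" for a a' b :: "'a l2" by (rule cinner_add_left)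
  show "cinner a (b + b') = cinner a b + cinner a b'" for a b b' :: "'a l2" by (rule cinner_add_right)
  show "cinner (r *\<^sub>R a) b = r *\<^sub>R cinner a b" for r and a b :: "'a l2"
    by (simp add: scaleR_eq_cscale scaleR_conv_of_real)
  show "cinner a (r *\<^sub>R b) = r *\<^sub>R cinner a b" for r and a b :: "'a l2"
    by (simp add: scaleR_eq_cscale scaleR_conv_of_real)
  show "\<exists>K. \<forall>a b. norm (cinner a b) \<le> norm a * norm b * K" for K :: 'a
    by (rule exI[of _ 1]) (simp add: cmod_cinner_le)
qed

lemma sum_cmod_fn_le: "finite F \<Longrightarrow> (\<Sum>x\<in>F. (cmod (fn v x))\<^sup>2) \<le> (norm v)\<^sup>2"
  unfolding norm_l2_sq
  by (rule finite_sum_le_infsum) (use sqsum_fn[of v] in \<open>simp_all add: sqsum_def\<close>)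

lemma cmod_fn_le: "cmod (fn v x) \<le> norm v"
  using sum_cmod_fn_le[of "{x}" v] by (simp add: power2_le_iff_abs_le)

lemma sqsum_of_bound:
  assumes "\<And>F. finite F \<Longrightarrow> (\<Sum>x\<in>F. (cmod (f x))\<^sup>2) \<le> B\<^sup>2"
  shows "sqsum f"
  unfolding sqsum_def
  by (rule nonneg_bdd_above_summable_on) (use assms in \<open>auto intro!: bdd_aboveI\<close>)

lemma norm_Abs_le:
  assumes "\<And>F. finite F \<Longrightarrow> (\<Sum>x\<in>F. (cmod (f x))\<^sup>2) \<le> B\<^sup>2" "B \<ge> 0"
  shows "norm (Abs_l2 f) \<le> B"
proof -
  have s: "sqsum f" using assms(1) by (rule sqsum_of_bound)
  have "(norm (Abs_l2 f))\<^sup>2 \<le> B\<^sup>2"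
    unfolding norm_l2_sq fn_Abs[OF s]
    by (rule infsum_le_finite_sums) (use s assms(1) in \<open>simp_all add: sqsum_def\<close>)
  then show ?thesis using assms(2) by (rule power2_le_imp_le)
qed

instance l2 :: (type) banach
proof
  fix X :: "nat \<Rightarrow> 'a l2" assume X: "Cauchy X"
  have "Cauchy (\<lambda>n. fn (X n) x)" for x
  proof (rule CauchyI)
    fix e :: real assume "e > 0"
    then obtain N where N: "\<And>m n. m \<ge> N \<Longrightarrow> n \<ge> N \<Longrightarrow> norm (X m - X n) < e"
      using X unfolding Cauchy_iff by blast
    have "norm (fn (X m) x - fn (X n) x) < e" if "m \<ge> N" "n \<ge> N" for m n
      using cmod_fn_le[of "X m - X n" x] N[OF that] by simp
    then show "\<exists>M. \<forall>m\<ge>M. \<forall>n\<ge>M. norm (fn (X m) x - fn (X n) x) < e" by blast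
  qed
  then have "\<exists>l. (\<lambda>n. fn (X n) x) \<longlonglongrightarrow> l" for x
    using Cauchy_convergent_iff convergent_def by blast
  then obtain l where l: "\<And>x. (\<lambda>n. fn (X n) x) \<longlonglongrightarrow> l x" by metis
  have bound: "(\<Sum>x\<in>F. (cmod (fn (X m) x - l x))\<^sup>2) \<le> e\<^sup>2"
    if N: "\<And>m n. m \<ge> N \<Longrightarrow> n \<ge> N \<Longrightarrow> norm (X m - X n) < e" and m: "m \<ge> N" and F: "finite F" for N e m F
  proof (rule LIMSEQ_le_const2)
    show "(\<lambda>n. \<Sum>x\<in>F. (cmod (fn (X m) x - fn (X n) x))\<^sup>2) \<longlonglongrightarrow> (\<Sum>x\<in>F. (cmod (fn (X m) x - l x))\<^sup>2)"
      by (intro tendsto_intros l)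
    have "(\<Sum>x\<in>F. (cmod (fn (X m) x - fn (X n) x))\<^sup>2) \<le> e\<^sup>2" if "n \<ge> N" for n
    proof -
      have "(\<Sum>x\<in>F. (cmod (fn (X m) x - fn (X n) x))\<^sup>2) \<le> (norm (X m - X n))\<^sup>2"
        using sum_cmod_fn_le[OF F, of "X m - X n"] by simp
      also have "\<dots> \<le> e\<^sup>2" using N[OF m that] by (intro power_mono) simp_all
      finally show ?thesis .
    qed
    then show "\<exists>N. \<forall>n\<ge>N. (\<Sum>x\<in>F. (cmod (fn (X m) x - fn (X n) x))\<^sup>2) \<le> e\<^sup>2" by blast
  qed
  obtain N1 where N1: "\<And>m n. m \<ge> N1 \<Longrightarrow> n \<ge> N1 \<Longrightarrow> norm (X m - X n) < 1"
    using X unfolding Cauchy_iff by (meson zero_less_one)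
  have d: "sqsum (\<lambda>x. fn (X N1) x - l x)" by (rule sqsum_of_bound) (rule bound[OF N1 order_refl])
  have sl: "sqsum l"
    using sqsum_add[OF sqsum_fn[of "X N1"] sqsum_cmult[OF d, of "-1"]] by simp
  define L where "L = Abs_l2 l"
  have fnL: "fn L = l" using sl by (simp add: L_def fn_Abs)
  have "X \<longlonglongrightarrow> L"
  proof (rule LIMSEQ_I)
    fix e :: real assume e: "e > 0"
    then obtain N where N: "\<And>m n. m \<ge> N \<Longrightarrow> n \<ge> N \<Longrightarrow> norm (X m - X n) < e / 2"
      using X unfolding Cauchy_iff by (meson half_gt_zero)
    have "norm (X m - L) < e" if m: "m \<ge> N" for m
    proof -
      have "X m - L = Abs_l2 (\<lambda>x. fn (X m) x - l x)"
        by (metis (no_types, lifting) ext fn_inverse fn_minus fnL)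
      moreover have "norm (Abs_l2 (\<lambda>x. fn (X m) x - l x)) \<le> e / 2"
        by (rule norm_Abs_le) (use bound[OF N m] e in auto)
      ultimately show ?thesis using e by simp
    qed
    then show "\<exists>no. \<forall>n\<ge>no. norm (X n - L) < e" by blast
  qed
  then show "convergent X" by (auto simp: convergent_def)
qed

definition delta :: "'a \<Rightarrow> 'a l2" where "delta x = Abs_l2 (\<lambda>y. if y = x then 1 else 0)"

lemma fn_delta: "fn (delta x) y = (if y = x then 1 else 0)"
proof -
  have "sqsum (\<lambda>y. if y = x then 1 else 0)"
    by (rule sqsum_of_bound[of _ 1]) (simp add: if_distrib[of cmod] if_distrib[of "\<lambda>x. x\<^sup>2"] sum.delta' cong: if_cong)
  then show ?thesis by (simp add: delta_def fn_Abs)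
qed

lemma cinner_delta_right: "cinner v (delta x) = fn v x"
proof -
  have "cinner v (delta x) = (\<Sum>\<^sub>\<infinity>y\<in>{x}. fn v y * cnj (fn (delta x) y))"
    unfolding cinner_def by (rule infsum_cong_neutral) (auto simp: fn_delta)
  then show ?thesis by (simp add: fn_delta)
qed

lemma cinner_delta_left: "cinner (delta x) v = cnj (fn v x)"
  by (subst cinner_commute) (simp add: cinner_delta_right)

lemma fn_finite_combination:
  "finite F \<Longrightarrow> fn (\<Sum>x\<in>F. cscale (a x) (delta x)) y = (if y \<in> F then a y else 0)"
proof (induction F rule: finite_induct)
  case (insert x F) then show ?case by (auto simp: fn_delta)
qed simp

lemma norm_finite_combination:
  assumes "finite F"
  shows "(norm (\<Sum>x\<in>F. cscale (a x) (delta x)))\<^sup>2 = (\<Sum>x\<in>F. (cmod (a x))\<^sup>2)"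
proof -
  have "(norm (\<Sum>x\<in>F. cscale (a x) (delta x)))\<^sup>2 = (\<Sum>\<^sub>\<infinity>x\<in>F. (cmod (a x))\<^sup>2)"
    unfolding norm_l2_sq by (rule infsum_cong_neutral) (auto simp: fn_finite_combination[OF assms])
  then show ?thesis using assms by simp
qed

text \<open>Finite truncations converge to \<open>v\<close> in norm.\<close>
lemma closed_subspace_delta_UNIV:
  fixes W :: "'a l2 set"
  assumes W: "subspace W" "closed W" and delta: "\<And>c x. cscale c (delta x) \<in> W"
  shows "v \<in> W"
proof -
  define t where "t F = (\<Sum>x\<in>F. cscale (fn v x) (delta x))" for F
  have fnt: "fn (t F) y = (if y \<in> F then fn v y else 0)" if "finite F" for F y
    using that unfolding t_def by (rule fn_finite_combination)
  have tW: "t F \<in> W" for F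
    unfolding t_def by (rule subspace_sum[OF W(1)]) (rule delta)
  have "\<exists>w\<in>W. dist w v < e" if e: "e > 0" for e
  proof -
    have "((\<lambda>x. (cmod (fn v x))\<^sup>2) has_sum (norm v)\<^sup>2) UNIV"
      unfolding norm_l2_sq by (rule has_sum_infsum) (use sqsum_fn[of v] in \<open>simp add: sqsum_def\<close>)
    then have "\<forall>\<^sub>F F in finite_subsets_at_top UNIV. dist (\<Sum>x\<in>F. (cmod (fn v x))\<^sup>2) ((norm v)\<^sup>2) < e\<^sup>2"
      unfolding has_sum_def using e by (intro tendstoD) auto
    then obtain F where F: "finite F" "dist (\<Sum>x\<in>F. (cmod (fn v x))\<^sup>2) ((norm v)\<^sup>2) < e\<^sup>2"
      unfolding eventually_finite_subsets_at_top by blast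
    have "cinner (t F) (v - t F) = 0"
    proof -
      have "fn (t F) x * cnj (fn (v - t F) x) = 0" for x by (simp add: fnt[OF F(1)])
      then show ?thesis unfolding cinner_def by (simp only: infsum_0_simp)
    qed
    then have "(norm v)\<^sup>2 = (norm (t F))\<^sup>2 + (norm (v - t F))\<^sup>2"
      using norm_add_Pythagorean[of "t F" "v - t F"] by (simp add: orthogonal_def inner_l2_def)
    moreover have "(norm (t F))\<^sup>2 = (\<Sum>x\<in>F. (cmod (fn v x))\<^sup>2)"
      unfolding t_def by (rule norm_finite_combination[OF F(1)])
    ultimately have "(norm (v - t F))\<^sup>2 < e\<^sup>2" using F(2) by (simp add: dist_real_def)
    then have "norm (v - t F) < e" using e by (meson less_eq_real_def power2_less_imp_less)
    then show ?thesis using tW by (metis dist_commute dist_norm)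
  qed
  then have "v \<in> closure W" by (simp add: closure_approachable)
  then show ?thesis using W(2) by simp
qed

section \<open>Bounded operators\<close>

text \<open>Weighted composition operators. Multiplication operators, coordinate projections and the twisted
translations are all of this form.\<close>
definition wcomp :: "'a set \<Rightarrow> ('a \<Rightarrow> complex) \<Rightarrow> ('a \<Rightarrow> 'a) \<Rightarrow> 'a l2 \<Rightarrow>\<^sub>L 'a l2" where
  "wcomp X w p = Blinfun (\<lambda>v. Abs_l2 (\<lambda>x. if x \<in> X then w x * fn v (p x) else 0))"

lemma
  assumes inj: "inj_on p X" and w: "\<And>x. x \<in> X \<Longrightarrow> cmod (w x) \<le> c" and c: "0 \<le> c"
  shows fn_wcomp: "fn (wcomp X w p v) x = (if x \<in> X then w x * fn v (p x) else 0)"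
    and norm_wcomp_le: "norm (wcomp X w p) \<le> c"
proof -
  define f where "f v = Abs_l2 (\<lambda>x. if x \<in> X then w x * fn v (p x) else 0)" for v
  have le: "cmod (if x \<in> X then w x * fn v (p x) else 0) \<le> c * cmod (if x \<in> X then fn v (p x) else 0)" for v x
    using w[of x] by (simp add: norm_mult mult_right_mono)
  have sq: "sqsum (\<lambda>x. if x \<in> X then w x * fn v (p x) else 0)" for v
    by (rule sqsum_le[OF sqsum_comp(1)[OF sqsum_fn[of v] inj] le])
  have fnf: "fn (f v) x = (if x \<in> X then w x * fn v (p x) else 0)" for v x
    using sq by (simp add: f_def fn_Abs)
  have nrm: "norm (f v) \<le> c * norm v" for v
  proof -
    have s1: "sqsum (\<lambda>x. if x \<in> X then fn v (p x) else 0)" by (rule sqsum_comp(1)[OF sqsum_fn inj])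
    have "(norm (f v))\<^sup>2 = (\<Sum>\<^sub>\<infinity>x. (cmod (if x \<in> X then w x * fn v (p x) else 0))\<^sup>2)"
      unfolding norm_l2_sq fnf ..
    also have "\<dots> \<le> (\<Sum>\<^sub>\<infinity>x. c\<^sup>2 * (cmod (if x \<in> X then fn v (p x) else 0))\<^sup>2)"
    proof (rule infsum_mono)
      show "(\<lambda>x. (cmod (if x \<in> X then w x * fn v (p x) else 0))\<^sup>2) summable_on UNIV"
        using sq unfolding sqsum_def .
      show "(\<lambda>x. c\<^sup>2 * (cmod (if x \<in> X then fn v (p x) else 0))\<^sup>2) summable_on UNIV"
        using s1 unfolding sqsum_def by (rule summable_on_cmult_right)
      show "(cmod (if x \<in> X then w x * fn v (p x) else 0))\<^sup>2
          \<le> c\<^sup>2 * (cmod (if x \<in> X then fn v (p x) else 0))\<^sup>2" for x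
        unfolding power_mult_distrib[symmetric] by (rule power_mono[OF le]) simp
    qed
    also have "\<dots> = c\<^sup>2 * (\<Sum>\<^sub>\<infinity>x. (cmod (if x \<in> X then fn v (p x) else 0))\<^sup>2)"
      by (rule infsum_cmult_right) (use s1 in \<open>simp add: sqsum_def\<close>)
    also have "\<dots> \<le> c\<^sup>2 * (norm v)\<^sup>2"
      unfolding norm_l2_sq by (rule mult_left_mono[OF sqsum_comp(2)[OF sqsum_fn inj]]) simp
    finally have "(norm (f v))\<^sup>2 \<le> (c * norm v)\<^sup>2" by (simp add: power_mult_distrib)
    then show ?thesis using c by (simp add: power2_le_iff_abs_le)
  qed
  have "bounded_linear f"
  proof (rule bounded_linear_intro)
    show "f (v + w) = f v + f w" for v w by (rule l2_eqI) (simp add: fnf algebra_simps)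
    show "f (r *\<^sub>R v) = r *\<^sub>R f v" for r v by (rule l2_eqI) (simp add: fnf algebra_simps)
    show "norm (f v) \<le> norm v * c" for v using nrm[of v] by (simp add: mult.commute)
  qed
  then have app: "blinfun_apply (wcomp X w p) = f"
    unfolding wcomp_def f_def[symmetric] by (rule bounded_linear_Blinfun_apply)
  show "fn (wcomp X w p v) x = (if x \<in> X then w x * fn v (p x) else 0)" by (simp add: app fnf)
  show "norm (wcomp X w p) \<le> c" by (rule norm_blinfun_bound[OF c]) (simp add: app nrm)
qed

definition complex_scaling :: "complex \<Rightarrow> 'a l2 \<Rightarrow>\<^sub>L 'a l2" where "complex_scaling c = wcomp UNIV (\<lambda>_. c) (\<lambda>x. x)"

definition cop :: "complex \<Rightarrow> ('a l2 \<Rightarrow>\<^sub>L 'a l2) \<Rightarrow> 'a l2 \<Rightarrow>\<^sub>L 'a l2" where "cop c T = complex_scaling c o\<^sub>L T"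

definition proj :: "'a set \<Rightarrow> 'a l2 \<Rightarrow>\<^sub>L 'a l2" where "proj X = wcomp X (\<lambda>_. 1) (\<lambda>x. x)"

lemma complex_scaling_apply [simp]: "complex_scaling c v = cscale c v"
  by (rule l2_eqI) (simp add: complex_scaling_def fn_wcomp[where c = "cmod c"])

lemma cop_apply [simp]: "cop c T v = cscale c (T v)"
  by (simp add: cop_def)

lemma fn_proj [simp]: "fn (proj X v) x = (if x \<in> X then fn v x else 0)"
  unfolding proj_def by (subst fn_wcomp[where c = 1]) simp_all

lemma norm_proj_le: "norm (proj X) \<le> 1"
  unfolding proj_def by (rule norm_wcomp_le) simp_all

lemma norm_proj_apply_le: "norm (proj X v) \<le> norm v"
  using norm_blinfun[of "proj X" v] mult_right_mono[OF norm_proj_le[of X], of "norm v"] by simp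

lemma proj_proj: "proj X o\<^sub>L proj Y = proj (X \<inter> Y)"
  by (rule blinfun_eqI, rule l2_eqI) auto

lemma norm_cop [simp]: "norm (cop c T) = cmod c * norm T"
proof (rule antisym)
  show 1: "norm (cop c T) \<le> cmod c * norm T" for c and T :: "'a l2 \<Rightarrow>\<^sub>L 'a l2"
    by (rule norm_blinfun_bound) (simp_all add: mult.assoc mult_left_mono norm_blinfun)
  show "cmod c * norm T \<le> norm (cop c T)"
  proof (cases "c = 0")
    case False
    have "T = cop (inverse c) (cop c T)" using False by (intro blinfun_eqI) simp
    then have "norm T \<le> cmod (inverse c) * norm (cop c T)" using 1[of "inverse c" "cop c T"] by simp
    then show ?thesis using False by (simp add: norm_divide field_simps)
  qed simp
qed

lemma cop_add: "cop c (S + T) = cop c S + cop c T"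
  by (rule blinfun_eqI) (simp add: blinfun.add_left cscale_add)
lemma cop_cop [simp]: "cop c (cop d T) = cop (c * d) T"
  by (rule blinfun_eqI) simp
lemma cop_one [simp]: "cop 1 T = T"
  by (rule blinfun_eqI) simp
lemma cop_zero [simp]: "cop 0 T = 0"
  by (rule blinfun_eqI, rule l2_eqI) simp
lemma cop_of_real: "cop (complex_of_real r) T = r *\<^sub>R T"
  by (rule blinfun_eqI) (simp add: blinfun.scaleR_left scaleR_eq_cscale)
lemma cop_minus_one: "cop (-1) T = - T"
  using cop_of_real[of "-1" T] by simp
lemma cop_compose_left: "cop c S o\<^sub>L T = cop c (S o\<^sub>L T)"
  by (rule blinfun_eqI) simp

definition complex_linear :: "('a l2 \<Rightarrow>\<^sub>L 'a l2) \<Rightarrow> bool" where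
  "complex_linear T \<longleftrightarrow> (\<forall>c v. T (cscale c v) = cscale c (T v))"

lemma complex_linear_apply: "complex_linear T \<Longrightarrow> T (cscale c v) = cscale c (T v)" by (simp add: complex_linear_def)

lemma cop_compose_right: "complex_linear S \<Longrightarrow> S o\<^sub>L cop c T = cop c (S o\<^sub>L T)"
  by (rule blinfun_eqI) (simp add: complex_linear_apply)

lemma complex_linear_compose: "complex_linear S \<Longrightarrow> complex_linear T \<Longrightarrow> complex_linear (S o\<^sub>L T)" by (simp add: complex_linear_def)
lemma complex_linear_add: "complex_linear S \<Longrightarrow> complex_linear T \<Longrightarrow> complex_linear (S + T)"
  by (simp add: complex_linear_def blinfun.add_left cscale_add)
lemma complex_linear_cop: "complex_linear T \<Longrightarrow> complex_linear (cop c T)" by (simp add: complex_linear_def mult.commute)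
lemma complex_linear_proj: "complex_linear (proj X)"
  unfolding complex_linear_def by (intro allI l2_eqI) simp
lemma complex_linear_wcomp:
  assumes "inj_on p X" "\<And>x. x \<in> X \<Longrightarrow> cmod (w x) \<le> c" "0 \<le> c" shows "complex_linear (wcomp X w p)"
  unfolding complex_linear_def by (intro allI l2_eqI) (simp add: fn_wcomp[OF assms])

subsection \<open>Adjoints\<close>

lemma le_if_square_le_mult:
  fixes a b :: real
  assumes "a * a \<le> b * a" "0 \<le> a" "0 \<le> b" shows "a \<le> b"
proof (cases "a = 0")
  case False
  then show ?thesis using assms by (intro mult_right_le_imp_le[of a a b]) simp_all
qed (use assms in simp)

definition isadj :: "('a l2 \<Rightarrow>\<^sub>L 'a l2) \<Rightarrow> ('a l2 \<Rightarrow>\<^sub>L 'a l2) \<Rightarrow> bool" where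
  "isadj S T \<longleftrightarrow> (\<forall>v w. cinner (T v) w = cinner v (S w))"

lemma isadjD: "isadj S T \<Longrightarrow> cinner (T v) w = cinner v (S w)" by (simp add: isadj_def)

lemma isadj_sym: "isadj S T \<Longrightarrow> isadj T S"
  unfolding isadj_def by (metis cinner_commute)

lemma cinner_ext: assumes "\<And>u. cinner u v = cinner u w" shows "v = w"
  by (rule l2_eqI) (metis assms cinner_delta_left complex_cnj_cancel_iff)

lemma isadj_unique: "isadj S T \<Longrightarrow> isadj S' T \<Longrightarrow> S = S'"
  by (rule blinfun_eqI, rule cinner_ext) (metis isadj_def)

lemma isadj_complex_linear: "isadj S T \<Longrightarrow> complex_linear S"
  unfolding complex_linear_def by (intro allI, rule cinner_ext) (simp add: isadjD[symmetric])

lemma isadj_norm_le: assumes "isadj S T" shows "norm S \<le> norm T"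
proof (rule norm_blinfun_bound)
  fix w
  have "(norm (S w))\<^sup>2 = cmod (cinner (S w) (S w))"
    by (simp only: cinner_self_norm norm_of_real abs_power2)
  also have "\<dots> = cmod (cinner (T (S w)) w)" by (simp add: isadjD[OF assms])
  also have "\<dots> \<le> norm (T (S w)) * norm w" by (rule cmod_cinner_le)
  also have "\<dots> \<le> norm T * norm (S w) * norm w" by (simp add: mult_right_mono norm_blinfun)
  finally have "norm (S w) * norm (S w) \<le> (norm T * norm w) * norm (S w)"
    by (simp add: power2_eq_square mult_ac)
  then show "norm (S w) \<le> norm T * norm w"
    by (rule le_if_square_le_mult) simp_all
qed simp

lemma isadj_compose: "isadj S T \<Longrightarrow> isadj S' T' \<Longrightarrow> isadj (S' o\<^sub>L S) (T o\<^sub>L T')"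
  by (simp add: isadj_def)
lemma isadj_add: "isadj S T \<Longrightarrow> isadj S' T' \<Longrightarrow> isadj (S + S') (T + T')"
  by (simp add: isadj_def blinfun.add_left cinner_add_left cinner_add_right)
lemma isadj_cop: "isadj S T \<Longrightarrow> isadj (cop (cnj c) S) (cop c T)"
  by (simp add: isadj_def)

lemma isadj_proj: "isadj (proj X) (proj X)"
  unfolding isadj_def cinner_def by (intro allI infsum_cong) simp

definition adj :: "('a l2 \<Rightarrow>\<^sub>L 'a l2) \<Rightarrow> 'a l2 \<Rightarrow>\<^sub>L 'a l2" where "adj T = (SOME S. isadj S T)"

text \<open>The coordinates of the adjoint are forced by its action on the basis vectors. They are square-summable because
their finite truncations can be tested against \<open>T\<close> itself.\<close>
lemma isadj_adj:
  assumes T: "complex_linear T" shows "isadj (adj T) T"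
proof -
  define s where "s w x = cnj (cinner (T (delta x)) w)" for w x
  have bound: "(\<Sum>x\<in>F. (cmod (s w x))\<^sup>2) \<le> (norm T * norm w)\<^sup>2" if F: "finite F" for F w
  proof -
    define q where "q = (\<Sum>x\<in>F. (cmod (s w x))\<^sup>2)"
    define z where "z = (\<Sum>x\<in>F. cscale (s w x) (delta x))"
    have nz: "(norm z)\<^sup>2 = q" unfolding z_def q_def by (rule norm_finite_combination[OF F])
    have "T z = (\<Sum>x\<in>F. cscale (s w x) (T (delta x)))"
      unfolding z_def by (simp add: blinfun.sum_right complex_linear_apply[OF T])
    then have "cinner (T z) w = (\<Sum>x\<in>F. s w x * cinner (T (delta x)) w)"
      by (simp add: bounded_bilinear.sum_left[OF bounded_bilinear_cinner])
    also have "\<dots> = complex_of_real q"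
      unfolding q_def of_real_sum
      by (rule sum.cong[OF refl]) (simp only: s_def complex_mod_cnj complex_norm_square complex_cnj_cnj mult.commute)
    finally have eq: "cinner (T z) w = complex_of_real q" .
    have "q \<ge> 0" by (simp add: q_def sum_nonneg)
    then have "q = cmod (cinner (T z) w)" by (simp add: eq)
    also have "\<dots> \<le> norm (T z) * norm w" by (rule cmod_cinner_le)
    also have "\<dots> \<le> norm T * norm z * norm w" by (simp add: mult_right_mono norm_blinfun)
    finally have "norm z * norm z \<le> (norm T * norm w) * norm z"
      using nz by (simp add: power2_eq_square mult_ac)
    then have "norm z \<le> norm T * norm w"
      by (rule le_if_square_le_mult) simp_all
    then have "(norm z)\<^sup>2 \<le> (norm T * norm w)\<^sup>2" by (rule power_mono) simp
    then show ?thesis using nz by (simp add: q_def)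
  qed
  have sq: "sqsum (s w)" for w by (rule sqsum_of_bound) (rule bound)
  have fnS: "fn (Abs_l2 (s w)) x = s w x" for w x by (simp add: fn_Abs sq)
  have "bounded_linear (\<lambda>w. Abs_l2 (s w))"
  proof (rule bounded_linear_intro)
    show "Abs_l2 (s (v + w)) = Abs_l2 (s v) + Abs_l2 (s w)" for v w
      by (rule l2_eqI) (simp add: fnS, simp add: s_def cinner_add_right)
    show "Abs_l2 (s (r *\<^sub>R v)) = r *\<^sub>R Abs_l2 (s v)" for r v
      by (rule l2_eqI) (simp add: fnS, simp add: s_def scaleR_eq_cscale)
    show "norm (Abs_l2 (s w)) \<le> norm w * norm T" for w
      by (rule norm_Abs_le) (use bound[of _ w] in \<open>simp_all add: mult.commute\<close>)
  qed
  then have app: "blinfun_apply (Blinfun (\<lambda>w. Abs_l2 (s w))) = (\<lambda>w. Abs_l2 (s w))"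
    by (rule bounded_linear_Blinfun_apply)
  have "isadj (Blinfun (\<lambda>w. Abs_l2 (s w))) T"
    unfolding isadj_def app
  proof (intro allI)
    fix v w
    define W where "W = {v. cinner (T v) w = cinner v (Abs_l2 (s w))}"
    have "v \<in> W"
    proof (rule closed_subspace_delta_UNIV)
      show "subspace W"
        unfolding W_def subspace_def
        by (simp add: blinfun.add_right complex_linear_apply[OF T] blinfun.zero_right cinner_add_left
            scaleR_eq_cscale bounded_bilinear.zero_left[OF bounded_bilinear_cinner])
      show "closed W"
        unfolding W_def
        by (intro closed_Collect_eq bounded_bilinear.continuous_on[OF bounded_bilinear_cinner] continuous_intros)
      show "cscale c (delta x) \<in> W" for c x
        by (simp add: W_def complex_linear_apply[OF T] cinner_delta_left fnS) (simp add: s_def)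
    qed
    then show "cinner (T v) w = cinner v (Abs_l2 (s w))" by (simp add: W_def)
  qed
  then show ?thesis unfolding adj_def by (rule someI)
qed

lemma adj_eqI: "isadj S T \<Longrightarrow> adj T = S"
  unfolding adj_def by (rule isadj_unique[of _ T]) (rule someI)

section \<open>Operators on square-summable functions over an index set\<close>

interpretation oL: bounded_bilinear "(o\<^sub>L) :: ('b::real_normed_vector \<Rightarrow>\<^sub>L 'c::real_normed_vector) \<Rightarrow>
    ('a::real_normed_vector \<Rightarrow>\<^sub>L 'b) \<Rightarrow> 'a \<Rightarrow>\<^sub>L 'c"
  by (rule bounded_bilinear_blinfun_compose)

lemma oL_assoc: "(R o\<^sub>L S) o\<^sub>L T = R o\<^sub>L (S o\<^sub>L T)"
  by (rule blinfun_eqI) simp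

text \<open>The complex-linear operators that live on the coordinates in \<open>X\<close>. They correspond to the bounded
operators on \<open>ell2 X\<close>, and the identity there corresponds to \<open>proj X\<close>.\<close>
definition corner :: "'a set \<Rightarrow> ('a l2 \<Rightarrow>\<^sub>L 'a l2) set" where
  "corner X = {S. complex_linear S \<and> proj X o\<^sub>L S = S \<and> S o\<^sub>L proj X = S}"

definition opr :: "'a set \<Rightarrow> ('a l2 \<Rightarrow>\<^sub>L 'a l2) \<Rightarrow> 'a operator" where
  "opr X S = (\<lambda>\<xi>\<in>ell2 X. fn (S (Abs_l2 \<xi>)))"

lemma corner_complex_linear: "S \<in> corner X \<Longrightarrow> complex_linear S" by (simp add: corner_def)

lemma corner_left: "S \<in> corner X \<Longrightarrow> proj X o\<^sub>L S = S" by (simp add: corner_def)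
lemma corner_right: "S \<in> corner X \<Longrightarrow> S o\<^sub>L proj X = S" by (simp add: corner_def)
lemma corner_left_apply: "S \<in> corner X \<Longrightarrow> proj X (S v) = S v"
  by (metis corner_left blinfun_apply_blinfun_compose)
lemma corner_right_apply: "S \<in> corner X \<Longrightarrow> S (proj X v) = S v"
  by (metis corner_right blinfun_apply_blinfun_compose)

lemma ell2_Abs:
  assumes "\<xi> \<in> ell2 X"
  shows "fn (Abs_l2 \<xi>) = \<xi>" "proj X (Abs_l2 \<xi>) = Abs_l2 \<xi>"
proof -
  show 1: "fn (Abs_l2 \<xi>) = \<xi>" using assms by (simp add: ell2_iff fn_Abs)
  show "proj X (Abs_l2 \<xi>) = Abs_l2 \<xi>"
    by (rule l2_eqI) (use assms in \<open>simp add: 1 ell2_iff\<close>)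
qed

lemma Abs_fn [simp]: "Abs_l2 (fn v) = v" by (rule fn_inverse)

lemma fn_in_ell2_iff: "fn v \<in> ell2 X \<longleftrightarrow> proj X v = v"
proof
  assume "fn v \<in> ell2 X"
  from ell2_Abs(2)[OF this] show "proj X v = v" by simp
next
  assume "proj X v = v"
  then have e: "fn v x = (if x \<in> X then fn v x else 0)" for x by (metis fn_proj)
  have "fn v x = 0" if "x \<notin> X" for x using e[of x] that by simp
  then show "fn v \<in> ell2 X" by (simp add: ell2_iff)
qed

lemma fn_proj_in_ell2 [simp]: "fn (proj X v) \<in> ell2 X"
  by (simp add: ell2_iff)

lemma ell2_norm_fn: assumes "fn v \<in> ell2 X" shows "ell2_norm X (fn v) = norm v"
proof -
  have "(\<Sum>\<^sub>\<infinity>x\<in>X. (cmod (fn v x))\<^sup>2) = (norm v)\<^sup>2"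
    unfolding norm_l2_sq by (rule infsum_cong_neutral) (use assms in \<open>auto simp: ell2_iff\<close>)
  then show ?thesis by (simp add: ell2_norm_def)
qed

lemma ell2_inner_fn:
  assumes "fn v \<in> ell2 X" shows "ell2_inner X (fn v) (fn w) = cinner v w"
  unfolding ell2_inner_def cinner_def
  by (rule infsum_cong_neutral) (use assms in \<open>auto simp: ell2_iff\<close>)

lemma opr_apply:
  fixes S :: "'a l2 \<Rightarrow>\<^sub>L 'a l2"
  shows "fn v \<in> ell2 X \<Longrightarrow> opr X S (fn v) = fn (S v)"
  by (simp add: opr_def)

lemma opr_ext:
  fixes S :: "'a l2 \<Rightarrow>\<^sub>L 'a l2"
  assumes "\<And>v. fn v \<in> ell2 X \<Longrightarrow> f (fn v) = fn (S v)" "\<And>\<xi>. \<xi> \<notin> ell2 X \<Longrightarrow> f \<xi> = undefined"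
  shows "f = opr X S"
proof
  fix \<xi>
  show "f \<xi> = opr X S \<xi>"
  proof (cases "\<xi> \<in> ell2 X")
    case True
    then have e: "\<xi> = fn (Abs_l2 \<xi>)" by (simp add: ell2_Abs)
    then show ?thesis using True assms(1)[of "Abs_l2 \<xi>"] opr_apply[of "Abs_l2 \<xi>" X S] by simp
  next
    case False
    then show ?thesis using assms(2) by (simp add: opr_def)
  qed
qed

lemma corner_ell2: "S \<in> corner X \<Longrightarrow> fn (S v) \<in> ell2 X"
  by (simp add: fn_in_ell2_iff corner_left_apply)

lemma opr_inj: assumes "S \<in> corner X" "T \<in> corner X" "opr X S = opr X T" shows "S = T"
proof (rule blinfun_eqI)
  fix v
  have "fn (S (proj X v)) = fn (T (proj X v))"
    using assms(3) opr_apply[OF fn_proj_in_ell2] by metis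
  then show "S v = T v" using assms(1,2) by (simp add: corner_right_apply fn_inject)
qed

lemma opr_bounded: assumes S: "S \<in> corner X" shows "opr X S \<in> bounded_ops X"
  unfolding bounded_ops_def
proof (intro CollectI conjI ballI allI)
  have mem: "opr X S \<xi> \<in> ell2 X" if "\<xi> \<in> ell2 X" for \<xi>
    using that corner_ell2[OF S] by (simp add: opr_def)
  then show "opr X S \<in> ell2 X \<rightarrow>\<^sub>E ell2 X" by (auto simp: opr_def)
  fix \<xi> assume x: "\<xi> \<in> ell2 X"
  then obtain v where v: "\<xi> = fn v" by (metis ell2_Abs(1))
  show "opr X S (\<lambda>x. \<xi> x + \<eta> x) = (\<lambda>x. opr X S \<xi> x + opr X S \<eta> x)" if y: "\<eta> \<in> ell2 X" for \<eta>
  proof -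
    obtain w where w: "\<eta> = fn w" using y by (metis ell2_Abs(1))
    have e: "(\<lambda>x. \<xi> x + \<eta> x) = fn (v + w)" by (simp add: v w fun_eq_iff)
    have m: "fn (v + w) \<in> ell2 X" using x y by (simp add: v w ell2_iff)
    show ?thesis
      unfolding e opr_apply[OF m] using x y by (simp add: v w opr_apply blinfun.add_right fun_eq_iff)
  qed
  show "opr X S (\<lambda>x. c * \<xi> x) = (\<lambda>x. c * opr X S \<xi> x)" for c
  proof -
    have e: "(\<lambda>x. c * \<xi> x) = fn (cscale c v)" by (simp add: v fun_eq_iff)
    have m: "fn (cscale c v) \<in> ell2 X" using x by (simp add: v ell2_iff)
    show ?thesis
      unfolding e opr_apply[OF m]
      using x by (simp add: v opr_apply complex_linear_apply[OF corner_complex_linear[OF S]] fun_eq_iff)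
  qed
next
  show "\<exists>C. \<forall>\<xi>\<in>ell2 X. ell2_norm X (opr X S \<xi>) \<le> C * ell2_norm X \<xi>"
  proof (intro exI ballI)
    fix \<xi> assume x: "\<xi> \<in> ell2 X"
    then obtain v where v: "\<xi> = fn v" by (metis ell2_Abs(1))
    show "ell2_norm X (opr X S \<xi>) \<le> norm S * ell2_norm X \<xi>"
      using x corner_ell2[OF S] by (simp add: v opr_apply ell2_norm_fn norm_blinfun)
  qed
qed

lemma bounded_ops_imp_opr:
  assumes T: "T \<in> bounded_ops X" obtains S where "S \<in> corner X" "T = opr X S"
proof -
  have mem: "\<And>\<xi>. \<xi> \<in> ell2 X \<Longrightarrow> T \<xi> \<in> ell2 X" and und: "\<And>\<xi>. \<xi> \<notin> ell2 X \<Longrightarrow> T \<xi> = undefined"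
    and add: "\<And>\<xi> \<eta>. \<xi> \<in> ell2 X \<Longrightarrow> \<eta> \<in> ell2 X \<Longrightarrow> T (\<lambda>x. \<xi> x + \<eta> x) = (\<lambda>x. T \<xi> x + T \<eta> x)"
    and scale: "\<And>\<xi> c. \<xi> \<in> ell2 X \<Longrightarrow> T (\<lambda>x. c * \<xi> x) = (\<lambda>x. c * T \<xi> x)"
  proof -
    have T1: "T \<in> ell2 X \<rightarrow>\<^sub>E ell2 X"
      and T2: "\<forall>\<xi>\<in>ell2 X. \<forall>\<eta>\<in>ell2 X. T (\<lambda>x. \<xi> x + \<eta> x) = (\<lambda>x. T \<xi> x + T \<eta> x)"
      and T3: "\<forall>c. \<forall>\<xi>\<in>ell2 X. T (\<lambda>x. c * \<xi> x) = (\<lambda>x. c * T \<xi> x)"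
      using T unfolding bounded_ops_def by blast+
    show "T \<xi> \<in> ell2 X" if "\<xi> \<in> ell2 X" for \<xi> using PiE_mem[OF T1 that] .
    show "T \<xi> = undefined" if "\<xi> \<notin> ell2 X" for \<xi> using PiE_arb[OF T1 that] .
    show "T (\<lambda>x. \<xi> x + \<eta> x) = (\<lambda>x. T \<xi> x + T \<eta> x)" if "\<xi> \<in> ell2 X" "\<eta> \<in> ell2 X" for \<xi> \<eta>
      using T2[rule_format, OF that] .
    show "T (\<lambda>x. c * \<xi> x) = (\<lambda>x. c * T \<xi> x)" if "\<xi> \<in> ell2 X" for \<xi> c
      using T3[rule_format, OF that] .
  qed
  obtain C where C: "\<And>\<xi>. \<xi> \<in> ell2 X \<Longrightarrow> ell2_norm X (T \<xi>) \<le> C * ell2_norm X \<xi>"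
    using T unfolding bounded_ops_def by blast
  define f where "f v = Abs_l2 (T (fn (proj X v)))" for v
  have fnf: "fn (f v) = T (fn (proj X v))" for v
    unfolding f_def by (rule ell2_Abs(1)[OF mem]) simp
  have fmem: "fn (f v) \<in> ell2 X" for v unfolding fnf by (rule mem) simp
  have "bounded_linear f"
  proof (rule bounded_linear_intro)
    fix v w r
    have "fn (proj X (v + w)) = (\<lambda>x. fn (proj X v) x + fn (proj X w) x)" by (auto simp: fun_eq_iff)
    then have "T (fn (proj X (v + w))) = (\<lambda>x. T (fn (proj X v)) x + T (fn (proj X w)) x)"
      by (simp only:) (rule add; rule fn_proj_in_ell2)
    then show "f (v + w) = f v + f w" by (intro l2_eqI) (simp add: fnf)
    have "fn (proj X (r *\<^sub>R v)) = (\<lambda>x. complex_of_real r * fn (proj X v) x)" by (auto simp: fun_eq_iff)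
    then have "T (fn (proj X (r *\<^sub>R v))) = (\<lambda>x. complex_of_real r * T (fn (proj X v)) x)"
      by (simp only:) (rule scale; rule fn_proj_in_ell2)
    then show "f (r *\<^sub>R v) = r *\<^sub>R f v" by (intro l2_eqI) (simp add: fnf)
    have "norm (f v) = ell2_norm X (T (fn (proj X v)))"
      using ell2_norm_fn[OF fmem[of v]] by (simp add: fnf)
    also have "\<dots> \<le> C * norm (proj X v)" using C[of "fn (proj X v)"] by (simp add: ell2_norm_fn)
    also have "\<dots> \<le> \<bar>C\<bar> * norm (proj X v)" by (rule mult_right_mono) simp_all
    also have "\<dots> \<le> \<bar>C\<bar> * norm v" by (rule mult_left_mono[OF norm_proj_apply_le]) simp
    finally show "norm (f v) \<le> norm v * \<bar>C\<bar>" by (simp add: mult.commute)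
  qed
  then have app: "blinfun_apply (Blinfun f) = f" by (rule bounded_linear_Blinfun_apply)
  have "complex_linear (Blinfun f)"
    unfolding complex_linear_def app
  proof (intro allI l2_eqI)
    fix c v x
    have "fn (proj X (cscale c v)) = (\<lambda>x. c * fn (proj X v) x)" by (auto simp: fun_eq_iff)
    then have "T (fn (proj X (cscale c v))) = (\<lambda>x. c * T (fn (proj X v)) x)"
      by (simp only:) (rule scale; rule fn_proj_in_ell2)
    then show "fn (f (cscale c v)) x = fn (cscale c (f v)) x" by (simp add: fnf)
  qed
  moreover have "proj X o\<^sub>L Blinfun f = Blinfun f"
    using fmem by (intro blinfun_eqI) (simp add: app fn_in_ell2_iff)
  moreover have "Blinfun f o\<^sub>L proj X = Blinfun f"
  proof (rule blinfun_eqI)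
    fix v
    have "proj X (proj X v) = proj X v" by (rule l2_eqI) simp
    then show "(Blinfun f o\<^sub>L proj X) v = Blinfun f v" by (simp add: app f_def)
  qed
  ultimately have c: "Blinfun f \<in> corner X" by (simp add: corner_def)
  have "T = opr X (Blinfun f)"
    by (rule opr_ext) (simp_all add: app fnf und fn_in_ell2_iff)
  with c show thesis by (rule that)
qed

lemma proj_corner: "proj X \<in> corner X"
  by (simp add: corner_def complex_linear_proj proj_proj)

lemma corner_add: "S \<in> corner X \<Longrightarrow> T \<in> corner X \<Longrightarrow> S + T \<in> corner X"
  by (simp add: corner_def complex_linear_add oL.add_left oL.add_right)
lemma corner_cop: "S \<in> corner X \<Longrightarrow> cop c S \<in> corner X"
  by (simp add: corner_def complex_linear_cop cop_compose_left cop_compose_right[OF complex_linear_proj])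
lemma corner_scaleR: "S \<in> corner X \<Longrightarrow> r *\<^sub>R S \<in> corner X"
  by (simp add: corner_cop cop_of_real[symmetric])
lemma corner_zero: "0 \<in> corner X"
  using corner_scaleR[OF proj_corner, of 0] by simp
lemma subspace_corner: "subspace (corner X)"
  by (simp add: subspace_def corner_zero corner_add corner_scaleR)

lemma closed_complex_linear: "closed (Collect (complex_linear :: ('a l2 \<Rightarrow>\<^sub>L 'a l2) \<Rightarrow> bool))"
proof -
  have "closed {T :: 'a l2 \<Rightarrow>\<^sub>L 'a l2. \<forall>c v. T (cscale c v) = complex_scaling c (T v)}"
    by (intro closed_Collect_all closed_Collect_eq continuous_intros)
  then show ?thesis by (simp add: complex_linear_def[abs_def])
qed

lemma closed_corner: "closed (corner (X :: 'a set))"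
proof -
  have "closed {S :: 'a l2 \<Rightarrow>\<^sub>L 'a l2. proj X o\<^sub>L S = S}" "closed {S :: 'a l2 \<Rightarrow>\<^sub>L 'a l2. S o\<^sub>L proj X = S}"
    by (intro closed_Collect_eq bounded_bilinear.continuous_on[OF bounded_bilinear_blinfun_compose] continuous_intros)+
  with closed_complex_linear show ?thesis
    unfolding corner_def by (intro closed_Collect_conj)
qed

lemma corner_adj:
  assumes S: "S \<in> corner X" and a: "isadj T S" shows "T \<in> corner X"
proof -
  have "isadj (proj X o\<^sub>L T) S" "isadj (T o\<^sub>L proj X) S"
    using isadj_compose[OF a isadj_proj[of X]] isadj_compose[OF isadj_proj[of X] a]
    by (simp_all only: corner_left[OF S] corner_right[OF S])
  from isadj_unique[OF a this(1)] isadj_unique[OF a this(2)]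
  have "T = proj X o\<^sub>L T" "T = T o\<^sub>L proj X" .
  then show ?thesis using isadj_complex_linear[OF a] by (simp add: corner_def)
qed

lemma op_add_opr: "S \<in> corner X \<Longrightarrow> T \<in> corner X \<Longrightarrow> op_add X (opr X S) (opr X T) = opr X (S + T)"
  by (rule opr_ext) (simp_all add: op_add_def opr_apply blinfun.add_left fun_eq_iff)

lemma op_scale_opr: "op_scale X c (opr X S) = opr X (cop c S)"
  by (rule opr_ext) (simp_all add: op_scale_def opr_apply fun_eq_iff)

lemma op_mult_opr: "T \<in> corner X \<Longrightarrow> op_mult X (opr X S) (opr X T) = opr X (S o\<^sub>L T)"
  by (rule opr_ext) (simp_all add: op_mult_def compose_def opr_apply corner_ell2)

lemma op_id_opr: "op_id X = opr X (proj X)"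
  by (rule opr_ext) (simp_all add: op_id_def fn_in_ell2_iff)

text \<open>The supremum over the unit ball of \<open>ell2 X\<close> is the full operator norm, because projecting onto the
coordinates in \<open>X\<close> does not increase the norm of a vector.\<close>
lemma op_norm_opr: assumes S: "S \<in> corner X" shows "op_norm X (opr X S) = norm S"
proof -
  define B where "B = (\<lambda>\<xi>. ell2_norm X (opr X S \<xi>)) ` {\<xi> \<in> ell2 X. ell2_norm X \<xi> \<le> 1}"
  have mem: "norm (S v) \<in> B" if "fn v \<in> ell2 X" "norm v \<le> 1" for v
    using that corner_ell2[OF S, of v]
    by (auto simp: B_def opr_apply ell2_norm_fn intro!: image_eqI[of _ _ "fn v"])
  have le: "b \<le> norm S" if b: "b \<in> B" for b
  proof -
    obtain \<xi> where x: "\<xi> \<in> ell2 X" "ell2_norm X \<xi> \<le> 1" "b = ell2_norm X (opr X S \<xi>)"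
      using b by (auto simp: B_def)
    obtain v where v: "\<xi> = fn v" using x(1) by (metis ell2_Abs(1))
    have "b = norm (S v)" "norm v \<le> 1" using x corner_ell2[OF S, of v] by (simp_all add: v opr_apply ell2_norm_fn)
    then show ?thesis using norm_blinfun[of S v] mult_left_mono[of "norm v" 1 "norm S"] by simp
  qed
  have bdd: "bdd_above B" using le by (rule bdd_aboveI)
  have B0: "0 \<in> B" using mem[of 0] by (simp add: ell2_iff sqsum_def blinfun.zero_right)
  have "norm S \<le> Sup B"
  proof (rule norm_blinfun_bound)
    show S0: "0 \<le> Sup B" by (rule cSup_upper[OF B0 bdd])
    fix v
    define w where "w = proj X v"
    have w: "fn w \<in> ell2 X" by (simp add: w_def)
    have "norm (S w) \<le> Sup B * norm w"
    proof (cases "norm w = 0")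
      case False
      have "norm (S (w /\<^sub>R norm w)) \<in> B"
        by (rule mem) (use w False in \<open>simp_all add: ell2_iff\<close>)
      then have "norm (S (w /\<^sub>R norm w)) \<le> Sup B" by (rule cSup_upper[OF _ bdd])
      then show ?thesis using False by (simp add: blinfun.scaleR_right field_simps)
    qed simp
    also have "\<dots> \<le> Sup B * norm v" using S0 by (simp add: w_def mult_left_mono norm_proj_apply_le)
    finally show "norm (S v) \<le> Sup B * norm v" using S by (simp add: w_def corner_right_apply)
  qed
  moreover have "Sup B \<le> norm S" using B0 le by (intro cSup_least) auto
  ultimately show ?thesis by (simp add: op_norm_def B_def)
qed

lemma op_adj_opr:
  assumes S: "S \<in> corner X" shows "op_adj X (opr X S) = opr X (adj S)"
proof -
  have a: "isadj (adj S) S" using isadj_adj[OF corner_complex_linear[OF S]] .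
  have aX: "adj S \<in> corner X" by (rule corner_adj[OF S a])
  show ?thesis
    unfolding op_adj_def
  proof (rule the_equality)
    have "ell2_inner X (opr X S \<xi>) \<eta> = ell2_inner X \<xi> (opr X (adj S) \<eta>)"
      if x: "\<xi> \<in> ell2 X" and y: "\<eta> \<in> ell2 X" for \<xi> \<eta>
    proof -
      obtain v w where "\<xi> = fn v" "\<eta> = fn w" using x y by (metis ell2_Abs(1))
      then show ?thesis
        using x y corner_ell2[OF S] isadjD[OF a] by (simp add: opr_apply ell2_inner_fn)
    qed
    then show "opr X (adj S) \<in> bounded_ops X \<and>
      (\<forall>\<xi>\<in>ell2 X. \<forall>\<eta>\<in>ell2 X. ell2_inner X (opr X S \<xi>) \<eta> = ell2_inner X \<xi> (opr X (adj S) \<eta>))"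
      using opr_bounded[OF aX] by blast
  next
    fix R assume R: "R \<in> bounded_ops X \<and>
      (\<forall>\<xi>\<in>ell2 X. \<forall>\<eta>\<in>ell2 X. ell2_inner X (opr X S \<xi>) \<eta> = ell2_inner X \<xi> (R \<eta>))"
    then obtain T where T: "T \<in> corner X" "R = opr X T" using bounded_ops_imp_opr by blast
    have "isadj T S"
      unfolding isadj_def
    proof (intro allI)
      fix v w
      have "cinner (S (proj X v)) (proj X w) = cinner (proj X v) (T (proj X w))"
      proof -
        have "ell2_inner X (opr X S (fn (proj X v))) (fn (proj X w))
            = ell2_inner X (fn (proj X v)) (opr X T (fn (proj X w)))"
          using R T(2) by (meson fn_proj_in_ell2)
        then show ?thesis by (simp only: opr_apply[OF fn_proj_in_ell2] ell2_inner_fn[OF corner_ell2[OF S]]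
              ell2_inner_fn[OF fn_proj_in_ell2])
      qed
      moreover have "cinner (S (proj X v)) (proj X w) = cinner (S v) w"
        unfolding isadjD[OF isadj_proj, symmetric] corner_right_apply[OF S] corner_left_apply[OF S] ..
      moreover have "cinner (proj X v) (T (proj X w)) = cinner v (T w)"
        unfolding isadjD[OF isadj_proj] corner_right_apply[OF T(1)] corner_left_apply[OF T(1)] ..
      ultimately show "cinner (S v) w = cinner v (T w)" by simp
    qed
    then have "adj S = T" by (rule adj_eqI)
    then show "R = opr X (adj S)" using T(2) by simp
  qed
qed

section \<open>Generated operator algebras\<close>

definition calg :: "('a l2 \<Rightarrow>\<^sub>L 'a l2) set \<Rightarrow> ('a l2 \<Rightarrow>\<^sub>L 'a l2) set" where
  "calg U = closure (span {cop c u | c u. u \<in> U})"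

lemma subspace_closure:
  fixes S :: "'b::real_normed_vector set"
  assumes S: "subspace S" shows "subspace (closure S)"
proof -
  have "x + y \<in> closure S" if xy: "x \<in> closure S" "y \<in> closure S" for x y
  proof -
    obtain f g where "\<And>n. f n \<in> S" "f \<longlonglongrightarrow> x" "\<And>n. g n \<in> S" "g \<longlonglongrightarrow> y"
      using xy unfolding closure_sequential by blast
    then show ?thesis
      unfolding closure_sequential using subspace_add[OF S] tendsto_add[of f x sequentially g y]
      by (intro exI[of _ "\<lambda>n. f n + g n"]) simp
  qed
  moreover have "r *\<^sub>R x \<in> closure S" if x: "x \<in> closure S" for r x
  proof -
    obtain f where "\<And>n. f n \<in> S" "f \<longlonglongrightarrow> x" using x unfolding closure_sequential by blast
    then show ?thesis
      unfolding closure_sequential using subspace_scale[OF S] tendsto_scaleR[OF tendsto_const, of f x sequentially r]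
      by (intro exI[of _ "\<lambda>n. r *\<^sub>R f n"]) simp
  qed
  moreover have "0 \<in> closure S" using subspace_0[OF S] closure_subset by blast
  ultimately show ?thesis by (simp add: subspace_def)
qed

lemma calg_closed: "closed (calg U)" by (simp add: calg_def)
lemma calg_subspace: "subspace (calg U)" by (simp add: calg_def subspace_closure subspace_span)
lemma calg_gen: "u \<in> U \<Longrightarrow> cop c u \<in> calg U"
  unfolding calg_def by (rule subsetD[OF closure_subset], rule span_base) blast
lemma calg_base: "u \<in> U \<Longrightarrow> u \<in> calg U" using calg_gen[of u U 1] by simp

text \<open>Everything about the generated algebra is checked on generators: the operators with a given property are
shown to form a closed subspace.\<close>
lemma calg_induct:
  assumes "subspace W" "closed W" "\<And>c u. u \<in> U \<Longrightarrow> cop c u \<in> W" "T \<in> calg U"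
  shows "T \<in> W"
proof -
  have "span {cop c u | c u. u \<in> U} \<subseteq> W" using assms by (intro span_minimal) auto
  then show ?thesis using assms(2,4) closure_minimal unfolding calg_def by blast
qed

lemma bounded_linear_cop: "bounded_linear (cop c)"
  unfolding cop_def by (rule bounded_bilinear.bounded_linear_right[OF bounded_bilinear_blinfun_compose])

lemma calg_linear_induct:
  fixes f :: "('a l2 \<Rightarrow>\<^sub>L 'a l2) \<Rightarrow> 'b::real_normed_vector"
  assumes f: "bounded_linear f" and W: "subspace W" "closed W" "\<And>c u. u \<in> U \<Longrightarrow> f (cop c u) \<in> W"
    and T: "T \<in> calg U"
  shows "f T \<in> W"
proof -
  have "T \<in> f -` W"
  proof (rule calg_induct[OF _ _ _ T])
    show "subspace (f -` W)"
      using linear_subspace_vimage[OF bounded_linear.linear[OF f] W(1)] .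
    show "closed (f -` W)"
      using linear_continuous_on[OF f] W(2) by (simp add: closed_vimage)
  qed (use W in auto)
  then show ?thesis by simp
qed

lemma calg_cop: "T \<in> calg U \<Longrightarrow> cop c T \<in> calg U"
  by (rule calg_linear_induct[OF bounded_linear_cop calg_subspace calg_closed]) (simp_all add: calg_gen)

text \<open>Closure of the generators under products and adjoints up to scalars makes their closed linear span a
C*-algebra.\<close>
locale operator_system =
  fixes X :: "'a set" and U :: "('a l2 \<Rightarrow>\<^sub>L 'a l2) set"
  assumes U_corner: "U \<subseteq> corner X" and U_ne: "U \<noteq> {}"
    and U_mult: "\<And>u v. u \<in> U \<Longrightarrow> v \<in> U \<Longrightarrow> \<exists>c. \<exists>w\<in>U. u o\<^sub>L v = cop c w"
    and U_adj: "\<And>u. u \<in> U \<Longrightarrow> \<exists>c. \<exists>w\<in>U. isadj (cop c w) u"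
begin

lemma calg_corner: "calg U \<subseteq> corner X"
  using calg_induct[OF subspace_corner closed_corner] U_corner corner_cop by blast

lemma calg_compose: assumes "S \<in> calg U" "T \<in> calg U" shows "S o\<^sub>L T \<in> calg U"
proof -
  have 1: "u o\<^sub>L T \<in> calg U" if u: "u \<in> U" for u
  proof (rule calg_linear_induct[OF _ calg_subspace calg_closed _ assms(2)])
    show "bounded_linear ((o\<^sub>L) u)"
      by (rule bounded_bilinear.bounded_linear_right[OF bounded_bilinear_blinfun_compose])
    fix c v assume v: "v \<in> U"
    obtain d w where w: "w \<in> U" "u o\<^sub>L v = cop d w" using U_mult[OF u v] by blast
    have "complex_linear u" using u U_corner corner_complex_linear by blast
    then show "u o\<^sub>L cop c v \<in> calg U"
      using w by (simp add: cop_compose_right calg_gen)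
  qed
  show ?thesis
  proof (rule calg_linear_induct[OF _ calg_subspace calg_closed _ assms(1)])
    show "bounded_linear (\<lambda>S. S o\<^sub>L T)"
      by (rule bounded_bilinear.bounded_linear_left[OF bounded_bilinear_blinfun_compose])
  qed (simp add: cop_compose_left 1 calg_cop)
qed

text \<open>Taking adjoints is isometric, hence passes to limits.\<close>
lemma calg_adj: assumes "T \<in> calg U" shows "adj T \<in> calg U"
proof -
  define W where "W = {T. complex_linear T \<and> adj T \<in> calg U}"
  have ad: "isadj (adj T) T" if "T \<in> W" for T using that by (intro isadj_adj) (simp add: W_def)
  have "T \<in> W"
  proof (rule calg_induct[OF _ _ _ assms])
    have "isadj 0 (0 :: 'a l2 \<Rightarrow>\<^sub>L 'a l2)"
      by (simp add: isadj_def bounded_bilinear.zero_left[OF bounded_bilinear_cinner]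
          bounded_bilinear.zero_right[OF bounded_bilinear_cinner])
    from adj_eqI[OF this] isadj_complex_linear[OF this] have "0 \<in> W"
      using calg_subspace[of U] by (simp add: W_def subspace_0)
    moreover have "S + T \<in> W" if "S \<in> W" "T \<in> W" for S T
      using adj_eqI[OF isadj_add[OF ad[OF that(1)] ad[OF that(2)]]] that calg_subspace[of U]
      by (simp add: W_def complex_linear_add subspace_add)
    moreover have "r *\<^sub>R T \<in> W" if "T \<in> W" for r T
      using adj_eqI[OF isadj_cop[OF ad[OF that], of "complex_of_real r"]] that
      by (simp add: W_def complex_linear_cop calg_cop cop_of_real[symmetric])
    ultimately show "subspace W" by (simp add: subspace_def)
    show "closed W"
      unfolding closed_sequential_limits
    proof (intro allI impI, elim conjE)
      fix x l assume x: "\<forall>n. x n \<in> W" "x \<longlonglongrightarrow> l"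
      have "complex_linear l" using closed_complex_linear x unfolding closed_sequential_limits W_def by blast
      then have al: "isadj (adj l) l" by (rule isadj_adj)
      have le: "norm (adj (x n) - adj l) \<le> norm (x n - l)" for n
      proof (rule isadj_norm_le)
        show "isadj (adj (x n) - adj l) (x n - l)"
          using isadj_add[OF ad isadj_cop[OF al, of "-1"], of "x n"] x(1) by (simp add: cop_minus_one)
      qed
      have lim: "(\<lambda>n. norm (x n - l)) \<longlonglongrightarrow> 0"
        using x(2) LIM_zero tendsto_norm_zero by blast
      have "(\<lambda>n. adj (x n) - adj l) \<longlonglongrightarrow> 0"
        by (rule Lim_null_comparison[OF _ lim]) (simp add: le)
      then have "(\<lambda>n. adj (x n)) \<longlonglongrightarrow> adj l" by (rule LIM_zero_cancel)
      moreover have "adj (x n) \<in> calg U" for n using x(1) by (simp add: W_def)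
      ultimately have "adj l \<in> calg U"
        using closed_sequentially[OF calg_closed] by meson
      then show "l \<in> W" using \<open>complex_linear l\<close> by (simp add: W_def)
    qed
    fix c u assume u: "u \<in> U"
    obtain d w where w: "w \<in> U" "isadj (cop d w) u" using U_adj[OF u] by blast
    show "cop c u \<in> W"
      using adj_eqI[OF isadj_cop[OF w(2), of c]] isadj_complex_linear[OF isadj_sym[OF isadj_cop[OF w(2), of c]]] w(1)
      by (simp add: W_def calg_gen)
  qed
  then show ?thesis by (simp add: W_def)
qed

lemma opr_diff: "S \<in> corner X \<Longrightarrow> T \<in> corner X \<Longrightarrow>
  op_norm X (op_add X (opr X S) (op_scale X (-1) (opr X T))) = norm (S - T)"
  by (simp add: op_scale_opr op_add_opr corner_cop op_norm_opr corner_add) (simp add: cop_minus_one)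

lemma cstar_subalgebra_calg: "cstar_subalgebra X (opr X ` calg U)"
  unfolding cstar_subalgebra_def
proof (intro conjI ballI allI impI)
  show "opr X ` calg U \<subseteq> bounded_ops X" using calg_corner opr_bounded by blast
  show "opr X ` calg U \<noteq> {}" using U_ne calg_base by blast
  fix S assume "S \<in> opr X ` calg U"
  then obtain S' where S: "S' \<in> calg U" "S = opr X S'" by blast
  have Sc: "S' \<in> corner X" using S calg_corner by blast
  show "op_scale X c S \<in> opr X ` calg U" for c
    unfolding S(2) op_scale_opr by (rule imageI) (rule calg_cop[OF S(1)])
  show "op_adj X S \<in> opr X ` calg U"
    unfolding S(2) op_adj_opr[OF Sc] by (rule imageI) (rule calg_adj[OF S(1)])
  fix T assume "T \<in> opr X ` calg U"
  then obtain T' where T: "T' \<in> calg U" "T = opr X T'" by blast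
  have Tc: "T' \<in> corner X" using T calg_corner by blast
  show "op_add X S T \<in> opr X ` calg U"
    unfolding S(2) T(2) op_add_opr[OF Sc Tc]
    by (rule imageI) (rule subspace_add[OF calg_subspace S(1) T(1)])
  show "op_mult X S T \<in> opr X ` calg U"
    unfolding S(2) T(2) op_mult_opr[OF Tc] by (rule imageI) (rule calg_compose[OF S(1) T(1)])
next
  fix T assume T: "T \<in> bounded_ops X"
    and app: "\<forall>\<epsilon>>0. \<exists>S\<in>opr X ` calg U. op_norm X (op_add X T (op_scale X (- 1) S)) < \<epsilon>"
  obtain T' where T': "T' \<in> corner X" "T = opr X T'" using bounded_ops_imp_opr[OF T] by blast
  have "\<exists>S\<in>calg U. dist S T' < e" if e: "e > 0" for e
  proof -
    obtain S where S: "S \<in> calg U" "op_norm X (op_add X T (op_scale X (- 1) (opr X S))) < e"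
      using app e by blast
    then have "norm (T' - S) < e" using T' calg_corner by (simp add: opr_diff subset_iff)
    then show ?thesis using S(1) by (metis dist_commute dist_norm)
  qed
  then have "T' \<in> closure (calg U)" by (simp add: closure_approachable)
  then show "T \<in> opr X ` calg U" using T' calg_closed[of U] by simp
qed

lemma calg_minimal:
  assumes A: "cstar_subalgebra X A" "opr X ` U \<subseteq> A" and T: "T \<in> calg U" shows "opr X T \<in> A"
proof -
  define W where "W = {S \<in> corner X. opr X S \<in> A}"
  have add: "op_add X S T \<in> A" if "S \<in> A" "T \<in> A" for S T
    using A(1) that unfolding cstar_subalgebra_def by blast
  have scale: "op_scale X c T \<in> A" if "T \<in> A" for c T
    using A(1) that unfolding cstar_subalgebra_def by blast
  have cl: "T \<in> A" if "T \<in> bounded_ops X"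
    "\<And>e. e > 0 \<Longrightarrow> \<exists>S\<in>A. op_norm X (op_add X T (op_scale X (-1) S)) < e" for T
    using A(1) that unfolding cstar_subalgebra_def by blast
  have cop: "cop c S \<in> W" if "S \<in> W" for c S
    using that scale[of "opr X S" c] by (simp add: W_def corner_cop op_scale_opr)
  have Uw: "u \<in> W" if "u \<in> U" for u using that U_corner A(2) by (auto simp: W_def)
  obtain u0 where u0: "u0 \<in> U" using U_ne by blast
  have "T \<in> W"
  proof (rule calg_induct[OF _ _ _ T])
    have "S + T \<in> W" if "S \<in> W" "T \<in> W" for S T
      using that add[of "opr X S" "opr X T"] by (simp add: W_def corner_add op_add_opr)
    moreover have "0 \<in> W" using cop[OF Uw[OF u0], of 0] by simp
    moreover have "r *\<^sub>R S \<in> W" if "S \<in> W" for r S using cop[OF that, of "complex_of_real r"] by (simp add: cop_of_real)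
    ultimately show "subspace W" by (simp add: subspace_def)
    have "closure W \<subseteq> W"
    proof
      fix S assume S: "S \<in> closure W"
      have Sc: "S \<in> corner X"
        using S closure_minimal[of W "corner X"] closed_corner[of X] by (auto simp: W_def)
      moreover have "opr X S \<in> A"
      proof (rule cl)
        show "opr X S \<in> bounded_ops X" by (rule opr_bounded[OF Sc])
        fix e :: real assume "e > 0"
        then obtain R where R: "R \<in> W" "dist R S < e" using S by (auto simp: closure_approachable)
        then have "op_norm X (op_add X (opr X S) (op_scale X (-1) (opr X R))) < e"
          using Sc by (simp add: W_def opr_diff) (metis dist_commute dist_norm)
        then show "\<exists>R\<in>A. op_norm X (op_add X (opr X S) (op_scale X (-1) R)) < e"
          using R(1) by (auto simp: W_def)
      qed
      ultimately show "S \<in> W" by (simp add: W_def)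
    qed
    then show "closed W" by (metis closed_closure closure_subset subset_antisym)
    show "cop c u \<in> W" if "u \<in> U" for c u using cop[OF Uw[OF that]] .
  qed
  then show ?thesis by (simp add: W_def)
qed

theorem cstar_generated_eq: "cstar_generated X (opr X ` U) = opr X ` calg U"
proof
  show "cstar_generated X (opr X ` U) \<subseteq> opr X ` calg U"
    unfolding cstar_generated_def using cstar_subalgebra_calg calg_base by blast
  show "opr X ` calg U \<subseteq> cstar_generated X (opr X ` U)"
    unfolding cstar_generated_def using calg_minimal by blast
qed

end

section \<open>Twisted group algebras and their traces\<close>

locale twisted_group = group G for G (structure) +
  fixes \<sigma> :: "'a \<Rightarrow> 'a \<Rightarrow> complex"
  assumes sigma: "\<sigma> \<in> cocycles2 G"
begin

lemma cmod_sigma: "g \<in> carrier G \<Longrightarrow> h \<in> carrier G \<Longrightarrow> cmod (\<sigma> g h) = 1"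
  and sigma_one: "g \<in> carrier G \<Longrightarrow> \<sigma> g \<one> = 1" "g \<in> carrier G \<Longrightarrow> \<sigma> \<one> g = 1"
  and cocycle: "g \<in> carrier G \<Longrightarrow> h \<in> carrier G \<Longrightarrow> k \<in> carrier G \<Longrightarrow>
    \<sigma> g h * \<sigma> (g \<otimes> h) k = \<sigma> h k * \<sigma> g (h \<otimes> k)"
  using sigma by (simp_all add: cocycles2_def)

lemma sigma_cnj: "g \<in> carrier G \<Longrightarrow> h \<in> carrier G \<Longrightarrow> \<sigma> g h * cnj (\<sigma> g h) = 1"
  using complex_norm_square[of "\<sigma> g h"] by (simp add: cmod_sigma)

lemma sigma_inv_commute: "g \<in> carrier G \<Longrightarrow> \<sigma> (inv g) g = \<sigma> g (inv g)"
  using cocycle[of g "inv g" g] by (simp add: sigma_one)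

definition L :: "'a \<Rightarrow> 'a l2 \<Rightarrow>\<^sub>L 'a l2" where
  "L g = wcomp (carrier G) (\<lambda>h. \<sigma> g (inv g \<otimes> h)) (\<lambda>h. inv g \<otimes> h)"

text \<open>The adjoint of \<open>L g\<close>, written through the generator at \<open>inv g\<close> so that it visibly belongs to the algebra.\<close>
definition Ls :: "'a \<Rightarrow> 'a l2 \<Rightarrow>\<^sub>L 'a l2" where
  "Ls g = cop (cnj (\<sigma> g (inv g))) (L (inv g))"

abbreviation "P \<equiv> proj (carrier G)"

lemma
  assumes g: "g \<in> carrier G"
  shows fn_L: "fn (L g v) h = (if h \<in> carrier G then \<sigma> g (inv g \<otimes> h) * fn v (inv g \<otimes> h) else 0)"
    and norm_L_le: "norm (L g) \<le> 1" and complex_linear_L: "complex_linear (L g)"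
proof -
  have 1: "inj_on (\<lambda>h. inv g \<otimes> h) (carrier G)" using g by (auto simp: inj_on_def)
  have 2: "cmod (\<sigma> g (inv g \<otimes> h)) \<le> 1" if "h \<in> carrier G" for h using g that by (simp add: cmod_sigma)
  show "fn (L g v) h = (if h \<in> carrier G then \<sigma> g (inv g \<otimes> h) * fn v (inv g \<otimes> h) else 0)"
    unfolding L_def by (rule fn_wcomp[OF 1 2]) simp_all
  show "norm (L g) \<le> 1"
    unfolding L_def by (rule norm_wcomp_le[OF 1 2]) simp_all
  show "complex_linear (L g)"
    unfolding L_def by (rule complex_linear_wcomp[OF 1 2]) simp_all
qed

lemma L_corner: assumes g: "g \<in> carrier G" shows "L g \<in> corner (carrier G)"
proof -
  have "P o\<^sub>L L g = L g" "L g o\<^sub>L P = L g"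
    by (rule blinfun_eqI, rule l2_eqI, simp add: fn_L g)+
  then show ?thesis using complex_linear_L[OF g] by (simp add: corner_def)
qed

lemma twisted_regular_rep_eq:
  assumes g: "g \<in> carrier G" shows "twisted_regular_rep G \<sigma> g = opr (carrier G) (L g)"
  by (rule opr_ext) (simp_all add: twisted_regular_rep_def fn_L g fun_eq_iff)

text \<open>At a point \<open>g h m\<close> this is the cocycle identity for \<open>g\<close>, \<open>h\<close>, \<open>m\<close>.\<close>
lemma L_mult:
  assumes g: "g \<in> carrier G" and h: "h \<in> carrier G"
  shows "L g o\<^sub>L L h = cop (\<sigma> g h) (L (g \<otimes> h))"
proof (rule blinfun_eqI, rule l2_eqI)
  fix v x
  show "fn ((L g o\<^sub>L L h) v) x = fn (cop (\<sigma> g h) (L (g \<otimes> h)) v) x"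
  proof (cases "x \<in> carrier G")
    case True
    define m where "m = inv h \<otimes> (inv g \<otimes> x)"
    have m: "m \<in> carrier G" using g h True by (simp add: m_def)
    have 1: "inv (g \<otimes> h) \<otimes> x = m" using g h True by (simp add: m_def inv_mult_group m_assoc)
    have 2: "inv g \<otimes> x = h \<otimes> m" using g h True by (simp add: m_def m_assoc[symmetric])
    show ?thesis
      using True g h m cocycle[OF g h m] by (simp add: fn_L 1) (simp add: 2 m_assoc[symmetric])
  qed (simp add: fn_L g h)
qed

lemma L_one: "L \<one> = P"
  by (rule blinfun_eqI, rule l2_eqI) (simp add: fn_L sigma_one)

lemma L_Ls: assumes g: "g \<in> carrier G" shows "L g o\<^sub>L Ls g = P" "Ls g o\<^sub>L L g = P"
  using g sigma_cnj[of g "inv g"]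
  by (simp_all add: Ls_def cop_compose_right complex_linear_L cop_compose_left L_mult L_one sigma_inv_commute mult.commute)

lemma cinner_L_L:
  assumes g: "g \<in> carrier G" shows "cinner (L g v) (L g w) = cinner (P v) w"
proof -
  have bij: "bij_betw (\<lambda>h. inv g \<otimes> h) (carrier G) (carrier G)"
    by (rule bij_betw_byWitness[of _ "\<lambda>h. g \<otimes> h"]) (use g in \<open>auto simp: m_assoc[symmetric]\<close>)
  have "cinner (L g v) (L g w) = (\<Sum>\<^sub>\<infinity>h\<in>carrier G. fn v (inv g \<otimes> h) * cnj (fn w (inv g \<otimes> h)))"
    unfolding cinner_def
  proof (rule infsum_cong_neutral)
    fix h assume "h \<in> UNIV \<inter> carrier G"
    then have h: "h \<in> carrier G" by simp
    have "\<sigma> g (inv g \<otimes> h) * cnj (\<sigma> g (inv g \<otimes> h)) = 1" using g h by (simp add: sigma_cnj)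
    then show "fn (L g v) h * cnj (fn (L g w) h) = fn v (inv g \<otimes> h) * cnj (fn w (inv g \<otimes> h))"
      using g h by (simp add: fn_L)
  qed (simp_all add: fn_L g)
  also have "\<dots> = (\<Sum>\<^sub>\<infinity>h\<in>carrier G. fn v h * cnj (fn w h))"
    by (rule infsum_reindex_bij_betw[OF bij])
  also have "\<dots> = cinner (P v) w"
    unfolding cinner_def by (rule infsum_cong_neutral) auto
  finally show ?thesis .
qed

text \<open>\<open>L g\<close> is unitary on the coordinates in the carrier, and \<open>Ls g\<close> is its inverse there.\<close>
lemma isadj_Ls: assumes g: "g \<in> carrier G" shows "isadj (Ls g) (L g)"
  unfolding isadj_def
proof (intro allI)
  fix v w
  have "cinner (L g v) w = cinner (P (L g v)) w" by (simp add: corner_left_apply[OF L_corner[OF g]])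
  also have "\<dots> = cinner (L g v) (P w)" by (rule isadjD[OF isadj_proj])
  also have "P w = L g (Ls g w)" by (metis L_Ls(1)[OF g] blinfun_apply_blinfun_compose)
  also have "cinner (L g v) (L g (Ls g w)) = cinner (P v) (Ls g w)" by (rule cinner_L_L[OF g])
  also have "\<dots> = cinner v (P (Ls g w))" by (rule isadjD[OF isadj_proj])
  also have "P (Ls g w) = Ls g w"
    using g corner_left_apply[OF corner_cop[OF L_corner[of "inv g"]]] by (simp add: Ls_def)
  finally show "cinner (L g v) w = cinner v (Ls g w)" .
qed

definition Alg :: "('a l2 \<Rightarrow>\<^sub>L 'a l2) set" where "Alg = calg (L ` carrier G)"

sublocale operator_system "carrier G" "L ` carrier G"
proof
  show "L ` carrier G \<subseteq> corner (carrier G)" using L_corner by blast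
  show "L ` carrier G \<noteq> {}" using one_closed by blast
  fix u assume "u \<in> L ` carrier G"
  then obtain g where g: "g \<in> carrier G" "u = L g" by blast
  show "\<exists>c. \<exists>w\<in>L ` carrier G. isadj (cop c w) u"
    using isadj_Ls[OF g(1)] g unfolding Ls_def by blast
  fix v assume "v \<in> L ` carrier G"
  then obtain h where h: "h \<in> carrier G" "v = L h" by blast
  show "\<exists>c. \<exists>w\<in>L ` carrier G. u o\<^sub>L v = cop c w"
    using L_mult[OF g(1) h(1)] g h by blast
qed

lemma reduced_cstar_eq: "reduced_cstar G \<sigma> = opr (carrier G) ` Alg"
proof -
  have "twisted_regular_rep G \<sigma> ` carrier G = opr (carrier G) ` L ` carrier G"
    by (simp add: image_image twisted_regular_rep_eq)
  then show ?thesis unfolding reduced_cstar_def Alg_def by (simp add: cstar_generated_eq)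
qed

lemma Alg_closed: "closed Alg" and Alg_subspace: "subspace Alg"
  and Alg_corner: "T \<in> Alg \<Longrightarrow> T \<in> corner (carrier G)"
  and Alg_compose: "S \<in> Alg \<Longrightarrow> T \<in> Alg \<Longrightarrow> S o\<^sub>L T \<in> Alg"
  and Alg_adj: "T \<in> Alg \<Longrightarrow> adj T \<in> Alg"
  and Alg_cop: "T \<in> Alg \<Longrightarrow> cop c T \<in> Alg"
  and Alg_L: "g \<in> carrier G \<Longrightarrow> L g \<in> Alg"
  using calg_corner unfolding Alg_def
  by (auto simp: calg_closed calg_subspace calg_compose calg_adj calg_cop calg_base)

lemma Alg_Ls: "g \<in> carrier G \<Longrightarrow> Ls g \<in> Alg"
  by (simp add: Ls_def Alg_cop Alg_L)

lemma Alg_P: "P \<in> Alg"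
  using Alg_L[of \<one>] by (simp add: L_one)

lemma Alg_add: "S \<in> Alg \<Longrightarrow> T \<in> Alg \<Longrightarrow> S + T \<in> Alg" by (rule subspace_add[OF Alg_subspace])
lemma Alg_diff: "S \<in> Alg \<Longrightarrow> T \<in> Alg \<Longrightarrow> S - T \<in> Alg" by (rule subspace_diff[OF Alg_subspace])
lemma Alg_scaleR: "S \<in> Alg \<Longrightarrow> r *\<^sub>R S \<in> Alg" by (rule subspace_scale[OF Alg_subspace])

definition is_trace :: "(('a l2 \<Rightarrow>\<^sub>L 'a l2) \<Rightarrow> complex) \<Rightarrow> bool" where
  "is_trace \<theta> \<longleftrightarrow>
     (\<forall>S\<in>Alg. \<forall>T\<in>Alg. \<theta> (S + T) = \<theta> S + \<theta> T) \<and>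
     (\<forall>c. \<forall>T\<in>Alg. \<theta> (cop c T) = c * \<theta> T) \<and>
     (\<forall>T\<in>Alg. \<theta> (adj T o\<^sub>L T) \<in> \<real>\<^sub>\<ge>\<^sub>0) \<and>
     \<theta> P = 1 \<and>
     (\<forall>S\<in>Alg. \<forall>T\<in>Alg. \<theta> (S o\<^sub>L T) = \<theta> (T o\<^sub>L S))"

lemma tracial_state_iff:
  "tracial_state (carrier G) (reduced_cstar G \<sigma>) \<tau> \<longleftrightarrow>
     \<tau> \<in> extensional (reduced_cstar G \<sigma>) \<and> is_trace (\<lambda>T. \<tau> (opr (carrier G) T))"
  unfolding tracial_state_def is_trace_def reduced_cstar_eq
  by (simp add: op_add_opr op_scale_opr op_mult_opr op_adj_opr op_id_opr Alg_corner Alg_adj)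

context
  fixes \<theta> assumes tr: "is_trace \<theta>"
begin

lemma trace_add: "S \<in> Alg \<Longrightarrow> T \<in> Alg \<Longrightarrow> \<theta> (S + T) = \<theta> S + \<theta> T"
  and trace_cop: "T \<in> Alg \<Longrightarrow> \<theta> (cop c T) = c * \<theta> T"
  and trace_P: "\<theta> P = 1"
  and trace_commute: "S \<in> Alg \<Longrightarrow> T \<in> Alg \<Longrightarrow> \<theta> (S o\<^sub>L T) = \<theta> (T o\<^sub>L S)"
  using tr by (simp_all add: is_trace_def)

lemma trace_positive: "T \<in> Alg \<Longrightarrow> isadj S T \<Longrightarrow> \<theta> (S o\<^sub>L T) \<in> \<real>\<^sub>\<ge>\<^sub>0"
  using tr adj_eqI unfolding is_trace_def by metis

lemma trace_scaleR: "T \<in> Alg \<Longrightarrow> \<theta> (r *\<^sub>R T) = complex_of_real r * \<theta> T"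
  by (simp add: cop_of_real[symmetric] trace_cop)

lemma trace_diff: "S \<in> Alg \<Longrightarrow> T \<in> Alg \<Longrightarrow> \<theta> (S - T) = \<theta> S - \<theta> T"
  using trace_add[of S "cop (-1) T"] trace_cop[of T "-1"] Alg_cop[of T "-1"]
  by (simp add: cop_minus_one)

text \<open>The square root of \<open>1 - x\<close> is \<open>1 - z\<close> for the fixed point \<open>z\<close> of \<open>z \<mapsto> (x + z\<^sup>2) / 2\<close>, a contraction
  of the ball of radius \<open>\<parallel>x\<parallel> < 1\<close>. It replaces the functional calculus.\<close>
lemma ex_square_root:
  assumes x: "x \<in> Alg" "isadj x x" "norm x < 1"
  obtains z where "z \<in> Alg" "isadj z z" "P - x = (P - z) o\<^sub>L (P - z)"
proof -
  define S where "S = {z \<in> Alg. isadj z z} \<inter> cball 0 (norm x)"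
  define f where "f z = (1/2) *\<^sub>R (x + (z o\<^sub>L z))" for z
  have sa: "isadj (r *\<^sub>R T) (r *\<^sub>R T)" if "isadj T T" for r and T :: "'a l2 \<Rightarrow>\<^sub>L 'a l2"
    using isadj_cop[OF that, of "complex_of_real r"] by (simp add: cop_of_real)
  have "\<exists>!z\<in>S. f z = z"
  proof (rule Banach_fix)
    have "closed {z :: 'a l2 \<Rightarrow>\<^sub>L 'a l2. isadj z z}"
      unfolding isadj_def
      by (intro closed_Collect_all closed_Collect_eq bounded_bilinear.continuous_on[OF bounded_bilinear_cinner] continuous_intros)
    from closed_Int[OF closed_Int[OF Alg_closed this] closed_cball]
    show "complete S" by (simp add: S_def Collect_conj_eq complete_eq_closed)
    show "S \<noteq> {}" using x by (auto simp: S_def)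
    show "0 \<le> norm x" "norm x < 1" using x by simp_all
    show "f ` S \<subseteq> S"
    proof clarify
      fix z assume "z \<in> S"
      then have z: "z \<in> Alg" "isadj z z" "norm z \<le> norm x" by (auto simp: S_def)
      have "norm (z o\<^sub>L z) \<le> norm x * norm x"
        using norm_blinfun_compose[of z z] mult_mono[OF z(3) z(3)] by simp
      also have "\<dots> \<le> norm x" using x(3) by (simp add: mult_left_le)
      finally have "norm (x + (z o\<^sub>L z)) \<le> 2 * norm x" using norm_triangle_ineq[of x "z o\<^sub>L z"] by simp
      then have "norm (f z) \<le> norm x" by (simp add: f_def)
      moreover have "isadj (f z) (f z)"
        unfolding f_def by (rule sa, rule isadj_add[OF x(2) isadj_compose[OF z(2) z(2)]])
      moreover have "f z \<in> Alg"
        unfolding f_def by (intro Alg_scaleR Alg_add Alg_compose x z)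
      ultimately show "f z \<in> S" by (simp add: S_def)
    qed
    fix z w assume "z \<in> S" "w \<in> S"
    show "dist (f z) (f w) \<le> norm x * dist z w"
    proof -
      from \<open>z \<in> S\<close> \<open>w \<in> S\<close> have zw: "norm z \<le> norm x" "norm w \<le> norm x" by (auto simp: S_def)
      have "f z - f w = (1/2) *\<^sub>R ((z o\<^sub>L z) - (w o\<^sub>L w))"
        by (simp add: f_def scaleR_diff_right[symmetric])
      also have "(z o\<^sub>L z) - (w o\<^sub>L w) = (z o\<^sub>L (z - w)) + ((z - w) o\<^sub>L w)"
        by (simp add: oL.diff_left oL.diff_right)
      finally have "norm (f z - f w) = (1/2) * norm ((z o\<^sub>L (z - w)) + ((z - w) o\<^sub>L w))" by simp
      also have "\<dots> \<le> (1/2) * (norm z * norm (z - w) + norm (z - w) * norm w)"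
        using norm_triangle_ineq[of "z o\<^sub>L (z - w)" "(z - w) o\<^sub>L w"]
          norm_blinfun_compose[of z "z - w"] norm_blinfun_compose[of "z - w" w] by simp
      also have "\<dots> \<le> (1/2) * (norm x * norm (z - w) + norm (z - w) * norm x)"
        using zw by (intro mult_left_mono add_mono mult_right_mono) simp_all
      finally show "dist (f z) (f w) \<le> norm x * dist z w" by (simp add: dist_norm mult.commute)
    qed
  qed
  then obtain z where z: "z \<in> S" "f z = z" by blast
  have zA: "z \<in> Alg" "isadj z z" using z by (auto simp: S_def)
  have zc: "P o\<^sub>L z = z" "z o\<^sub>L P = z"
    using corner_left[OF Alg_corner[OF zA(1)]] corner_right[OF Alg_corner[OF zA(1)]] by simp_all
  have "2 *\<^sub>R z = x + (z o\<^sub>L z)"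
  proof -
    have "2 *\<^sub>R z = 2 *\<^sub>R f z" using z(2) by simp
    then show ?thesis by (simp add: f_def)
  qed
  then have "x = z + z - (z o\<^sub>L z)" by (simp add: scaleR_2 eq_diff_eq)
  then have "P - x = (P - z) o\<^sub>L (P - z)"
    by (simp add: oL.diff_left oL.diff_right zc proj_proj)
  then show thesis using zA that by blast
qed

text \<open>The positive element \<open>r - x\<close> is a square of a self-adjoint element of the algebra for every
\<open>r > \<parallel>x\<parallel>\<close>, so the trace of \<open>x\<close> is real and at most \<open>r\<close>.\<close>
lemma trace_selfadjoint:
  assumes x: "x \<in> Alg" "isadj x x"
  shows "\<theta> x \<in> \<real>" "Re (\<theta> x) \<le> norm x"
proof -
  have 1: "\<theta> y \<in> \<real> \<and> Re (\<theta> y) \<le> 1" if y: "y \<in> Alg" "isadj y y" "norm y < 1" for y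
  proof -
    obtain z where z: "z \<in> Alg" "isadj z z" "P - y = (P - z) o\<^sub>L (P - z)"
      using ex_square_root[OF y] by blast
    have "isadj (P - z) (P - z)"
      using isadj_add[OF isadj_proj isadj_cop[OF z(2), of "-1"]] by (simp add: cop_minus_one)
    then have "\<theta> (P - y) \<in> \<real>\<^sub>\<ge>\<^sub>0"
      unfolding z(3) by (intro trace_positive Alg_diff Alg_P z)
    then have "1 - \<theta> y \<in> \<real>\<^sub>\<ge>\<^sub>0" using y Alg_P by (simp add: trace_diff trace_P)
    then obtain r where r: "r \<ge> 0" "1 - \<theta> y = complex_of_real r" by (auto elim: nonneg_Reals_cases)
    then have "\<theta> y = complex_of_real (1 - r)" by (simp add: algebra_simps)
    then show ?thesis using r by simp
  qed
  have 2: "\<theta> x \<in> \<real> \<and> Re (\<theta> x) \<le> r" if r: "r > norm x" for r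
  proof -
    have r0: "r > 0" using r norm_ge_zero[of x] by linarith
    define y where "y = (1/r) *\<^sub>R x"
    have "isadj y y" using isadj_cop[OF x(2), of "complex_of_real (1/r)"] by (simp add: y_def cop_of_real del: of_real_divide)
    moreover have "norm y < 1" using r r0 by (simp add: y_def field_simps)
    ultimately have y: "\<theta> y \<in> \<real>" "Re (\<theta> y) \<le> 1" using 1[of y] x by (simp_all add: y_def Alg_scaleR)
    have "x = r *\<^sub>R y" "y \<in> Alg" using r0 x by (simp_all add: y_def Alg_scaleR)
    then have "\<theta> x = complex_of_real r * \<theta> y" using trace_scaleR by metis
    then show ?thesis using y r0 by simp
  qed
  show "\<theta> x \<in> \<real>" using 2[of "norm x + 1"] by simp
  show "Re (\<theta> x) \<le> norm x" using 2 by (meson dense_le not_le)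
qed

text \<open>The real part of the trace of \<open>a\<close> is half the trace of the self-adjoint element \<open>a + b\<close>, where \<open>b\<close> is
the adjoint.\<close>
lemma Re_trace_le: assumes a: "a \<in> Alg" shows "Re (\<theta> a) \<le> norm a"
  and trace_adj: "isadj b a \<Longrightarrow> \<theta> b = cnj (\<theta> a)"
proof -
  define b where "b = adj a"
  have b: "isadj b a" "b \<in> Alg" using isadj_adj[OF corner_complex_linear[OF Alg_corner[OF a]]] a
    by (simp_all add: b_def Alg_adj)
  have h: "isadj (a + b) (a + b)" using isadj_add[OF b(1) isadj_sym[OF b(1)]] by (simp add: add.commute)
  \<comment> \<open>The imaginary part of \<open>a\<close>, up to a real factor; its trace does not contribute to the real part.\<close>
  have k: "isadj (cop \<i> (b - a)) (cop \<i> (b - a))"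
  proof -
    have "isadj (cop (-\<i>) a + cop \<i> b) (cop \<i> b + cop (-\<i>) a)"
      using isadj_add[OF isadj_cop[OF isadj_sym[OF b(1)], of \<i>] isadj_cop[OF b(1), of "-\<i>"]] by simp
    moreover have "cop \<i> b + cop (-\<i>) a = cop \<i> (b - a)"
    proof -
      have "cop \<i> (b - a) = cop \<i> (b + cop (-1) a)" by (simp add: cop_minus_one)
      also have "\<dots> = cop \<i> b + cop \<i> (cop (-1) a)" by (rule cop_add)
      finally show ?thesis by simp
    qed
    ultimately show ?thesis by (simp add: add.commute)
  qed
  have "\<theta> (a + b) \<in> \<real>" "Re (\<theta> (a + b)) \<le> norm (a + b)"
    using trace_selfadjoint[OF Alg_add[OF a b(2)] h] by simp_all
  moreover have "\<theta> (cop \<i> (b - a)) \<in> \<real>"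
    using trace_selfadjoint[OF Alg_cop[OF Alg_diff[OF b(2) a]] k] by simp
  ultimately have eq: "\<theta> b = cnj (\<theta> a)" and le: "2 * Re (\<theta> a) \<le> norm (a + b)"
    using a b(2) by (auto simp: trace_add trace_cop trace_diff Alg_diff complex_is_Real_iff complex_eq_iff)
  show "\<theta> b' = cnj (\<theta> a)" if "isadj b' a" for b'
    using isadj_unique[OF that b(1)] eq by simp
  have "norm (a + b) \<le> norm a + norm a"
    using norm_triangle_ineq[of a b] isadj_norm_le[OF b(1)] by linarith
  then show "Re (\<theta> a) \<le> norm a" using le by linarith
qed

lemma cmod_trace_le: assumes a: "a \<in> Alg" shows "cmod (\<theta> a) \<le> norm a"
proof (cases "\<theta> a = 0")
  case False
  define c where "c = cnj (\<theta> a) / cmod (\<theta> a)"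
  have c1: "cmod c = 1" using False by (simp add: c_def norm_divide)
  have "c * \<theta> a = complex_of_real (cmod (\<theta> a))"
    using False complex_norm_square[of "\<theta> a"]
    by (simp add: c_def power2_eq_square mult.commute divide_simps)
  then have "cmod (\<theta> a) = Re (\<theta> (cop c a))" using a by (simp add: trace_cop)
  also have "\<dots> \<le> norm a" using Re_trace_le[OF Alg_cop[OF a, of c]] c1 by simp
  finally show ?thesis .
qed simp

end

lemma trace_eq_on_Alg:
  assumes t: "is_trace \<theta>" "is_trace \<theta>'" and eq: "\<And>g. g \<in> carrier G \<Longrightarrow> \<theta> (L g) = \<theta>' (L g)"
    and T: "T \<in> Alg"
  shows "\<theta> T = \<theta>' T"
proof -
  define W where "W = {T \<in> Alg. \<theta> T = \<theta>' T}"
  have "T \<in> W"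
  proof (rule calg_induct[OF _ _ _ T[unfolded Alg_def]])
    show "subspace W"
      using subspace_0[OF Alg_subspace] trace_scaleR[OF t(1), of _ 0] trace_scaleR[OF t(2), of _ 0] Alg_P
      by (auto simp: W_def subspace_def Alg_add Alg_scaleR trace_add[OF t(1)] trace_add[OF t(2)]
          trace_scaleR[OF t(1)] trace_scaleR[OF t(2)])
    show "closed W"
      unfolding closed_sequential_limits
    proof (intro allI impI, elim conjE)
      fix x l assume x: "\<forall>n. x n \<in> W" "x \<longlonglongrightarrow> l"
      have xA: "x n \<in> Alg" and xe: "\<theta> (x n) = \<theta>' (x n)" for n using x(1) by (auto simp: W_def)
      have l: "l \<in> Alg" using closed_sequentially[OF Alg_closed xA x(2)] .
      have "(\<lambda>n. \<theta> (x n)) \<longlonglongrightarrow> \<theta> l" if t: "is_trace \<theta>" for \<theta>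
      proof (rule LIM_zero_cancel, rule Lim_null_comparison[OF _ tendsto_norm_zero[OF LIM_zero[OF x(2)]]])
        show "\<forall>\<^sub>F n in sequentially. norm (\<theta> (x n) - \<theta> l) \<le> norm (x n - l)"
          using cmod_trace_le[OF t Alg_diff[OF xA l]] by (simp add: trace_diff[OF t xA l])
      qed
      from LIMSEQ_unique[OF this[OF t(1)]] this[OF t(2)] have "\<theta> l = \<theta>' l" by (simp add: xe)
      then show "l \<in> W" using l by (simp add: W_def)
    qed
    show "cop c u \<in> W" if "u \<in> L ` carrier G" for c u
      using that eq by (auto simp: W_def Alg_cop Alg_L trace_cop[OF t(1)] trace_cop[OF t(2)])
  qed
  then show ?thesis by (simp add: W_def)
qed

lemma tracial_state_unique:
  assumes "tracial_state (carrier G) (reduced_cstar G \<sigma>) \<tau>" "tracial_state (carrier G) (reduced_cstar G \<sigma>) \<tau>'"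
    and "\<And>g. g \<in> carrier G \<Longrightarrow> \<tau> (opr (carrier G) (L g)) = \<tau>' (opr (carrier G) (L g))"
  shows "\<tau> = \<tau>'"
proof (rule extensionalityI)
  show "\<tau> \<in> extensional (reduced_cstar G \<sigma>)" "\<tau>' \<in> extensional (reduced_cstar G \<sigma>)"
    using assms by (simp_all add: tracial_state_iff)
  fix a assume "a \<in> reduced_cstar G \<sigma>"
  then obtain T where "T \<in> Alg" "a = opr (carrier G) T" by (auto simp: reduced_cstar_eq)
  then show "\<tau> a = \<tau>' a"
    using trace_eq_on_Alg[of "\<lambda>T. \<tau> (opr (carrier G) T)" "\<lambda>T. \<tau>' (opr (carrier G) T)" T] assms
    by (simp add: tracial_state_iff)
qed

text \<open>A bounded functional that is symmetric on generators is symmetric on the algebra, one factor at a time.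
All tracial states below are obtained in this way.\<close>
lemma tracial_state_of_functional:
  assumes lin: "bounded_linear \<phi>" and cop: "\<And>c T. \<phi> (cop c T) = c * \<phi> T"
    and pos: "\<And>S T. isadj S T \<Longrightarrow> \<phi> (S o\<^sub>L T) \<in> \<real>\<^sub>\<ge>\<^sub>0" and one: "\<phi> P = 1"
    and comm: "\<And>g h. g \<in> carrier G \<Longrightarrow> h \<in> carrier G \<Longrightarrow> \<phi> (L g o\<^sub>L L h) = \<phi> (L h o\<^sub>L L g)"
  obtains \<tau> where "tracial_state (carrier G) (reduced_cstar G \<sigma>) \<tau>"
    "\<And>T. T \<in> Alg \<Longrightarrow> \<tau> (opr (carrier G) T) = \<phi> T"
proof -
  have add: "\<phi> (S + T) = \<phi> S + \<phi> T" for S T using lin by (simp add: linear_simps)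
  define D where "D S T = \<phi> (S o\<^sub>L T) - \<phi> (T o\<^sub>L S)" for S T
  have cl1: "bounded_linear (\<lambda>S. D S T)" and cl2: "bounded_linear (D T)" for T
    unfolding D_def
    by (intro bounded_linear_sub bounded_linear_compose[OF lin] oL.bounded_linear_left oL.bounded_linear_right)+
  have z: "subspace {0::complex}" "closed {0::complex}" by (simp_all add: subspace_def)
  have gen: "D S (L h) = 0" if h: "h \<in> carrier G" and S: "S \<in> Alg" for S h
  proof -
    have "D S (L h) \<in> {0}"
      by (rule calg_linear_induct[OF cl1 z _ S[unfolded Alg_def]])
        (use h comm in \<open>auto simp: D_def cop_compose_left cop_compose_right complex_linear_L cop\<close>)
    then show ?thesis by simp
  qed
  have comm': "\<phi> (S o\<^sub>L T) = \<phi> (T o\<^sub>L S)" if S: "S \<in> Alg" and T: "T \<in> Alg" for S T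
  proof -
    have cS: "complex_linear S" using corner_complex_linear[OF Alg_corner[OF S]] .
    have "D S T \<in> {0}"
    proof (rule calg_linear_induct[OF cl2 z _ T[unfolded Alg_def]])
      fix c u assume "u \<in> L ` carrier G"
      then obtain h where h: "h \<in> carrier G" "u = L h" by blast
      have "D S (cop c u) = c * D S u"
        by (simp add: D_def cop_compose_left cop_compose_right[OF cS] cop algebra_simps)
      then show "D S (cop c u) \<in> {0}" using gen[OF h(1) S] h(2) by simp
    qed
    then show ?thesis by (simp add: D_def)
  qed
  define \<tau> where "\<tau> = (\<lambda>a\<in>reduced_cstar G \<sigma>. \<phi> (SOME T. T \<in> Alg \<and> a = opr (carrier G) T))"
  have val: "\<tau> (opr (carrier G) T) = \<phi> T" if T: "T \<in> Alg" for T
  proof -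
    have "(SOME T'. T' \<in> Alg \<and> opr (carrier G) T = opr (carrier G) T') = T"
      by (rule some_equality) (use T opr_inj Alg_corner in auto)
    then show ?thesis using T by (simp add: \<tau>_def reduced_cstar_eq)
  qed
  have "is_trace (\<lambda>T. \<tau> (opr (carrier G) T))"
    unfolding is_trace_def
  proof (intro conjI ballI allI)
    show "\<tau> (opr (carrier G) P) = 1" by (simp add: val Alg_P one)
    fix T assume T: "T \<in> Alg"
    show "\<tau> (opr (carrier G) (cop c T)) = c * \<tau> (opr (carrier G) T)" for c
      using T by (simp add: val Alg_cop cop)
    show "\<tau> (opr (carrier G) (adj T o\<^sub>L T)) \<in> \<real>\<^sub>\<ge>\<^sub>0"
      using T pos[OF isadj_adj[OF corner_complex_linear[OF Alg_corner[OF T]]]] by (simp add: val Alg_compose Alg_adj)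
    fix S assume S: "S \<in> Alg"
    show "\<tau> (opr (carrier G) (T + S)) = \<tau> (opr (carrier G) T) + \<tau> (opr (carrier G) S)"
      using S T by (simp add: val Alg_add add)
    show "\<tau> (opr (carrier G) (T o\<^sub>L S)) = \<tau> (opr (carrier G) (S o\<^sub>L T))"
      using S T comm' by (simp add: val Alg_compose)
  qed
  then have "tracial_state (carrier G) (reduced_cstar G \<sigma>) \<tau>"
    by (simp add: tracial_state_iff) (simp add: \<tau>_def)
  then show thesis using val that by blast
qed

end

section \<open>Extending linear functionals\<close>

definition sublinear :: "('v::real_vector \<Rightarrow> real) \<Rightarrow> bool" where
  "sublinear p \<longleftrightarrow> (\<forall>x y. p (x + y) \<le> p x + p y) \<and> (\<forall>s x. 0 \<le> s \<longrightarrow> p (s *\<^sub>R x) = s * p x)"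

lemma sublinear_add: "sublinear p \<Longrightarrow> p (x + y) \<le> p x + p y"
  and sublinear_scale: "sublinear p \<Longrightarrow> 0 \<le> s \<Longrightarrow> p (s *\<^sub>R x) = s * p x"
  by (simp_all add: sublinear_def)

lemma sublinear_zero: "sublinear p \<Longrightarrow> p 0 = 0"
  using sublinear_scale[of p 0 0] by simp

lemma sublinear_neg: "sublinear p \<Longrightarrow> - p (- x) \<le> p x"
  using sublinear_add[of p x "- x"] sublinear_zero[of p] by simp

lemma sublinearI:
  assumes add: "\<And>x y. p (x + y) \<le> p x + p y" and zero: "p 0 = 0"
    and scale: "\<And>s x. 0 < s \<Longrightarrow> p (s *\<^sub>R x) \<le> s * p x"
  shows "sublinear p"
  unfolding sublinear_def
proof (intro conjI allI impI add)
  fix s x assume "0 \<le> (s::real)"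
  show "p (s *\<^sub>R x) = s * p x"
  proof (cases "s = 0")
    case False
    then have s: "s > 0" using \<open>0 \<le> s\<close> by simp
    have "p x \<le> inverse s * p (s *\<^sub>R x)" using scale[of "inverse s" "s *\<^sub>R x"] s by simp
    then have "s * p x \<le> p (s *\<^sub>R x)" using s by (simp add: field_simps)
    then show ?thesis using scale[OF s, of x] by simp
  qed (simp add: zero)
qed

text \<open>The conditions on \<open>add\<close> and \<open>scale\<close> hold for chains of sublinear functionals and for the infimal
convolutions used below.\<close>
lemma sublinear_Inf:
  fixes Q :: "'i set" and q :: "'i \<Rightarrow> 'v::real_vector \<Rightarrow> real"
  assumes ne: "Q \<noteq> {}" and bdd: "\<And>x. bdd_below ((\<lambda>i. q i x) ` Q)"
    and add: "\<And>i j x y. i \<in> Q \<Longrightarrow> j \<in> Q \<Longrightarrow> \<exists>k\<in>Q. q k (x + y) \<le> q i x + q j y"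
    and scale: "\<And>i s x. i \<in> Q \<Longrightarrow> 0 < s \<Longrightarrow> \<exists>k\<in>Q. q k (s *\<^sub>R x) \<le> s * q i x"
    and zero: "(INF i\<in>Q. q i 0) = 0"
  shows "sublinear (\<lambda>x. INF i\<in>Q. q i x)"
proof (rule sublinearI)
  show "(INF i\<in>Q. q i 0) = 0" by (rule zero)
  have le: "(INF i\<in>Q. q i x) \<le> q k x" if "k \<in> Q" for k x
    by (rule cINF_lower[OF bdd that])
  show "(INF i\<in>Q. q i (x + y)) \<le> (INF i\<in>Q. q i x) + (INF i\<in>Q. q i y)" for x y
  proof -
    have 1: "(INF i\<in>Q. q i (x + y)) \<le> q i x + q j y" if ij: "i \<in> Q" "j \<in> Q" for i j
    proof -
      obtain k where "k \<in> Q" "q k (x + y) \<le> q i x + q j y" using add[OF ij] by blast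
      then show ?thesis using le[of k "x + y"] by linarith
    qed
    have "(INF i\<in>Q. q i (x + y)) - q i x \<le> (INF j\<in>Q. q j y)" if "i \<in> Q" for i
      by (rule cINF_greatest[OF ne]) (use 1[OF that] in \<open>simp add: algebra_simps\<close>)
    then have "(INF i\<in>Q. q i (x + y)) - (INF j\<in>Q. q j y) \<le> (INF i\<in>Q. q i x)"
      by (intro cINF_greatest[OF ne]) (simp add: algebra_simps)
    then show ?thesis by linarith
  qed
  show "(INF i\<in>Q. q i (s *\<^sub>R x)) \<le> s * (INF i\<in>Q. q i x)" if s: "0 < s" for s x
  proof -
    have "(INF i\<in>Q. q i (s *\<^sub>R x)) / s \<le> q i x" if i: "i \<in> Q" for i
    proof -
      obtain k where "k \<in> Q" "q k (s *\<^sub>R x) \<le> s * q i x" using scale[OF i s] by blast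
      then have "(INF i\<in>Q. q i (s *\<^sub>R x)) \<le> s * q i x" using le[of k "s *\<^sub>R x"] by linarith
      then show ?thesis using s by (simp add: field_simps)
    qed
    then have "(INF i\<in>Q. q i (s *\<^sub>R x)) / s \<le> (INF i\<in>Q. q i x)" by (rule cINF_greatest[OF ne])
    then show ?thesis using s by (simp add: field_simps)
  qed
qed

text \<open>A minimal sublinear functional \<open>q\<close> below \<open>p\<close> is linear: for fixed \<open>y\<close>, the functional
\<open>x \<mapsto> inf q (x + s y) - s q y\<close> over \<open>s \<ge> 0\<close> is sublinear and below \<open>q\<close>, hence equal to \<open>q\<close>, and \<open>s = 1\<close> gives
additivity.\<close>
lemma ex_linear_le_sublinear:
  fixes p :: "'v::real_vector \<Rightarrow> real"
  assumes p: "sublinear p"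
  obtains \<psi> where "linear \<psi>" "\<And>x. \<psi> x \<le> p x"
proof -
  define A where "A = {q. sublinear q \<and> (\<forall>x. q x \<le> p x)}"
  define R where "R q q' \<longleftrightarrow> (\<forall>x. q' x \<le> q x)" for q q' :: "'v \<Rightarrow> real"
  have low: "- p (- x) \<le> q x" if "q \<in> A" for q x
  proof -
    have "sublinear q" "q (- x) \<le> p (- x)" using that by (simp_all add: A_def)
    then show ?thesis using sublinear_neg[of q x] by linarith
  qed
  have "\<exists>m\<in>A. \<forall>a\<in>A. R m a \<longrightarrow> a = m"
  proof (rule predicate_Zorn)
    show "partial_order_on A (relation_of R A)"
      by (rule partial_order_on_relation_ofI) (auto simp: R_def fun_eq_iff intro: order_trans antisym)
    fix C assume C: "C \<in> Chains (relation_of R A)"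
    then have CA: "q \<in> A" if "q \<in> C" for q using that by (auto simp: Chains_def relation_of_def)
    have tot: "R q q' \<or> R q' q" if "q \<in> C" "q' \<in> C" for q q'
      using C that by (auto simp: Chains_def relation_of_def)
    show "\<exists>u\<in>A. \<forall>a\<in>C. R a u"
    proof (cases "C = {}")
      case True
      then show ?thesis using p by (auto simp: A_def)
    next
      case False
      define u where "u x = (INF q\<in>C. q x)" for x
      have bdd: "bdd_below ((\<lambda>q. q x) ` C)" for x
        using low[OF CA] by (auto intro!: bdd_belowI2[of _ "- p (- x)"])
      have le: "u x \<le> q x" if "q \<in> C" for q x unfolding u_def by (rule cINF_lower[OF bdd that])
      have "sublinear u"
        unfolding u_def[abs_def]
      proof (rule sublinear_Inf[OF False bdd])
        fix q q' x y assume q: "q \<in> C" "q' \<in> C"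
        then have s: "sublinear q" "sublinear q'" using CA by (auto simp: A_def)
        from tot[OF q] show "\<exists>r\<in>C. r (x + y) \<le> q x + q' y"
        proof
          assume "R q q'"
          then have "q' x \<le> q x" by (simp add: R_def)
          then show ?thesis using sublinear_add[OF s(2), of x y] q by (intro bexI[of _ q']) linarith+
        next
          assume "R q' q"
          then have "q y \<le> q' y" by (simp add: R_def)
          then show ?thesis using sublinear_add[OF s(1), of x y] q by (intro bexI[of _ q]) linarith+
        qed
      next
        fix q s x assume q: "q \<in> C" and s: "0 < (s::real)"
        have "sublinear q" using CA[OF q] by (simp add: A_def)
        then show "\<exists>r\<in>C. r (s *\<^sub>R x) \<le> s * q x" using q s sublinear_scale[of q s x] by (intro bexI[of _ q]) simp_all
      next
        have "q 0 = 0" if "q \<in> C" for q using CA[OF that] sublinear_zero by (auto simp: A_def)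
        then have "(\<lambda>q. q 0) ` C = {0}" using False by (auto simp: image_iff)
        then show "(INF q\<in>C. q 0) = 0" by simp
      qed
      moreover have "u x \<le> p x" for x
      proof -
        obtain q where "q \<in> C" using False by blast
        then show ?thesis using le[of q x] CA[of q] unfolding A_def by (auto intro: order_trans)
      qed
      ultimately show ?thesis using le by (auto simp: A_def R_def)
    qed
  qed
  then obtain q where qA: "q \<in> A" and qmin: "\<forall>a\<in>A. R q a \<longrightarrow> a = q" by (rule bexE)
  have q: "sublinear q" "\<And>x. q x \<le> p x" using qA by (simp_all add: A_def)
  have min: "r = q" if "sublinear r" "\<And>x. r x \<le> q x" for r
  proof -
    have "r x \<le> p x" for x using that(2)[of x] q(2)[of x] by linarith
    then have "r \<in> A" using that(1) by (simp add: A_def)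
    moreover have "R q r" using that(2) by (simp add: R_def)
    ultimately show ?thesis using qmin by simp
  qed
  have super: "q x + q y \<le> q (x + y)" for x y
  proof -
    define r where "r x = (INF s\<in>{0..}. q (x + s *\<^sub>R y) - s * q y)" for x
    have low: "- q (- x) \<le> q (x + s *\<^sub>R y) - s * q y" if "s \<in> {0..}" for x s
      using sublinear_add[OF q(1), of "x + s *\<^sub>R y" "- x"] sublinear_scale[OF q(1), of s y] that by simp
    have bdd: "bdd_below ((\<lambda>s. q (x + s *\<^sub>R y) - s * q y) ` {0..})" for x
      by (rule bdd_belowI2) (rule low)
    have "sublinear r"
      unfolding r_def[abs_def]
    proof (rule sublinear_Inf[OF _ bdd])
      fix s t x z assume st: "s \<in> {0::real..}" "t \<in> {0::real..}"
      have "q (x + z + (s + t) *\<^sub>R y) \<le> q (x + s *\<^sub>R y) + q (z + t *\<^sub>R y)"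
        using sublinear_add[OF q(1), of "x + s *\<^sub>R y" "z + t *\<^sub>R y"] by (simp add: algebra_simps)
      then show "\<exists>k\<in>{0..}. q (x + z + k *\<^sub>R y) - k * q y
          \<le> q (x + s *\<^sub>R y) - s * q y + (q (z + t *\<^sub>R y) - t * q y)"
        using st by (intro bexI[of _ "s + t"]) (simp_all add: algebra_simps)
    next
      fix t s x assume t: "t \<in> {0::real..}" and s: "0 < (s::real)"
      have "q (s *\<^sub>R x + (s * t) *\<^sub>R y) = s * q (x + t *\<^sub>R y)"
        using sublinear_scale[OF q(1), of s "x + t *\<^sub>R y"] s by (simp add: algebra_simps)
      then show "\<exists>k\<in>{0..}. q (s *\<^sub>R x + k *\<^sub>R y) - k * q y \<le> s * (q (x + t *\<^sub>R y) - t * q y)"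
        using s t by (intro bexI[of _ "s * t"]) (simp_all add: algebra_simps)
    next
      have "q (0 + s *\<^sub>R y) - s * q y = 0" if "s \<in> {0..}" for s
        using that sublinear_scale[OF q(1), of s y] by simp
      then show "(INF s\<in>{0..}. q (0 + s *\<^sub>R y) - s * q y) = 0" by (simp cong: INF_cong_simp)
    qed simp
    moreover have "r x \<le> q x" for x
      using cINF_lower[OF bdd, of 0 x] by (simp add: r_def)
    ultimately have "r = q" by (rule min)
    moreover have "r x \<le> q (x + 1 *\<^sub>R y) - 1 * q y"
      unfolding r_def by (rule cINF_lower[OF bdd]) simp
    ultimately show ?thesis by simp
  qed
  have add: "q (x + y) = q x + q y" for x y
    using super[of x y] sublinear_add[OF q(1), of x y] by linarith
  have "linear q"
  proof (rule linearI)
    show "q (x + y) = q x + q y" for x y by (rule add)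
    show "q (r *\<^sub>R x) = r *\<^sub>R q x" for r x
    proof (cases "r \<ge> 0")
      case False
      have "q (r *\<^sub>R x) + q ((- r) *\<^sub>R x) = 0"
        using add[of "r *\<^sub>R x" "(- r) *\<^sub>R x"] sublinear_zero[OF q(1)] by (simp add: algebra_simps)
      then show ?thesis using False sublinear_scale[OF q(1), of "- r" x] by simp
    qed (simp add: sublinear_scale[OF q(1)])
  qed
  then show thesis using that q(2) by blast
qed

text \<open>A linear functional below \<open>p x = inf (\<parallel>x - a\<parallel> + f a)\<close> over \<open>a \<in> V\<close> is dominated by the norm and by \<open>f\<close>, and
on a subspace domination by a linear functional is equality.\<close>
lemma hahn_banach_norm:
  fixes f :: "'v::real_normed_vector \<Rightarrow> real"
  assumes V: "subspace V" and add: "\<And>a b. a \<in> V \<Longrightarrow> b \<in> V \<Longrightarrow> f (a + b) = f a + f b"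
    and scale: "\<And>r a. a \<in> V \<Longrightarrow> f (r *\<^sub>R a) = r * f a" and le: "\<And>a. a \<in> V \<Longrightarrow> f a \<le> norm a"
  obtains \<psi> where "linear \<psi>" "\<And>x. \<psi> x \<le> norm x" "\<And>a. a \<in> V \<Longrightarrow> \<psi> a = f a"
proof -
  define p where "p x = (INF a\<in>V. norm (x - a) + f a)" for x
  have V0: "0 \<in> V" using V by (rule subspace_0)
  have f0: "f 0 = 0" using scale[OF V0, of 0] by simp
  have neg: "f (- a) = - f a" if "a \<in> V" for a using scale[OF that, of "-1"] by simp
  have low: "- norm x \<le> norm (x - a) + f a" if a: "a \<in> V" for x a
    using le[OF subspace_neg[OF V a]] neg[OF a] norm_triangle_ineq2[of a x] by (simp add: norm_minus_commute)
  have bdd: "bdd_below ((\<lambda>a. norm (x - a) + f a) ` V)" for x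
    by (rule bdd_belowI2) (rule low)
  have sp: "sublinear p"
    unfolding p_def[abs_def]
  proof (rule sublinear_Inf[OF _ bdd])
    show "V \<noteq> {}" using V0 by blast
    fix a b x y assume ab: "a \<in> V" "b \<in> V"
    have "norm (x + y - (a + b)) \<le> norm (x - a) + norm (y - b)"
      using norm_triangle_ineq[of "x - a" "y - b"] by (simp add: algebra_simps)
    then show "\<exists>k\<in>V. norm (x + y - k) + f k \<le> norm (x - a) + f a + (norm (y - b) + f b)"
      using ab add[OF ab] by (intro bexI[of _ "a + b"]) (simp_all add: subspace_add[OF V])
  next
    fix a s x assume a: "a \<in> V" and s: "0 < (s::real)"
    have "norm (s *\<^sub>R x - s *\<^sub>R a) = s * norm (x - a)"
      using s by (simp add: scaleR_diff_right[symmetric])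
    then show "\<exists>k\<in>V. norm (s *\<^sub>R x - k) + f k \<le> s * (norm (x - a) + f a)"
      using a s by (intro bexI[of _ "s *\<^sub>R a"]) (simp_all add: subspace_scale[OF V] scale algebra_simps)
  next
    show "(INF a\<in>V. norm (0 - a) + f a) = 0"
    proof (rule antisym)
      show "(INF a\<in>V. norm (0 - a) + f a) \<le> 0" using cINF_lower[OF bdd V0, of 0] f0 by simp
      show "0 \<le> (INF a\<in>V. norm (0 - a) + f a)" using V0 low[of _ 0] by (intro cINF_greatest) auto
    qed
  qed
  then obtain \<psi> where psi: "linear \<psi>" "\<And>x. \<psi> x \<le> p x"
    using ex_linear_le_sublinear[OF sp] by metis
  have pn: "p x \<le> norm x" for x using cINF_lower[OF bdd V0, of x] f0 by (simp add: p_def)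
  have pf: "p a \<le> f a" if "a \<in> V" for a using cINF_lower[OF bdd that, of a] by (simp add: p_def)
  show thesis
  proof (rule that[OF psi(1)])
    show "\<psi> x \<le> norm x" for x using psi(2)[of x] pn[of x] by linarith
    show "\<psi> a = f a" if a: "a \<in> V" for a
      using psi(2)[of a] pf[OF a] psi(2)[of "- a"] pf[OF subspace_neg[OF V a]] neg[OF a] linear_neg[OF psi(1), of a]
      by linarith
  qed
qed

section \<open>Traces vanish off the amenable radical\<close>

text \<open>The linear term wins for small \<open>r\<close>.\<close>
lemma zero_if_quadratic_bound:
  fixes y k :: real
  assumes "\<And>r. r * y \<le> r\<^sup>2 * k" shows "y = 0"
proof (rule ccontr)
  assume y: "y \<noteq> 0"
  define K where "K = \<bar>k\<bar> + 1"
  have K: "K > 0" "k \<le> K" by (auto simp: K_def)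
  have "y / (2 * K) * y \<le> (y / (2 * K))\<^sup>2 * k" by (rule assms)
  also have "\<dots> \<le> (y / (2 * K))\<^sup>2 * K" using K by (intro mult_left_mono) auto
  also have "\<dots> = y\<^sup>2 / (4 * K)" using K by (simp add: power2_eq_square field_simps)
  finally have "y\<^sup>2 / (2 * K) \<le> y\<^sup>2 / (4 * K)" by (simp add: power2_eq_square)
  moreover have "y\<^sup>2 / (4 * K) < y\<^sup>2 / (2 * K)" using K y by (intro divide_strict_left_mono) auto
  ultimately show False by linarith
qed

lemma norm_proj_disjoint:
  assumes "A \<inter> B = {}"
  shows "(norm (proj A v + proj B w))\<^sup>2 = (norm (proj A v))\<^sup>2 + (norm (proj B w))\<^sup>2"
proof -
  have "proj A (proj B w) = 0" using assms by (intro l2_eqI) auto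
  then have "cinner (proj A v) (proj B w) = 0"
    by (simp add: isadjD[OF isadj_proj] bounded_bilinear.zero_right[OF bounded_bilinear_cinner])
  then show ?thesis by (intro norm_add_Pythagorean) (simp add: orthogonal_def inner_l2_def)
qed

text \<open>A norm-one functional with value 1 at the identity is a state, and operators supported on a null
projection are null for a state. Without the Cauchy-Schwarz inequality for states: with \<open>Q\<close> the complementary
projection, the norms of \<open>Q + r T E\<close> and \<open>Q + r E T\<close> exceed 1 only in second order of \<open>r\<close>, so the
first-order term of the functional has to vanish.\<close>
lemma state_null_projection:
  fixes \<psi> :: "('a l2 \<Rightarrow>\<^sub>L 'a l2) \<Rightarrow> real"
  assumes lin: "linear \<psi>" and le: "\<And>T. \<psi> T \<le> norm T" and one: "\<psi> (proj X) = 1"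
    and E: "E \<subseteq> X" "\<psi> (proj E) = 0"
  shows "\<psi> (T o\<^sub>L proj E) = 0" "\<psi> (proj E o\<^sub>L T) = 0"
proof -
  define Q where "Q = proj (X - E)"
  define t where "t = norm T"
  have sumP: "proj X = Q + proj E"
    using E(1) by (intro blinfun_eqI l2_eqI) (auto simp: Q_def blinfun.add_left)
  have psiQ: "\<psi> Q = 1" using one E(2) by (simp add: sumP linear_add[OF lin])
  have pyth: "(norm (Q v))\<^sup>2 + (norm (proj E v))\<^sup>2 \<le> (norm v)\<^sup>2" for v
  proof -
    have "(norm (proj X v))\<^sup>2 = (norm (Q v))\<^sup>2 + (norm (proj E v))\<^sup>2"
      unfolding sumP blinfun.add_left Q_def by (rule norm_proj_disjoint) blast
    then show ?thesis using power_mono[OF norm_proj_apply_le[of X v], of 2] by simp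
  qed
  \<comment> \<open>It suffices to bound the square of the norm of \<open>Q + r S\<close> by \<open>1 + r\<^sup>2 t\<^sup>2\<close> for all \<open>r\<close>, of either sign.\<close>
  have vanish: "\<psi> S = 0" if S: "\<And>r (v::'a l2). (norm ((Q + r *\<^sub>R S) v))\<^sup>2 \<le> (1 + r\<^sup>2 * t\<^sup>2) * (norm v)\<^sup>2" for S
  proof (rule zero_if_quadratic_bound[of _ "t\<^sup>2 / 2"])
    fix r
    have "norm (Q + r *\<^sub>R S) \<le> 1 + r\<^sup>2 * t\<^sup>2 / 2"
    proof (rule norm_blinfun_bound)
      fix v :: "'a l2"
      have "1 + r\<^sup>2 * t\<^sup>2 \<le> (1 + r\<^sup>2 * t\<^sup>2 / 2)\<^sup>2" by (simp add: power2_sum)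
      then have "(1 + r\<^sup>2 * t\<^sup>2) * (norm v)\<^sup>2 \<le> ((1 + r\<^sup>2 * t\<^sup>2 / 2) * norm v)\<^sup>2"
        unfolding power_mult_distrib by (rule mult_right_mono) simp
      then have "(norm ((Q + r *\<^sub>R S) v))\<^sup>2 \<le> ((1 + r\<^sup>2 * t\<^sup>2 / 2) * norm v)\<^sup>2" using S[of r v] by linarith
      then show "norm ((Q + r *\<^sub>R S) v) \<le> (1 + r\<^sup>2 * t\<^sup>2 / 2) * norm v" by (rule power2_le_imp_le) simp
    qed simp
    then have "\<psi> (Q + r *\<^sub>R S) \<le> 1 + r\<^sup>2 * t\<^sup>2 / 2" using le order_trans by blast
    then show "r * \<psi> S \<le> r\<^sup>2 * (t\<^sup>2 / 2)"
      by (simp add: linear_add[OF lin] linear_scale[OF lin] psiQ)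
  qed
  show "\<psi> (T o\<^sub>L proj E) = 0"
  proof (rule vanish)
    fix r and v :: "'a l2"
    define a b where "a = norm (Q v)" and "b = norm (proj E v)"
    have "norm ((Q + r *\<^sub>R (T o\<^sub>L proj E)) v) \<le> a + \<bar>r\<bar> * t * b"
    proof -
      have "norm ((Q + r *\<^sub>R (T o\<^sub>L proj E)) v) \<le> norm (Q v) + \<bar>r\<bar> * norm (T (proj E v))"
        using norm_triangle_ineq[of "Q v" "r *\<^sub>R T (proj E v)"] by (simp add: blinfun.add_left blinfun.scaleR_left)
      also have "\<dots> \<le> a + \<bar>r\<bar> * (t * b)"
        unfolding a_def b_def t_def by (intro add_left_mono mult_left_mono norm_blinfun) simp
      finally show ?thesis by (simp add: mult.assoc)
    qed
    then have "(norm ((Q + r *\<^sub>R (T o\<^sub>L proj E)) v))\<^sup>2 \<le> (a + \<bar>r\<bar> * t * b)\<^sup>2" by (intro power_mono) simp_all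
    also have "\<dots> \<le> (1 + r\<^sup>2 * t\<^sup>2) * (a\<^sup>2 + b\<^sup>2)"
    proof -
      \<comment> \<open>The Cauchy-Schwarz inequality for \<open>(a, b)\<close> and \<open>(1, \<bar>r\<bar> t)\<close>.\<close>
      have "0 \<le> (b - \<bar>r\<bar> * t * a)\<^sup>2" by simp
      also have "\<dots> = (1 + \<bar>r\<bar>\<^sup>2 * t\<^sup>2) * (a\<^sup>2 + b\<^sup>2) - (a + \<bar>r\<bar> * t * b)\<^sup>2"
        by (simp only: power2_eq_square) (simp only: algebra_simps)
      finally show ?thesis by simp
    qed
    also have "\<dots> \<le> (1 + r\<^sup>2 * t\<^sup>2) * (norm v)\<^sup>2"
      using pyth[of v] by (intro mult_left_mono) (simp_all add: a_def b_def)
    finally show "(norm ((Q + r *\<^sub>R (T o\<^sub>L proj E)) v))\<^sup>2 \<le> (1 + r\<^sup>2 * t\<^sup>2) * (norm v)\<^sup>2" .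
  qed
  show "\<psi> (proj E o\<^sub>L T) = 0"
  proof (rule vanish)
    fix r and v :: "'a l2"
    have "(Q + r *\<^sub>R (proj E o\<^sub>L T)) v = proj (X - E) v + proj E (r *\<^sub>R T v)"
      by (simp add: Q_def blinfun.add_left blinfun.scaleR_left blinfun.scaleR_right)
    then have "(norm ((Q + r *\<^sub>R (proj E o\<^sub>L T)) v))\<^sup>2 = (norm (proj (X - E) v))\<^sup>2 + (norm (proj E (r *\<^sub>R T v)))\<^sup>2"
      by (simp only:) (rule norm_proj_disjoint; blast)
    also have "\<dots> \<le> (norm v)\<^sup>2 + (\<bar>r\<bar> * (t * norm v))\<^sup>2"
    proof (intro add_mono power_mono norm_proj_apply_le)
      have "norm (proj E (r *\<^sub>R T v)) \<le> norm (r *\<^sub>R T v)" by (rule norm_proj_apply_le)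
      also have "\<dots> \<le> \<bar>r\<bar> * (t * norm v)" by (simp add: t_def norm_blinfun mult_left_mono)
      finally show "norm (proj E (r *\<^sub>R T v)) \<le> \<bar>r\<bar> * (t * norm v)" .
    qed simp_all
    also have "\<dots> = (1 + r\<^sup>2 * t\<^sup>2) * (norm v)\<^sup>2" by (simp add: power_mult_distrib algebra_simps)
    finally show "(norm ((Q + r *\<^sub>R (proj E o\<^sub>L T)) v))\<^sup>2 \<le> (1 + r\<^sup>2 * t\<^sup>2) * (norm v)\<^sup>2" .
  qed
qed

definition mult_op :: "'a set \<Rightarrow> ('a \<Rightarrow> real) \<Rightarrow> 'a l2 \<Rightarrow>\<^sub>L 'a l2" where
  "mult_op X f = wcomp X (\<lambda>x. complex_of_real (f x)) (\<lambda>x. x)"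

lemma fn_mult_op: assumes "bdd X f"
  shows "fn (mult_op X f v) x = (if x \<in> X then complex_of_real (f x) * fn v x else 0)"
proof -
  obtain c where "c \<ge> 0" "\<And>x. x \<in> X \<Longrightarrow> \<bar>f x\<bar> \<le> c" using bddE[OF assms] by blast
  then show ?thesis unfolding mult_op_def by (intro fn_wcomp[where c = c]) simp_all
qed

lemma norm_mult_op_le: assumes "c \<ge> 0" "\<And>x. x \<in> X \<Longrightarrow> \<bar>f x\<bar> \<le> c" shows "norm (mult_op X f) \<le> c"
  unfolding mult_op_def by (rule norm_wcomp_le) (use assms in simp_all)

lemma mult_op_indicator: "E \<subseteq> X \<Longrightarrow> mult_op X (indicator E) = proj E"
  by (intro blinfun_eqI l2_eqI) (auto simp: fn_mult_op split: split_indicator)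

text \<open>A function whose average over every set \<open>E\<close> is \<open>c\<close> equals \<open>c\<close> up to small errors off null sets.\<close>
lemma mean_level_sets_null:
  assumes m: "m \<in> means X" and F: "bdd X F" and d: "d > 0"
    and eq: "\<And>E. m (\<lambda>g. indicator E g * F g) = m (indicator E) * c"
  shows "m (indicator {g. d \<le> \<bar>F g - c\<bar>}) = 0"
proof -
  have nn: "m (indicator E) \<ge> 0" for E by (rule mean_nonneg[OF m]) simp_all
  have up: "m (indicator {g. c + d \<le> F g}) = 0"
  proof -
    let ?E = "{g. c + d \<le> F g}"
    have "m (\<lambda>g. (c + d) * indicator ?E g) \<le> m (\<lambda>g. indicator ?E g * F g)"
      by (rule mean_mono[OF m]) (use F in \<open>auto split: split_indicator\<close>)
    then have "m (indicator ?E) * (c + d) \<le> m (indicator ?E) * c"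
      unfolding eq mean_scale[OF m bdd_indicator] by (simp only: mult.commute)
    then have "m (indicator ?E) * d \<le> 0" by (simp add: algebra_simps)
    then show ?thesis using nn[of ?E] d by (simp add: mult_le_0_iff)
  qed
  have lo: "m (indicator {g. F g \<le> c - d}) = 0"
  proof -
    let ?E = "{g. F g \<le> c - d}"
    have "m (\<lambda>g. indicator ?E g * F g) \<le> m (\<lambda>g. (c - d) * indicator ?E g)"
      by (rule mean_mono[OF m]) (use F in \<open>auto split: split_indicator\<close>)
    then have "m (indicator ?E) * c \<le> m (indicator ?E) * (c - d)"
      unfolding eq mean_scale[OF m bdd_indicator] by (simp only: mult.commute)
    then have "m (indicator ?E) * d \<le> 0" by (simp add: algebra_simps)
    then show ?thesis using nn[of ?E] d by (simp add: mult_le_0_iff)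
  qed
  have "m (indicator {g. d \<le> \<bar>F g - c\<bar>}) \<le> m (\<lambda>g. indicator {g. c + d \<le> F g} g + indicator {g. F g \<le> c - d} g)"
    by (rule mean_mono[OF m]) (auto split: split_indicator)
  also have "\<dots> = 0" using up lo by (simp add: mean_add[OF m])
  finally show ?thesis using nn[of "{g. d \<le> \<bar>F g - c\<bar>}"] by linarith
qed

context twisted_group
begin

lemma norm_Ls_le: assumes g: "g \<in> carrier G" shows "norm (Ls g) \<le> 1"
  using isadj_norm_le[OF isadj_Ls[OF g]] norm_L_le[OF g] by linarith

lemma mult_op_L:
  assumes f: "bdd (carrier G) f" and h: "h \<in> carrier G"
  shows "Ls h o\<^sub>L (mult_op (carrier G) f o\<^sub>L L h) = mult_op (carrier G) (\<lambda>u. f (h \<otimes> u))"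
proof -
  have 1: "mult_op (carrier G) f o\<^sub>L L h = L h o\<^sub>L mult_op (carrier G) (\<lambda>u. f (h \<otimes> u))"
    using f h by (intro blinfun_eqI l2_eqI) (simp add: fn_mult_op fn_L m_assoc[symmetric])
  have 2: "P o\<^sub>L mult_op (carrier G) (\<lambda>u. f (h \<otimes> u)) = mult_op (carrier G) (\<lambda>u. f (h \<otimes> u))"
    using f h by (intro blinfun_eqI l2_eqI) (simp add: fn_mult_op)
  show ?thesis unfolding 1 oL_assoc[symmetric] L_Ls(2)[OF h] 2 ..
qed

text \<open>The states on all bounded operators that extend the trace, recorded by their real parts. A real functional
suffices because the trace can be multiplied by scalars first.\<close>
definition extensions :: "(('a l2 \<Rightarrow>\<^sub>L 'a l2) \<Rightarrow> complex) \<Rightarrow> (('a l2 \<Rightarrow>\<^sub>L 'a l2) \<Rightarrow> real) set" where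
  "extensions \<theta> = {\<psi>. (\<forall>S T. \<psi> (S + T) = \<psi> S + \<psi> T) \<and> (\<forall>r T. \<psi> (r *\<^sub>R T) = r * \<psi> T) \<and>
     (\<forall>T. \<psi> T \<le> norm T) \<and> (\<forall>a. a \<in> Alg \<longrightarrow> \<psi> a = Re (\<theta> a))}"

lemma extensions_linear: "\<psi> \<in> extensions \<theta> \<Longrightarrow> linear \<psi>"
  by (intro linearI) (simp_all add: extensions_def)
lemma extensions_le: "\<psi> \<in> extensions \<theta> \<Longrightarrow> \<psi> T \<le> norm T"
  by (simp add: extensions_def)
lemma extensions_Alg: "\<psi> \<in> extensions \<theta> \<Longrightarrow> a \<in> Alg \<Longrightarrow> \<psi> a = Re (\<theta> a)"
  by (simp add: extensions_def)
lemma extensions_abs_le: "\<psi> \<in> extensions \<theta> \<Longrightarrow> \<bar>\<psi> T\<bar> \<le> norm T"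
  using extensions_le[of \<psi> \<theta> T] extensions_le[of \<psi> \<theta> "- T"] linear_neg[OF extensions_linear, of \<psi> \<theta> T]
  by (simp add: abs_le_iff)

lemma compact_extensions: "compact (extensions \<theta>)"
proof -
  have cl: "closed (extensions \<theta>)"
    unfolding extensions_def
    by (intro closed_Collect_conj closed_Collect_all closed_Collect_imp closed_Collect_eq
      closed_Collect_le open_Collect_const continuous_intros)
  have co: "compact {\<psi> :: ('a l2 \<Rightarrow>\<^sub>L 'a l2) \<Rightarrow> real. \<forall>T. \<psi> T \<in> {- norm T..norm T}}"
    by (rule compact_functions) simp
  have sub: "extensions \<theta> \<subseteq> {\<psi>. \<forall>T. \<psi> T \<in> {- norm T..norm T}}"
  proof (intro subsetI CollectI allI)
    show "\<psi> T \<in> {- norm T..norm T}" if "\<psi> \<in> extensions \<theta>" for \<psi> T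
      using extensions_abs_le[OF that, of T] by (simp add: abs_le_iff minus_le_iff)
  qed
  show ?thesis using compact_Int_closed[OF co cl] by (simp only: Int_absorb1[OF sub])
qed

definition to_mean :: "(('a l2 \<Rightarrow>\<^sub>L 'a l2) \<Rightarrow> real) \<Rightarrow> ('a \<Rightarrow> real) \<Rightarrow> real" where
  "to_mean \<psi> f = (if bdd (carrier G) f then \<psi> (mult_op (carrier G) f) else 0)"

lemma continuous_to_mean: "continuous_on S to_mean"
proof (rule continuous_on_coordinatewise_then_product)
  show "continuous_on S (\<lambda>x. to_mean x f)" for f
    by (cases "bdd (carrier G) f") (simp_all add: to_mean_def continuous_on_coordinate)
qed

context
  fixes \<theta> assumes tr: "is_trace \<theta>"
begin

lemma extensions_nonempty: "extensions \<theta> \<noteq> {}"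
proof -
  obtain \<psi> where "linear \<psi>" "\<And>x. \<psi> x \<le> norm x" "\<And>a. a \<in> Alg \<Longrightarrow> \<psi> a = Re (\<theta> a)"
    by (rule hahn_banach_norm[OF Alg_subspace, of "\<lambda>a. Re (\<theta> a)"])
      (simp_all add: trace_add[OF tr] trace_scaleR[OF tr] Re_trace_le[OF tr])
  then have "\<psi> \<in> extensions \<theta>" by (simp add: extensions_def linear_add linear_scale)
  then show ?thesis by blast
qed

lemma extensions_P: "\<psi> \<in> extensions \<theta> \<Longrightarrow> \<psi> P = 1"
  by (simp add: extensions_Alg Alg_P trace_P[OF tr])

lemma to_mean_means: assumes psi: "\<psi> \<in> extensions \<theta>" shows "to_mean \<psi> \<in> M"
proof (rule meansI)
  have lin: "linear \<psi>" using psi by (rule extensions_linear)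
  have one: "mult_op (carrier G) (\<lambda>_. 1) = P"
    by (intro blinfun_eqI l2_eqI) (simp add: fn_mult_op)
  show "to_mean \<psi> (\<lambda>_. 1) = 1" by (simp add: to_mean_def one extensions_P[OF psi])
  fix f c assume f: "bdd (carrier G) f"
  have "mult_op (carrier G) (\<lambda>x. c * f x) = c *\<^sub>R mult_op (carrier G) f"
    using f by (intro blinfun_eqI l2_eqI) (simp add: fn_mult_op blinfun.scaleR_left)
  then show "to_mean \<psi> (\<lambda>x. c * f x) = c * to_mean \<psi> f"
    using f by (simp add: to_mean_def linear_scale[OF lin])
  show "to_mean \<psi> (\<lambda>x. f x + f' x) = to_mean \<psi> f + to_mean \<psi> f'" if f': "bdd (carrier G) f'" for f'
  proof -
    have "mult_op (carrier G) (\<lambda>x. f x + f' x) = mult_op (carrier G) f + mult_op (carrier G) f'"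
      using f f' by (intro blinfun_eqI l2_eqI) (simp add: fn_mult_op blinfun.add_left algebra_simps)
    then show ?thesis using f f' by (simp add: to_mean_def linear_add[OF lin])
  qed
  show "0 \<le> to_mean \<psi> f" if pos: "\<And>x. x \<in> carrier G \<Longrightarrow> 0 \<le> f x"
  proof -
    obtain b where b: "b \<ge> 0" "\<And>x. x \<in> carrier G \<Longrightarrow> \<bar>f x\<bar> \<le> b" using bddE[OF f] by blast
    have "b *\<^sub>R P - mult_op (carrier G) f = mult_op (carrier G) (\<lambda>x. b - f x)"
      using f by (intro blinfun_eqI l2_eqI)
        (simp add: fn_mult_op blinfun.diff_left blinfun.scaleR_left algebra_simps)
    moreover have "norm (mult_op (carrier G) (\<lambda>x. b - f x)) \<le> b"
    proof (rule norm_mult_op_le[OF b(1)])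
      show "\<bar>b - f x\<bar> \<le> b" if "x \<in> carrier G" for x using b(2)[OF that] pos[OF that] by linarith
    qed
    ultimately have "\<psi> (b *\<^sub>R P - mult_op (carrier G) f) \<le> b"
      using extensions_le[OF psi, of "b *\<^sub>R P - mult_op (carrier G) f"] by simp
    then show ?thesis
      using f by (simp add: to_mean_def linear_diff[OF lin] linear_scale[OF lin] extensions_P[OF psi])
  qed
qed (simp add: to_mean_def)

text \<open>Conjugating by \<open>L h\<close> does not change the values on the algebra, by the trace property, and translates the
mean by \<open>h\<close>. So a mean of conjugates is again an extension, and the means of extensions form a left
ideal.\<close>
lemma average_extension:
  assumes psi: "\<psi> \<in> extensions \<theta>" and n: "n \<in> M"
  defines "\<psi>' \<equiv> \<lambda>T. n (\<lambda>h. \<psi> (Ls h o\<^sub>L (T o\<^sub>L L h)))"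
  shows "\<psi>' \<in> extensions \<theta>" "to_mean \<psi>' = conv n (to_mean \<psi>)"
proof -
  have lin: "linear \<psi>" using psi by (rule extensions_linear)
  have bnd: "\<bar>\<psi> (Ls h o\<^sub>L (T o\<^sub>L L h))\<bar> \<le> norm T" if h: "h \<in> carrier G" for h T
  proof -
    have "norm (Ls h o\<^sub>L (T o\<^sub>L L h)) \<le> norm (Ls h) * (norm T * norm (L h))"
      by (meson norm_blinfun_compose mult_left_mono norm_ge_zero order_trans)
    also have "\<dots> \<le> 1 * (norm T * 1)"
      using norm_L_le[OF h] norm_Ls_le[OF h] by (intro mult_mono) auto
    finally show ?thesis using extensions_abs_le[OF psi, of "Ls h o\<^sub>L (T o\<^sub>L L h)"] by simp
  qed
  have b: "bdd (carrier G) (\<lambda>h. \<psi> (Ls h o\<^sub>L (T o\<^sub>L L h)))" for T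
    using bnd by (rule bddI)
  show "\<psi>' \<in> extensions \<theta>"
    unfolding extensions_def
  proof (intro CollectI conjI allI impI)
    show "\<psi>' (S + T) = \<psi>' S + \<psi>' T" for S T
      unfolding \<psi>'_def using mean_add[OF n b b]
      by (simp add: oL.add_left oL.add_right linear_add[OF lin])
    show "\<psi>' (r *\<^sub>R T) = r * \<psi>' T" for r T
      unfolding \<psi>'_def using mean_scale[OF n b]
      by (simp add: oL.scaleR_left oL.scaleR_right linear_scale[OF lin])
    show "\<psi>' T \<le> norm T" for T
      unfolding \<psi>'_def using mean_abs_le[OF n, of "\<lambda>h. \<psi> (Ls h o\<^sub>L (T o\<^sub>L L h))" "norm T"] bnd by (simp add: abs_le_iff)
    fix a assume a: "a \<in> Alg"
    have "\<psi>' a = n (\<lambda>h. Re (\<theta> a))"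
      unfolding \<psi>'_def
    proof (rule mean_cong[OF n])
      fix h assume h: "h \<in> carrier G"
      have "\<theta> (Ls h o\<^sub>L (a o\<^sub>L L h)) = \<theta> ((a o\<^sub>L L h) o\<^sub>L Ls h)"
        by (rule trace_commute[OF tr]) (simp_all add: Alg_Ls Alg_L Alg_compose a h)
      also have "(a o\<^sub>L L h) o\<^sub>L Ls h = a"
        by (simp add: oL_assoc L_Ls(1)[OF h] corner_right[OF Alg_corner[OF a]])
      finally show "\<psi> (Ls h o\<^sub>L (a o\<^sub>L L h)) = Re (\<theta> a)"
        using extensions_Alg[OF psi, of "Ls h o\<^sub>L (a o\<^sub>L L h)"] by (simp add: Alg_Ls Alg_L Alg_compose a h)
    qed
    then show "\<psi>' a = Re (\<theta> a)" by (simp add: mean_const[OF n])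
  qed
  show "to_mean \<psi>' = conv n (to_mean \<psi>)"
  proof
    fix f
    show "to_mean \<psi>' f = conv n (to_mean \<psi>) f"
    proof (cases "bdd (carrier G) f")
      case True
      have "n (\<lambda>h. \<psi> (Ls h o\<^sub>L (mult_op (carrier G) f o\<^sub>L L h))) = n (\<lambda>h. to_mean \<psi> (\<lambda>u. f (h \<otimes> u)))"
        by (rule mean_cong[OF n]) (simp add: mult_op_L True to_mean_def)
      then show ?thesis using True by (simp add: to_mean_def conv_def \<psi>'_def)
    qed (simp add: to_mean_def conv_def)
  qed
qed

lemma left_ideal_to_mean: "left_ideal (to_mean ` extensions \<theta>)"
  unfolding left_ideal_def
proof (intro conjI ballI)
  show "to_mean ` extensions \<theta> \<subseteq> M" using to_mean_means by blast
  fix n x assume n: "n \<in> M" and "x \<in> to_mean ` extensions \<theta>"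
  then obtain \<psi> where psi: "\<psi> \<in> extensions \<theta>" "x = to_mean \<psi>" by blast
  show "conv n x \<in> to_mean ` extensions \<theta>"
    unfolding psi(2) average_extension(2)[OF psi(1) n, symmetric]
    by (rule imageI) (rule average_extension(1)[OF psi(1) n])
qed

text \<open>Choose an extreme point \<open>y\<close> of the minimal ideal moved by \<open>t\<close> and an extension whose mean \<open>m\<close> satisfies
\<open>y = conv m x\<close>. By extremality \<open>translate g x\<close> is close to \<open>y\<close>, and \<open>translate (t \<otimes> g) x\<close> close to
\<open>translate t y\<close>, for \<open>m\<close>-almost every \<open>g\<close>. Hence the set \<open>D\<close> of elements whose translate of \<open>x\<close> is close to
\<open>y\<close> has full measure, its preimage \<open>D'\<close> under left multiplication by \<open>t\<close> is null, and \<open>L t\<close>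
intertwines the two projections.\<close>
theorem trace_vanishes_off_rad:
  assumes t: "t \<in> carrier G" "t \<notin> rad"
  shows "\<theta> (L t) = 0"
proof -
  obtain y where y: "extreme_in min_ideal y" "translate t y \<noteq> y"
    using ex_moved_extreme_point[OF t] by blast
  have yL: "y \<in> min_ideal" using y(1) by (simp add: extreme_in_def)
  obtain f where f: "translate t y f \<noteq> y f" using y(2) by (meson ext)
  have fb: "bdd (carrier G) f"
  proof (rule ccontr)
    assume "\<not> bdd (carrier G) f"
    then show False using f mean_unbounded[OF min_ideal_means[OF yL]] by (simp add: translate_def)
  qed
  define ft where "ft u = f (t \<otimes> u)" for u
  have ftb: "bdd (carrier G) ft" unfolding ft_def[abs_def] using fb t(1) by (rule bdd_translate)
  obtain x where x: "x \<in> min_ideal" using min_ideal_nonempty by blast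
  have xM: "x \<in> M" using x by (rule min_ideal_means)
  have "(\<lambda>m. conv m x) ` to_mean ` extensions \<theta> = min_ideal"
  proof (rule left_ideal_orbit[OF _ _ left_ideal_to_mean x])
    show "compact (to_mean ` extensions \<theta>)"
      by (rule compact_continuous_image[OF continuous_to_mean compact_extensions])
  qed (simp add: extensions_nonempty)
  then obtain \<psi> where psi: "\<psi> \<in> extensions \<theta>" "y = conv (to_mean \<psi>) x" using yL by blast
  define m where "m = to_mean \<psi>"
  have m: "m \<in> M" and ym: "y = conv m x" using psi to_mean_means by (simp_all add: m_def)
  define F where "F g = translate g x f" for g
  define Ft where "Ft g = translate g x ft" for g
  have Fb: "bdd (carrier G) F" "bdd (carrier G) Ft"
    unfolding F_def[abs_def] Ft_def[abs_def] translate_def using fb ftb xM by simp_all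
  define a b where "a = y f" and "b = y ft"
  have ab: "a \<noteq> b" using f fb by (auto simp: a_def b_def translate_def ft_def[abs_def])
  \<comment> \<open>Intervals of radius \<open>d\<close> around \<open>a\<close> and \<open>b\<close> are disjoint.\<close>
  define d where "d = \<bar>a - b\<bar> / 2"
  have d: "d > 0" using ab by (simp add: d_def)
  have nullF: "m (indicator {g. d \<le> \<bar>F g - a\<bar>}) = 0"
    by (rule mean_level_sets_null[OF m Fb(1) d])
      (simp add: F_def a_def extreme_conv[OF y(1) x m ym fb])
  have nullFt: "m (indicator {g. d \<le> \<bar>Ft g - b\<bar>}) = 0"
    by (rule mean_level_sets_null[OF m Fb(2) d])
      (simp add: Ft_def b_def extreme_conv[OF y(1) x m ym ftb])
  have Ft: "Ft g = F (t \<otimes> g)" if g: "g \<in> carrier G" for g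
    using fb ftb t(1) g unfolding F_def Ft_def ft_def translate_def
    by (simp add: ft_def[symmetric]) (intro mean_cong[OF xM], simp add: ft_def m_assoc)
  define D where "D = {g \<in> carrier G. \<bar>F g - a\<bar> < d}"
  define D' where "D' = {g \<in> carrier G. t \<otimes> g \<in> D}"
  have nn: "m (indicator E) \<ge> 0" for E by (rule mean_nonneg[OF m]) simp_all
  have "m (indicator (carrier G - D)) \<le> m (indicator {g. d \<le> \<bar>F g - a\<bar>})"
    by (rule mean_mono[OF m]) (auto simp: D_def split: split_indicator)
  then have m1: "m (indicator (carrier G - D)) = 0" using nullF nn[of "carrier G - D"] by linarith
  have "m (indicator D') \<le> m (indicator {g. d \<le> \<bar>Ft g - b\<bar>})"
  proof (rule mean_mono[OF m])
    fix g assume g: "g \<in> carrier G"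
    have "d \<le> \<bar>Ft g - b\<bar>" if "g \<in> D'"
      using that g Ft[OF g] by (auto simp: D'_def D_def d_def abs_if split: if_splits)
    then show "indicator D' g \<le> (indicator {g. d \<le> \<bar>Ft g - b\<bar>} g :: real)" by (auto split: split_indicator)
  qed simp_all
  then have m2: "m (indicator D') = 0" using nullFt nn[of D'] by linarith
  have lin: "linear \<psi>" using psi(1) by (rule extensions_linear)
  have psi0: "\<psi> (proj E) = 0" if "E \<subseteq> carrier G" "m (indicator E) = 0" for E
    using that by (simp add: m_def to_mean_def mult_op_indicator)
  have zero: "\<psi> (cop c (L t)) = 0" for c
  proof -
    have 1: "proj D o\<^sub>L cop c (L t) = cop c (L t) o\<^sub>L proj D'"
      using t(1) by (intro blinfun_eqI l2_eqI) (auto simp: fn_L D'_def D_def m_assoc[symmetric])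
    have "cop c (L t) = P o\<^sub>L cop c (L t)"
      using corner_left[OF corner_cop[OF L_corner[OF t(1)]]] by simp
    also have "P = proj D + proj (carrier G - D)"
      by (intro blinfun_eqI l2_eqI) (auto simp: D_def blinfun.add_left)
    finally have "\<psi> (cop c (L t)) = \<psi> (proj D o\<^sub>L cop c (L t)) + \<psi> (proj (carrier G - D) o\<^sub>L cop c (L t))"
      by (metis oL.add_left linear_add[OF lin])
    moreover have "\<psi> (proj (carrier G - D) o\<^sub>L cop c (L t)) = 0"
      by (rule state_null_projection(2)[OF lin extensions_le[OF psi(1)] extensions_P[OF psi(1)]])
        (use m1 in \<open>simp_all add: psi0\<close>)
    moreover have "\<psi> (cop c (L t) o\<^sub>L proj D') = 0"
      by (rule state_null_projection(1)[OF lin extensions_le[OF psi(1)] extensions_P[OF psi(1)]])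
        (use m2 in \<open>simp_all add: psi0 D'_def\<close>)
    ultimately show ?thesis by (simp add: 1)
  qed
  have "Re (c * \<theta> (L t)) = 0" for c
    using zero[of c] extensions_Alg[OF psi(1), of "cop c (L t)"] t(1) by (simp add: Alg_cop Alg_L trace_cop[OF tr])
  \<comment> \<open>The extension only controls real parts, so it is applied to scalar multiples of \<open>L t\<close>.\<close>
  from this[of 1] this[of \<i>] show ?thesis by (simp add: complex_eq_iff)
qed

end

end

section \<open>The FC-hypercenter\<close>

context group
begin

lemma normal_Union_chain:
  assumes C: "C \<noteq> {}" "\<And>N. N \<in> C \<Longrightarrow> N \<lhd> G" "\<And>N N'. N \<in> C \<Longrightarrow> N' \<in> C \<Longrightarrow> N \<subseteq> N' \<or> N' \<subseteq> N"
  shows "\<Union>C \<lhd> G"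
  unfolding normal_inv_iff
proof (intro conjI ballI)
  have s: "subgroup N G" if "N \<in> C" for N using C(2)[OF that] by (rule normal_imp_subgroup)
  show "subgroup (\<Union>C) G"
  proof
    show "\<Union>C \<subseteq> carrier G" using subgroup.subset[OF s] by (rule Union_least)
    obtain N where "N \<in> C" using C(1) by blast
    then show "\<one> \<in> \<Union>C" using subgroup.one_closed[OF s[of N]] by blast
    show "inv x \<in> \<Union>C" if x: "x \<in> \<Union>C" for x
    proof -
      obtain N where N: "N \<in> C" "x \<in> N" using x by blast
      show ?thesis using N(1) subgroup.m_inv_closed[OF s[OF N(1)] N(2)] by (rule UnionI)
    qed
    fix x y assume "x \<in> \<Union>C" "y \<in> \<Union>C"
    then obtain N N' where N: "N \<in> C" "x \<in> N" "N' \<in> C" "y \<in> N'" by blast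
    from C(3)[OF N(1,3)] show "x \<otimes> y \<in> \<Union>C"
    proof
      assume "N \<subseteq> N'"
      then have "x \<otimes> y \<in> N'" using N s[OF N(3)] by (intro subgroup.m_closed) auto
      then show ?thesis using N by blast
    next
      assume "N' \<subseteq> N"
      then have "x \<otimes> y \<in> N" using N s[OF N(1)] by (intro subgroup.m_closed) auto
      then show ?thesis using N by blast
    qed
  qed
  fix x h assume x: "x \<in> carrier G" and "h \<in> \<Union>C"
  then obtain N where N: "N \<in> C" "h \<in> N" by blast
  then have "x \<otimes> h \<otimes> inv x \<in> N" using C(2) x unfolding normal_inv_iff by blast
  then show "x \<otimes> h \<otimes> inv x \<in> \<Union>C" using N by blast
qed

text \<open>The preimage in \<open>G\<close> of the elements of \<open>G / N\<close> with a finite conjugacy class.\<close>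
definition fc_preimage :: "'a set \<Rightarrow> 'a set" where
  "fc_preimage N = {g \<in> carrier G. finite ((\<lambda>c. N #> c) ` conj_class G g)}"

lemma normal_fc_preimage:
  assumes N: "N \<lhd> G" shows "fc_preimage N \<lhd> G" "N \<subseteq> fc_preimage N"
proof -
  interpret N: normal N G by (rule N)
  have mem: "h \<otimes> g \<otimes> inv h \<in> carrier G" if "g \<in> carrier G" "h \<in> carrier G" for g h using that by simp
  show sub: "N \<subseteq> fc_preimage N"
  proof
    fix n assume n: "n \<in> N"
    have "(\<lambda>c. N #> c) ` conj_class G n \<subseteq> {N}"
    proof clarify
      fix c assume "c \<in> conj_class G n"
      then have "c \<in> N" using n N.inv_op_closed2 by (auto simp: conj_class_def)
      then show "N #> c = N" using coset_join2[OF _ N.is_subgroup] by simp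
    qed
    then show "n \<in> fc_preimage N" using n by (auto simp: fc_preimage_def intro: finite_subset)
  qed
  show "fc_preimage N \<lhd> G"
    unfolding normal_inv_iff
  proof (intro conjI ballI)
    show "subgroup (fc_preimage N) G"
    proof
      show "fc_preimage N \<subseteq> carrier G" by (auto simp: fc_preimage_def)
      show "\<one> \<in> fc_preimage N" using sub N.one_closed by blast
    next
      fix x y assume xy: "x \<in> fc_preimage N" "y \<in> fc_preimage N"
      then have G: "x \<in> carrier G" "y \<in> carrier G" by (auto simp: fc_preimage_def)
      have "(\<lambda>c. N #> c) ` conj_class G (x \<otimes> y) \<subseteq>
        (\<lambda>(A, B). A <#> B) ` ((\<lambda>c. N #> c) ` conj_class G x \<times> (\<lambda>c. N #> c) ` conj_class G y)"
      proof clarify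
        fix c assume "c \<in> conj_class G (x \<otimes> y)"
        then obtain h where h: "h \<in> carrier G" "c = h \<otimes> (x \<otimes> y) \<otimes> inv h" by (auto simp: conj_class_def)
        have "c = (h \<otimes> x \<otimes> inv h) \<otimes> (h \<otimes> y \<otimes> inv h)"
          using h G by (simp add: m_assoc) (simp add: m_assoc[symmetric])
        then have "N #> c = (N #> (h \<otimes> x \<otimes> inv h)) <#> (N #> (h \<otimes> y \<otimes> inv h))"
          using h G by (simp add: N.rcos_sum)
        then show "N #> c \<in> (\<lambda>(A, B). A <#> B) ` ((\<lambda>c. N #> c) ` conj_class G x \<times> (\<lambda>c. N #> c) ` conj_class G y)"
          using h by (auto simp: conj_class_def intro!: image_eqI[of _ _ "(N #> (h \<otimes> x \<otimes> inv h), N #> (h \<otimes> y \<otimes> inv h))"])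
      qed
      moreover have "finite ((\<lambda>(A, B). A <#> B) ` ((\<lambda>c. N #> c) ` conj_class G x \<times> (\<lambda>c. N #> c) ` conj_class G y))"
        using xy by (simp add: fc_preimage_def)
      ultimately show "x \<otimes> y \<in> fc_preimage N" using G finite_subset by (auto simp: fc_preimage_def)
    next
      fix x assume x: "x \<in> fc_preimage N"
      then have G: "x \<in> carrier G" by (simp add: fc_preimage_def)
      have "(\<lambda>c. N #> c) ` conj_class G (inv x) \<subseteq> (\<lambda>A. set_inv A) ` (\<lambda>c. N #> c) ` conj_class G x"
      proof clarify
        fix c assume "c \<in> conj_class G (inv x)"
        then obtain h where h: "h \<in> carrier G" "c = h \<otimes> inv x \<otimes> inv h" by (auto simp: conj_class_def)
        have "c = inv (h \<otimes> x \<otimes> inv h)" using h G by (simp add: inv_mult_group m_assoc)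
        then have "N #> c = set_inv (N #> (h \<otimes> x \<otimes> inv h))" using h G by (simp add: N.rcos_inv)
        then show "N #> c \<in> (\<lambda>A. set_inv A) ` (\<lambda>c. N #> c) ` conj_class G x"
          using h by (auto simp: conj_class_def)
      qed
      moreover have "finite ((\<lambda>A. set_inv A) ` (\<lambda>c. N #> c) ` conj_class G x)"
        using x by (simp add: fc_preimage_def)
      ultimately have "finite ((\<lambda>c. N #> c) ` conj_class G (inv x))" by (rule finite_subset)
      then show "inv x \<in> fc_preimage N" using G by (simp add: fc_preimage_def)
    qed
    fix x g assume x: "x \<in> carrier G" and g: "g \<in> fc_preimage N"
    then have gG: "g \<in> carrier G" by (simp add: fc_preimage_def)
    have "conj_class G (x \<otimes> g \<otimes> inv x) \<subseteq> conj_class G g"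
    proof
      fix c assume "c \<in> conj_class G (x \<otimes> g \<otimes> inv x)"
      then obtain h where h: "h \<in> carrier G" "c = h \<otimes> (x \<otimes> g \<otimes> inv x) \<otimes> inv h" by (auto simp: conj_class_def)
      then have "c = (h \<otimes> x) \<otimes> g \<otimes> inv (h \<otimes> x)" using x gG by (simp add: inv_mult_group m_assoc)
      then show "c \<in> conj_class G g" using h x by (auto simp: conj_class_def)
    qed
    then show "x \<otimes> g \<otimes> inv x \<in> fc_preimage N"
      using x g finite_subset[OF image_mono] by (auto simp: fc_preimage_def)
  qed
qed

end

context twisted_group
begin

definition Ad :: "'a \<Rightarrow> ('a l2 \<Rightarrow>\<^sub>L 'a l2) \<Rightarrow> 'a l2 \<Rightarrow>\<^sub>L 'a l2" where
  "Ad h T = L h o\<^sub>L (T o\<^sub>L Ls h)"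

lemma complex_linear_Ls: "h \<in> carrier G \<Longrightarrow> complex_linear (Ls h)"
  by (simp add: Ls_def complex_linear_cop complex_linear_L)

lemma Ls_mult:
  assumes h: "h \<in> carrier G" and k: "k \<in> carrier G"
  shows "Ls (h \<otimes> k) = cop (\<sigma> h k) (Ls k o\<^sub>L Ls h)"
proof (rule isadj_unique)
  show "isadj (Ls (h \<otimes> k)) (L (h \<otimes> k))" using h k by (simp add: isadj_Ls)
  have "L (h \<otimes> k) = cop (cnj (\<sigma> h k)) (L h o\<^sub>L L k)"
    using sigma_cnj[OF h k] by (simp add: L_mult[OF h k] mult.commute)
  then show "isadj (cop (\<sigma> h k) (Ls k o\<^sub>L Ls h)) (L (h \<otimes> k))"
    using isadj_cop[OF isadj_compose[OF isadj_Ls[OF h] isadj_Ls[OF k]], of "cnj (\<sigma> h k)"] by simp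
qed

text \<open>The scalars from the two products cancel, so conjugation is an honest action of the group.\<close>
lemma Ad_mult:
  assumes h: "h \<in> carrier G" and k: "k \<in> carrier G" and T: "complex_linear T"
  shows "Ad (h \<otimes> k) T = Ad h (Ad k T)"
proof -
  have "cop (\<sigma> h k) (Ad (h \<otimes> k) T) = cop (\<sigma> h k) (L (h \<otimes> k)) o\<^sub>L (T o\<^sub>L Ls (h \<otimes> k))"
    by (simp add: Ad_def cop_compose_left)
  also have "\<dots> = (L h o\<^sub>L L k) o\<^sub>L (T o\<^sub>L cop (\<sigma> h k) (Ls k o\<^sub>L Ls h))"
    by (simp add: L_mult[OF h k] Ls_mult[OF h k])
  also have "\<dots> = cop (\<sigma> h k) (Ad h (Ad k T))"
    by (simp add: cop_compose_right[OF T] cop_compose_right[OF complex_linear_compose[OF complex_linear_L[OF h] complex_linear_L[OF k]]])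
      (simp add: Ad_def oL_assoc)
  finally have "cop (cnj (\<sigma> h k)) (cop (\<sigma> h k) (Ad (h \<otimes> k) T))
      = cop (cnj (\<sigma> h k)) (cop (\<sigma> h k) (Ad h (Ad k T)))" by simp
  then show ?thesis using sigma_cnj[OF h k] by (simp add: mult.commute)
qed

lemma Ad_L:
  assumes h: "h \<in> carrier G" and g: "g \<in> carrier G"
  obtains c where "cmod c = 1" "Ad h (L g) = cop c (L (h \<otimes> g \<otimes> inv h))"
proof
  show "cmod (cnj (\<sigma> h (inv h)) * \<sigma> g (inv h) * \<sigma> h (g \<otimes> inv h)) = 1"
    using h g by (simp add: norm_mult cmod_sigma)
  show "Ad h (L g) = cop (cnj (\<sigma> h (inv h)) * \<sigma> g (inv h) * \<sigma> h (g \<otimes> inv h)) (L (h \<otimes> g \<otimes> inv h))"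
    using h g by (simp add: Ad_def Ls_def cop_compose_right complex_linear_L L_mult m_assoc)
qed

lemma Ad_commuting:
  assumes h: "h \<in> carrier G" and g: "g \<in> carrier G" and comm: "g \<otimes> h = h \<otimes> g"
  shows "Ad h (L g) = cop (\<sigma> h g * cnj (\<sigma> g h)) (L g)"
proof -
  have "L h o\<^sub>L L g = cop (\<sigma> h g * cnj (\<sigma> g h)) (L g o\<^sub>L L h)"
    using sigma_cnj[OF g h] by (simp add: L_mult h g comm mult.assoc) (simp add: mult.commute)
  then have "Ad h (L g) = cop (\<sigma> h g * cnj (\<sigma> g h)) (L g o\<^sub>L (L h o\<^sub>L Ls h))"
    by (simp add: Ad_def oL_assoc[symmetric] cop_compose_left)
  then show ?thesis by (simp add: L_Ls[OF h] corner_right[OF L_corner[OF g]])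
qed

context
  fixes \<theta> assumes tr: "is_trace \<theta>"
begin

lemma trace_Ad: assumes h: "h \<in> carrier G" and T: "T \<in> Alg" shows "\<theta> (Ad h T) = \<theta> T"
proof -
  have "\<theta> (Ad h T) = \<theta> ((T o\<^sub>L Ls h) o\<^sub>L L h)"
    unfolding Ad_def by (rule trace_commute[OF tr]) (simp_all add: Alg_compose Alg_L Alg_Ls h T)
  then show ?thesis by (simp add: oL_assoc L_Ls[OF h] corner_right[OF Alg_corner[OF T]])
qed

lemma trace_conjugate:
  assumes "c \<in> conj_class G g" and g: "g \<in> carrier G"
  shows "cmod (\<theta> (L c)) = cmod (\<theta> (L g))"
proof -
  obtain h where h: "h \<in> carrier G" "c = h \<otimes> g \<otimes> inv h" using assms(1) by (auto simp: conj_class_def)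
  obtain k where k: "cmod k = 1" "Ad h (L g) = cop k (L c)" using Ad_L[OF h(1) g] h(2) by metis
  have "\<theta> (L g) = k * \<theta> (L c)"
    using trace_Ad[OF h(1) Alg_L[OF g]] k h g by (simp add: trace_cop[OF tr] Alg_L)
  then show ?thesis using k by (simp add: norm_mult)
qed

text \<open>Conjugation by a commuting \<open>h\<close> with \<open>\<sigma> g h \<noteq> \<sigma> h g\<close> multiplies \<open>L g\<close> by a scalar different from 1, but
does not change its trace.\<close>
lemma trace_not_regular:
  assumes g: "g \<in> carrier G" and "\<not> sigma_regular G \<sigma> g" shows "\<theta> (L g) = 0"
proof -
  obtain h where h: "h \<in> carrier G" "g \<otimes> h = h \<otimes> g" "\<sigma> g h \<noteq> \<sigma> h g"
    using assms(2) by (auto simp: sigma_regular_def)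
  have "\<theta> (L g) = (\<sigma> h g * cnj (\<sigma> g h)) * \<theta> (L g)"
    using trace_Ad[OF h(1) Alg_L[OF g]] Ad_commuting[OF h(1) g h(2)] g by (simp add: trace_cop[OF tr] Alg_L)
  moreover have "\<sigma> h g * cnj (\<sigma> g h) \<noteq> 1"
  proof
    assume e: "\<sigma> h g * cnj (\<sigma> g h) = 1"
    have "\<sigma> h g = \<sigma> h g * (cnj (\<sigma> g h) * \<sigma> g h)"
      using sigma_cnj[OF g h(1)] by (simp add: mult.commute)
    also have "\<dots> = \<sigma> g h" using e by (simp add: mult.assoc[symmetric])
    finally show False using h(3) by simp
  qed
  ultimately show ?thesis by (metis mult_cancel_right1)
qed

lemma trace_sum: "finite F \<Longrightarrow> (\<And>x. x \<in> F \<Longrightarrow> T x \<in> Alg) \<Longrightarrow>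
    \<theta> (\<Sum>x\<in>F. T x) = (\<Sum>x\<in>F. \<theta> (T x)) \<and> (\<Sum>x\<in>F. T x) \<in> Alg"
proof (induction F rule: finite_induct)
  case empty
  then show ?case using trace_scaleR[OF tr Alg_P, of 0] subspace_0[OF Alg_subspace] by simp
next
  case (insert x F)
  then show ?case by (simp add: trace_add[OF tr] Alg_add)
qed

lemma isadj_sum: "finite F \<Longrightarrow> (\<And>x. x \<in> F \<Longrightarrow> isadj (S x) (T x)) \<Longrightarrow> isadj (\<Sum>x\<in>F. S x) (\<Sum>x\<in>F. T x)"
proof (induction F rule: finite_induct)
  case empty
  then show ?case by (simp add: isadj_def bounded_bilinear.zero_left[OF bounded_bilinear_cinner]
          bounded_bilinear.zero_right[OF bounded_bilinear_cinner])
next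
  case (insert x F)
  then show ?case by (simp add: isadj_add)
qed

text \<open>Bessel's inequality for the operators \<open>L c\<close>, orthonormal for the inner product of the trace: it expresses
positivity of the trace at \<open>(P - a)\<^sup>* (P - a)\<close>, where \<open>a\<close> is the orthogonal projection of \<open>P\<close> to their
span.\<close>
lemma trace_bessel:
  assumes F: "finite F" "F \<subseteq> carrier G"
    and orth: "\<And>c d. c \<in> F \<Longrightarrow> d \<in> F \<Longrightarrow> c \<noteq> d \<Longrightarrow> \<theta> (L (inv c \<otimes> d)) = 0"
  shows "(\<Sum>c\<in>F. (cmod (\<theta> (L c)))\<^sup>2) \<le> 1"
proof -
  define a where "a = (\<Sum>c\<in>F. cop (cnj (\<theta> (L c))) (L c))"
  define b where "b = (\<Sum>c\<in>F. cop (\<theta> (L c)) (Ls c))"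
  define s where "s = (\<Sum>c\<in>F. (cmod (\<theta> (L c)))\<^sup>2)"
  have FG: "c \<in> carrier G" if "c \<in> F" for c using that F by blast
  have ba: "isadj b a"
    unfolding a_def b_def
  proof (rule isadj_sum[OF F(1)])
    fix c assume "c \<in> F"
    then show "isadj (cop (\<theta> (L c)) (Ls c)) (cop (cnj (\<theta> (L c))) (L c))"
      using isadj_cop[OF isadj_Ls[OF FG], of c "cnj (\<theta> (L c))"] by simp
  qed
  have aA: "a \<in> Alg" "b \<in> Alg"
    unfolding a_def b_def using trace_sum[OF F(1)] FG by (simp_all add: Alg_cop Alg_L Alg_Ls)
  have ta: "\<theta> a = complex_of_real s"
  proof -
    have "\<theta> a = (\<Sum>c\<in>F. cnj (\<theta> (L c)) * \<theta> (L c))"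
      unfolding a_def using trace_sum[OF F(1), of "\<lambda>c. cop (cnj (\<theta> (L c))) (L c)"] FG
      by (simp add: Alg_cop Alg_L trace_cop[OF tr])
    then show ?thesis
      unfolding s_def of_real_sum by (simp only: complex_norm_square mult.commute)
  qed
  have tb: "\<theta> b = complex_of_real s" using trace_adj[OF tr aA(1) ba] ta by simp
  have tba: "\<theta> (b o\<^sub>L a) = complex_of_real s"
  proof -
    have inner: "\<theta> (cop (\<theta> (L c)) (Ls c) o\<^sub>L a) = complex_of_real ((cmod (\<theta> (L c)))\<^sup>2)" if c: "c \<in> F" for c
    proof -
      have LL: "\<theta> (Ls c o\<^sub>L L d) = (if d = c then 1 else 0)" if d: "d \<in> F" for d
      proof (cases "d = c")
        case True
        then show ?thesis using L_Ls(2)[OF FG[OF c]] trace_P[OF tr] by simp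
      next
        case False
        then show ?thesis
          using orth[OF c d] FG[OF c] FG[OF d]
          by (simp add: Ls_def cop_compose_left L_mult trace_cop[OF tr] Alg_L)
      qed
      have "cop (\<theta> (L c)) (Ls c) o\<^sub>L a = (\<Sum>d\<in>F. cop (\<theta> (L c) * cnj (\<theta> (L d))) (Ls c o\<^sub>L L d))"
        unfolding a_def oL.sum_right using FG[OF c] complex_linear_Ls
        by (intro sum.cong refl) (simp add: cop_compose_left cop_compose_right)
      then have "\<theta> (cop (\<theta> (L c)) (Ls c) o\<^sub>L a) = (\<Sum>d\<in>F. \<theta> (L c) * cnj (\<theta> (L d)) * (if d = c then 1 else 0))"
        using trace_sum[OF F(1), of "\<lambda>d. cop (\<theta> (L c) * cnj (\<theta> (L d))) (Ls c o\<^sub>L L d)"] FG[OF c] FG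
        by (simp add: Alg_cop Alg_compose Alg_L Alg_Ls trace_cop[OF tr] LL)
      also have "\<dots> = (\<Sum>d\<in>F. if d = c then \<theta> (L c) * cnj (\<theta> (L c)) else 0)"
        by (intro sum.cong refl) simp
      also have "\<dots> = \<theta> (L c) * cnj (\<theta> (L c))" using c F(1) by (simp add: sum.delta)
      finally show ?thesis by (simp only: complex_norm_square)
    qed
    have "\<theta> (b o\<^sub>L a) = (\<Sum>c\<in>F. \<theta> (cop (\<theta> (L c)) (Ls c) o\<^sub>L a))"
      unfolding b_def oL.sum_left
      using trace_sum[OF F(1), of "\<lambda>c. cop (\<theta> (L c)) (Ls c) o\<^sub>L a"] FG aA
      by (simp add: Alg_cop Alg_compose Alg_Ls)
    then show ?thesis by (simp add: inner s_def)
  qed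
  have "isadj (P - b) (P - a)"
    using isadj_add[OF isadj_proj isadj_cop[OF ba, of "-1"]] by (simp add: cop_minus_one)
  then have "\<theta> ((P - b) o\<^sub>L (P - a)) \<in> \<real>\<^sub>\<ge>\<^sub>0"
    using aA Alg_P Alg_diff by (intro trace_positive[OF tr]) simp_all
  moreover have "(P - b) o\<^sub>L (P - a) = (P - a) - (b - (b o\<^sub>L a))"
    using corner_left[OF Alg_corner[OF aA(1)]] corner_right[OF Alg_corner[OF aA(2)]]
    by (simp add: oL.diff_left oL.diff_right proj_proj)
  ultimately have "1 - complex_of_real s \<in> \<real>\<^sub>\<ge>\<^sub>0"
    using aA Alg_P by (simp add: trace_diff[OF tr] Alg_diff Alg_compose trace_P[OF tr] ta tb tba)
  then show ?thesis
    by (simp add: s_def[symmetric] complex_nonneg_Reals_iff)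
qed

text \<open>Infinitely many conjugates \<open>c\<close> of \<open>g\<close> lie in one coset of \<open>N\<close>. Their quotients lie in \<open>N\<close>, so the operators
\<open>L c\<close> are orthonormal for the trace, while all the values at \<open>L c\<close> have the same modulus.\<close>
lemma trace_infinite_class_finite_quotient:
  assumes N: "N \<lhd> G" and van: "\<And>n. n \<in> N \<Longrightarrow> n \<noteq> \<one> \<Longrightarrow> \<theta> (L n) = 0"
    and g: "g \<in> carrier G" and inf: "infinite (conj_class G g)"
    and fin: "finite ((\<lambda>c. N #> c) ` conj_class G g)"
  shows "\<theta> (L g) = 0"
proof (rule ccontr)
  assume nz: "\<theta> (L g) \<noteq> 0"
  interpret N: normal N G by (rule N)
  obtain c0 where c0: "infinite {c \<in> conj_class G g. N #> c = N #> c0}"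
    using pigeonhole_infinite[OF inf fin] by blast
  define \<alpha> where "\<alpha> = (cmod (\<theta> (L g)))\<^sup>2"
  have a: "\<alpha> > 0" using nz by (simp add: \<alpha>_def)
  obtain n where n: "1 < real n * \<alpha>" using reals_Archimedean3[OF a] by blast
  obtain F where F: "F \<subseteq> {c \<in> conj_class G g. N #> c = N #> c0}" "finite F" "card F = n"
    using infinite_arbitrarily_large[OF c0] by metis
  have FG: "c \<in> carrier G" if "c \<in> F" for c using that F(1) g by (auto simp: conj_class_def)
  have "(\<Sum>c\<in>F. (cmod (\<theta> (L c)))\<^sup>2) \<le> 1"
  proof (rule trace_bessel[OF F(2)])
    fix c d assume cd: "c \<in> F" "d \<in> F" "c \<noteq> d"
    have G: "c \<in> carrier G" "d \<in> carrier G" using cd FG by auto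
    have "N #> d = N #> c" using cd F(1) by auto
    then have "d \<in> N #> c" using repr_independenceD[OF N.is_subgroup G(2), of c] by simp
    then obtain k where k: "k \<in> N" "d = k \<otimes> c" by (auto simp: r_coset_def)
    have "inv c \<otimes> d = inv c \<otimes> k \<otimes> c" using k G N.subset by (auto simp: m_assoc)
    then have "inv c \<otimes> d \<in> N" using N.inv_op_closed1[OF G(1) k(1)] by simp
    moreover have "inv c \<otimes> d \<noteq> \<one>" using cd(3) G by (metis inv_closed inv_equality inv_inv)
    ultimately show "\<theta> (L (inv c \<otimes> d)) = 0" by (rule van)
  qed (use FG in blast)
  moreover have "(\<Sum>c\<in>F. (cmod (\<theta> (L c)))\<^sup>2) = real n * \<alpha>"
  proof -
    have "(cmod (\<theta> (L c)))\<^sup>2 = \<alpha>" if "c \<in> F" for c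
      using that F(1) trace_conjugate[OF _ g, of c] by (auto simp: \<alpha>_def)
    then show ?thesis using F by simp
  qed
  ultimately show False using n by linarith
qed

text \<open>Take a maximal normal subgroup \<open>N\<close> on which the trace vanishes off the identity. By the two preceding
arguments it contains every element with a finite class modulo \<open>N\<close>, so \<open>G / N\<close> is ICC. This replaces a
transfinite induction along the upper FC-central series.\<close>
theorem trace_vanishes_on_FC_hypercenter:
  assumes K: "Kleppner G \<sigma>" and g: "g \<in> FC_hypercenter G" "g \<noteq> \<one>"
  shows "\<theta> (L g) = 0"
proof -
  define \<N> where "\<N> = {N. N \<lhd> G \<and> (\<forall>n\<in>N. n \<noteq> \<one> \<longrightarrow> \<theta> (L n) = 0)}"
  have fin_class: "\<theta> (L g) = 0" if "g \<in> carrier G" "g \<noteq> \<one>" "finite (conj_class G g)" for g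
    using that K trace_not_regular unfolding Kleppner_def by blast
  have "\<exists>N\<in>\<N>. \<forall>N'\<in>\<N>. N \<subseteq> N' \<longrightarrow> N' = N"
  proof (rule subset_Zorn_nonempty)
    show "\<N> \<noteq> {}" using one_is_normal by (auto simp: \<N>_def)
    fix C assume C: "C \<noteq> {}" "subset.chain \<N> C"
    have "\<Union>C \<lhd> G"
    proof (rule normal_Union_chain[OF C(1)])
      show "N \<lhd> G" if "N \<in> C" for N using that C(2) by (auto simp: subset.chain_def \<N>_def)
      show "N \<subseteq> N' \<or> N' \<subseteq> N" if "N \<in> C" "N' \<in> C" for N N'
        using that C(2) unfolding subset_chain_def by blast
    qed
    then show "\<Union>C \<in> \<N>" using C(2) by (auto simp: subset.chain_def \<N>_def)
  qed
  then obtain N where N: "N \<in> \<N>" and max: "\<And>N'. N' \<in> \<N> \<Longrightarrow> N \<subseteq> N' \<Longrightarrow> N' = N" by blast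
  have Nn: "N \<lhd> G" and van: "\<And>n. n \<in> N \<Longrightarrow> n \<noteq> \<one> \<Longrightarrow> \<theta> (L n) = 0" using N by (auto simp: \<N>_def)
  have "fc_preimage N \<in> \<N>"
    unfolding \<N>_def
  proof (intro CollectI conjI ballI impI normal_fc_preimage(1)[OF Nn])
    fix x assume x: "x \<in> fc_preimage N" "x \<noteq> \<one>"
    then have "x \<in> carrier G" "finite ((\<lambda>c. N #> c) ` conj_class G x)" by (auto simp: fc_preimage_def)
    then show "\<theta> (L x) = 0"
      using fin_class x(2) trace_infinite_class_finite_quotient[OF Nn van] by blast
  qed
  then have "fc_preimage N = N" using max normal_fc_preimage(2)[OF Nn] by blast
  then have "icc (G Mod N)"
    unfolding icc_quotient_iff[OF Nn] by (auto simp: conj_class_FactGroup[OF Nn] fc_preimage_def)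
  then have "FC_hypercenter G \<subseteq> N" using FC_hypercenter_least[OF Nn] by blast
  then show ?thesis using g van by blast
qed

end

section \<open>Traces from vectors\<close>

definition vector_functional :: "'a l2 \<Rightarrow> ('a l2 \<Rightarrow>\<^sub>L 'a l2) \<Rightarrow> complex" where "vector_functional v T = cinner (T v) v"

lemma bounded_linear_vector_functional: "bounded_linear (vector_functional v)"
  unfolding vector_functional_def[abs_def]
  by (rule bounded_linear_compose[OF bounded_bilinear.bounded_linear_left[OF bounded_bilinear_cinner] blinfun.bounded_linear_left])

lemma vector_functional_cop: "vector_functional v (cop c T) = c * vector_functional v T" by (simp add: vector_functional_def)

lemma vector_functional_pos: "isadj S T \<Longrightarrow> vector_functional v (S o\<^sub>L T) = complex_of_real ((norm (T v))\<^sup>2)"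
  using isadjD[OF isadj_sym, of S T "T v" v] by (simp add: vector_functional_def cinner_self_norm)

lemma L_delta: "g \<in> carrier G \<Longrightarrow> L g (delta \<one>) = delta g"
  by (rule l2_eqI) (auto simp: fn_L fn_delta sigma_one inv_solve_left' intro: inv_equality)

lemma vector_functional_one_L: assumes g: "g \<in> carrier G" shows "vector_functional (delta \<one>) (L g) = (if g = \<one> then 1 else 0)"
  using g by (auto simp: vector_functional_def L_delta cinner_delta_right fn_delta)

lemma canonical_trace:
  obtains \<tau> where "tracial_state (carrier G) (reduced_cstar G \<sigma>) \<tau>"
    "\<And>T. T \<in> Alg \<Longrightarrow> \<tau> (opr (carrier G) T) = vector_functional (delta \<one>) T"
proof (rule tracial_state_of_functional[OF bounded_linear_vector_functional vector_functional_cop])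
  show "vector_functional (delta \<one>) (S o\<^sub>L T) \<in> \<real>\<^sub>\<ge>\<^sub>0" if "isadj S T" for S T
    unfolding vector_functional_pos[OF that] by simp
  show "vector_functional (delta \<one>) P = 1" using vector_functional_one_L[of \<one>] by (simp add: L_one)
  fix g h assume g: "g \<in> carrier G" and h: "h \<in> carrier G"
  have "g \<otimes> h = \<one> \<longleftrightarrow> h = inv g" "h \<otimes> g = \<one> \<longleftrightarrow> h = inv g"
    using g h by (metis inv_equality inv_inv r_inv l_inv)+
  then show "vector_functional (delta \<one>) (L g o\<^sub>L L h) = vector_functional (delta \<one>) (L h o\<^sub>L L g)"
    using g h by (auto simp: L_mult vector_functional_cop vector_functional_one_L sigma_inv_commute)
qed blast

text \<open>A trace that vanishes at all nontrivial group elements agrees with the canonical one on generators.\<close>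
theorem unique_trace_if_vanishing:
  assumes "\<And>\<theta> g. is_trace \<theta> \<Longrightarrow> g \<in> carrier G \<Longrightarrow> g \<noteq> \<one> \<Longrightarrow> \<theta> (L g) = 0"
  shows "unique_trace_property G \<sigma>"
proof -
  obtain \<tau> where t: "tracial_state (carrier G) (reduced_cstar G \<sigma>) \<tau>" using canonical_trace by blast
  show ?thesis
    unfolding unique_trace_property_def
  proof (rule ex1I)
    show "tracial_state (carrier G) (reduced_cstar G \<sigma>) \<tau>" by (rule t)
    fix \<tau>' assume t': "tracial_state (carrier G) (reduced_cstar G \<sigma>) \<tau>'"
    have "\<theta> (L g) = (if g = \<one> then 1 else 0)" if "is_trace \<theta>" "g \<in> carrier G" for \<theta> g
      using assms[OF that] trace_P[OF that(1)] by (simp add: L_one)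
    note this[of "\<lambda>T. \<tau> (opr (carrier G) T)"] this[of "\<lambda>T. \<tau>' (opr (carrier G) T)"]
    then show "\<tau>' = \<tau>"
      using t t' by (intro tracial_state_unique[OF t' t]) (simp only: tracial_state_iff)
  qed
qed

theorem unique_trace_if_Kleppner:
  assumes "FC_hypercenter G = amenable_radical G" "Kleppner G \<sigma>"
  shows "unique_trace_property G \<sigma>"
proof (rule unique_trace_if_vanishing)
  fix \<theta> g assume "is_trace \<theta>" "g \<in> carrier G" "g \<noteq> \<one>"
  then show "\<theta> (L g) = 0"
    using trace_vanishes_off_rad trace_vanishes_on_FC_hypercenter[OF _ assms(2)] assms(1) amenable_radical_eq_rad
    by metis
qed

end

section \<open>Kleppner's condition is necessary\<close>

context twisted_group
begin

text \<open>Comparison with the canonical trace, in the form used to rule out further traces.\<close>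
lemma unique_trace_functional:
  assumes u: "unique_trace_property G \<sigma>"
    and phi: "bounded_linear \<phi>" "\<And>c T. \<phi> (cop c T) = c * \<phi> T"
      "\<And>S T. isadj S T \<Longrightarrow> \<phi> (S o\<^sub>L T) \<in> \<real>\<^sub>\<ge>\<^sub>0" "\<phi> P = 1"
      "\<And>g h. g \<in> carrier G \<Longrightarrow> h \<in> carrier G \<Longrightarrow> \<phi> (L g o\<^sub>L L h) = \<phi> (L h o\<^sub>L L g)"
    and g: "g \<in> carrier G" "g \<noteq> \<one>"
  shows "\<phi> (L g) = 0"
proof -
  obtain \<tau> where t: "tracial_state (carrier G) (reduced_cstar G \<sigma>) \<tau>"
    "\<And>T. T \<in> Alg \<Longrightarrow> \<tau> (opr (carrier G) T) = \<phi> T"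
    using tracial_state_of_functional[OF phi] by blast
  obtain \<tau>' where t': "tracial_state (carrier G) (reduced_cstar G \<sigma>) \<tau>'"
    "\<And>T. T \<in> Alg \<Longrightarrow> \<tau>' (opr (carrier G) T) = vector_functional (delta \<one>) T"
    using canonical_trace by blast
  have "\<tau> = \<tau>'" using u t(1) t'(1) unfolding unique_trace_property_def by blast
  then have "\<phi> (L g) = vector_functional (delta \<one>) (L g)" using t(2) t'(2) Alg_L[OF g(1)] by metis
  then show ?thesis using vector_functional_one_L[OF g(1)] g(2) by simp
qed

lemma unique_trace_vector_functional:
  assumes u: "unique_trace_property G \<sigma>" and v: "P v = v" "v \<noteq> 0"
    and comm: "\<And>g h. g \<in> carrier G \<Longrightarrow> h \<in> carrier G \<Longrightarrow> vector_functional v (L g o\<^sub>L L h) = vector_functional v (L h o\<^sub>L L g)"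
    and g: "g \<in> carrier G" "g \<noteq> \<one>"
  shows "vector_functional v (L g) = 0"
proof -
  define w where "w = inverse (norm v) *\<^sub>R v"
  have vw: "vector_functional w T = complex_of_real ((inverse (norm v))\<^sup>2) * vector_functional v T" if "complex_linear T" for T
    using that by (simp add: vector_functional_def w_def scaleR_eq_cscale complex_linear_apply power2_eq_square)
  have w1: "norm w = 1" "P w = w" using v by (simp_all add: w_def blinfun.scaleR_right)
  have "vector_functional w (L g) = 0"
  proof (rule unique_trace_functional[OF u bounded_linear_vector_functional vector_functional_cop _ _ _ g])
    show "vector_functional w (S o\<^sub>L T) \<in> \<real>\<^sub>\<ge>\<^sub>0" if "isadj S T" for S T unfolding vector_functional_pos[OF that] by simp
    show "vector_functional w P = 1" using w1 by (simp add: vector_functional_def cinner_self_norm)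
    show "vector_functional w (L g o\<^sub>L L h) = vector_functional w (L h o\<^sub>L L g)" if "g \<in> carrier G" "h \<in> carrier G" for g h
      using that comm by (simp add: vw complex_linear_compose complex_linear_L)
  qed
  then show ?thesis using v(2) g(1) by (simp add: vw complex_linear_L)
qed

lemma vector_functional_one_commute: assumes "S \<in> Alg" "T \<in> Alg" shows "vector_functional (delta \<one>) (S o\<^sub>L T) = vector_functional (delta \<one>) (T o\<^sub>L S)"
proof -
  obtain \<tau> where t: "tracial_state (carrier G) (reduced_cstar G \<sigma>) \<tau>"
    "\<And>T. T \<in> Alg \<Longrightarrow> \<tau> (opr (carrier G) T) = vector_functional (delta \<one>) T"
    using canonical_trace by blast
  have "is_trace (\<lambda>T. \<tau> (opr (carrier G) T))" using t(1) by (simp add: tracial_state_iff)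
  from trace_commute[OF this assms] show ?thesis using t(2) assms by (simp add: Alg_compose)
qed

lemma Alg_sum: "finite F \<Longrightarrow> (\<And>x. x \<in> F \<Longrightarrow> T x \<in> Alg) \<Longrightarrow> (\<Sum>x\<in>F. T x) \<in> Alg"
  using subspace_sum[OF Alg_subspace] by blast

lemma Ad_sum: "Ad h (\<Sum>x\<in>F. T x) = (\<Sum>x\<in>F. Ad h (T x))"
  by (simp add: Ad_def oL.sum_left oL.sum_right)

text \<open>Regularity makes \<open>h g h\<^sup>-\<^sup>1 \<mapsto> Ad h (L g)\<close> well defined on the class of \<open>g\<close>: two choices of \<open>h\<close> differ
by an element commuting with \<open>g\<close>, and conjugation by it fixes \<open>L g\<close>. The sum over the class is then invariant
under conjugation.\<close>
lemma central_element_of_regular_class: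
  assumes g: "g \<in> carrier G" and reg: "sigma_regular G \<sigma> g" and fin: "finite (conj_class G g)"
  shows "\<exists>z c. z \<in> Alg \<and> (\<forall>k\<in>carrier G. L k o\<^sub>L z = z o\<^sub>L L k) \<and>
    z (delta \<one>) = (\<Sum>x\<in>conj_class G g. cscale (c x) (delta x)) \<and> (\<forall>x\<in>conj_class G g. c x \<noteq> 0)"
proof -
  let ?C = "conj_class G g"
  have CG: "x \<in> carrier G" if "x \<in> ?C" for x using that g by (auto simp: conj_class_def)
  have "\<forall>x\<in>?C. \<exists>h. h \<in> carrier G \<and> x = h \<otimes> g \<otimes> inv h" by (auto simp: conj_class_def)
  then obtain h where h: "\<And>x. x \<in> ?C \<Longrightarrow> h x \<in> carrier G \<and> x = h x \<otimes> g \<otimes> inv (h x)" by metis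
  define \<Lambda> where "\<Lambda> x = Ad (h x) (L g)" for x
  have well: "Ad k (L g) = \<Lambda> (k \<otimes> g \<otimes> inv k)" if k: "k \<in> carrier G" for k
  proof -
    define x where "x = k \<otimes> g \<otimes> inv k"
    have xC: "x \<in> ?C" using k by (auto simp: x_def conj_class_def)
    have hx: "h x \<in> carrier G" "x = h x \<otimes> g \<otimes> inv (h x)" using h[OF xC] by simp_all
    define m where "m = inv (h x) \<otimes> k"
    have m: "m \<in> carrier G" using hx k by (simp add: m_def)
    have "k \<otimes> g \<otimes> inv k = h x \<otimes> g \<otimes> inv (h x)" using hx(2) by (simp add: x_def)
    then have "(k \<otimes> g \<otimes> inv k) \<otimes> k = (h x \<otimes> g \<otimes> inv (h x)) \<otimes> k" by simp
    then have "k \<otimes> g = h x \<otimes> g \<otimes> inv (h x) \<otimes> k" using k g by (simp add: m_assoc)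
    then have "m \<otimes> g = inv (h x) \<otimes> (h x \<otimes> g \<otimes> inv (h x) \<otimes> k)"
      using hx(1) k g by (simp add: m_def m_assoc)
    then have comm: "g \<otimes> m = m \<otimes> g"
      using hx(1) k g by (simp add: m_def m_assoc[symmetric])
    have "Ad m (L g) = cop (\<sigma> m g * cnj (\<sigma> g m)) (L g)" by (rule Ad_commuting[OF m g comm])
    also have "\<sigma> g m = \<sigma> m g" using reg m comm unfolding sigma_regular_def by blast
    finally have Am: "Ad m (L g) = L g" using sigma_cnj[OF m g] by simp
    have "k = h x \<otimes> m" using hx(1) k by (simp add: m_def m_assoc[symmetric])
    then have "Ad k (L g) = Ad (h x) (Ad m (L g))" using Ad_mult[OF hx(1) m complex_linear_L[OF g]] by simp
    then show ?thesis by (simp add: Am \<Lambda>_def x_def)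
  qed
  have AdL: "Ad k (\<Lambda> x) = \<Lambda> (k \<otimes> x \<otimes> inv k)" if k: "k \<in> carrier G" and x: "x \<in> ?C" for k x
  proof -
    have hx: "h x \<in> carrier G" "x = h x \<otimes> g \<otimes> inv (h x)" using h[OF x] by simp_all
    have "Ad k (\<Lambda> x) = Ad (k \<otimes> h x) (L g)" unfolding \<Lambda>_def by (rule Ad_mult[OF k hx(1) complex_linear_L[OF g], symmetric])
    also have "\<dots> = \<Lambda> (k \<otimes> h x \<otimes> g \<otimes> inv (k \<otimes> h x))" using k hx(1) by (intro well) simp
    also have "k \<otimes> h x \<otimes> g \<otimes> inv (k \<otimes> h x) = k \<otimes> (h x \<otimes> g \<otimes> inv (h x)) \<otimes> inv k"
      using k hx(1) g by (simp add: inv_mult_group m_assoc)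
    finally show ?thesis using hx(2) by simp
  qed
  have \<Lambda>A: "\<Lambda> x \<in> Alg" if "x \<in> ?C" for x
    using h[OF that] g by (simp add: \<Lambda>_def Ad_def Alg_compose Alg_L Alg_Ls)
  have "\<forall>x\<in>?C. \<exists>c. cmod c = 1 \<and> \<Lambda> x = cop c (L x)"
  proof
    fix x assume "x \<in> ?C"
    from h[OF this] show "\<exists>c. cmod c = 1 \<and> \<Lambda> x = cop c (L x)"
      unfolding \<Lambda>_def using Ad_L[of "h x" g] g by metis
  qed
  then obtain c where c: "\<And>x. x \<in> ?C \<Longrightarrow> cmod (c x) = 1 \<and> \<Lambda> x = cop (c x) (L x)" by metis
  define z where "z = (\<Sum>x\<in>?C. \<Lambda> x)"
  have zA: "z \<in> Alg" unfolding z_def by (rule Alg_sum[OF fin \<Lambda>A])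
  have Adz: "Ad k z = z" if k: "k \<in> carrier G" for k
  proof -
    have mem: "k \<otimes> x \<otimes> inv k \<in> ?C" if k: "k \<in> carrier G" and x: "x \<in> ?C" for x k
    proof -
      have "k \<otimes> x \<otimes> inv k = (k \<otimes> h x) \<otimes> g \<otimes> inv (k \<otimes> h x)"
        using k h[OF x] g by (metis inv_mult_group inv_closed m_assoc m_closed)
      then show ?thesis using k h[OF x] by (auto simp: conj_class_def)
    qed
    have bij: "bij_betw (\<lambda>x. k \<otimes> x \<otimes> inv k) ?C ?C"
    proof (rule bij_betw_byWitness[of _ "\<lambda>x. inv k \<otimes> x \<otimes> k"])
      show "\<forall>x\<in>?C. inv k \<otimes> (k \<otimes> x \<otimes> inv k) \<otimes> k = x"
        using k CG by (simp add: m_assoc) (simp add: m_assoc[symmetric])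
      show "\<forall>x\<in>?C. k \<otimes> (inv k \<otimes> x \<otimes> k) \<otimes> inv k = x"
        using k CG by (simp add: m_assoc) (simp add: m_assoc[symmetric])
      show "(\<lambda>x. k \<otimes> x \<otimes> inv k) ` ?C \<subseteq> ?C" using mem[OF k] by blast
      show "(\<lambda>x. inv k \<otimes> x \<otimes> k) ` ?C \<subseteq> ?C" using mem[of "inv k"] k by auto
    qed
    have "Ad k z = (\<Sum>x\<in>?C. \<Lambda> (k \<otimes> x \<otimes> inv k))"
      unfolding z_def Ad_sum using AdL[OF k] by (intro sum.cong) auto
    also have "\<dots> = z" unfolding z_def by (rule sum.reindex_bij_betw[OF bij])
    finally show ?thesis .
  qed
  show ?thesis
  proof (intro exI conjI ballI)
    show "z \<in> Alg" by (rule zA)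
    fix k assume k: "k \<in> carrier G"
    have "z o\<^sub>L L k = Ad k z o\<^sub>L L k" using Adz[OF k] by simp
    also have "\<dots> = L k o\<^sub>L z"
      by (simp add: Ad_def oL_assoc L_Ls(2)[OF k] corner_right[OF Alg_corner[OF zA]])
    finally show "L k o\<^sub>L z = z o\<^sub>L L k" by simp
  next
    have "z (delta \<one>) = (\<Sum>x\<in>?C. \<Lambda> x (delta \<one>))" unfolding z_def by (rule blinfun.sum_left)
    also have "\<dots> = (\<Sum>x\<in>?C. cscale (c x) (delta x))"
      by (rule sum.cong[OF refl]) (simp add: c L_delta CG)
    finally show "z (delta \<one>) = (\<Sum>x\<in>?C. cscale (c x) (delta x))" .
    show "c x \<noteq> 0" if "x \<in> ?C" for x using c[OF that] by auto
  qed
qed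

text \<open>For a central \<open>w\<close>, the functional \<open>T \<mapsto> \<langle>T w\<^sup>*\<delta>, w\<^sup>*\<delta>\<rangle>\<close> is a multiple of a trace. Apply this to
\<open>w = a + z\<close> for the central element \<open>z\<close> of a regular finite class and several scalars \<open>a\<close>. If all
these traces were canonical, the coefficient of \<open>z\<close> at \<open>g\<close> would vanish.\<close>
theorem Kleppner_if_unique_trace:
  assumes u: "unique_trace_property G \<sigma>" shows "Kleppner G \<sigma>"
  unfolding Kleppner_def
proof (intro ballI impI notI, elim conjE)
  fix g assume g: "g \<in> carrier G" and g1: "g \<noteq> \<one>" and reg: "sigma_regular G \<sigma> g"
    and fin: "finite (conj_class G g)"
  let ?C = "conj_class G g" and ?e = "delta \<one>"
  obtain z c where z: "z \<in> Alg" "\<And>k. k \<in> carrier G \<Longrightarrow> L k o\<^sub>L z = z o\<^sub>L L k"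
    and ze: "z ?e = (\<Sum>x\<in>?C. cscale (c x) (delta x))" and c: "\<And>x. x \<in> ?C \<Longrightarrow> c x \<noteq> 0"
    using central_element_of_regular_class[OF g reg fin] by blast
  have "g = \<one> \<otimes> g \<otimes> inv \<one>" using g by simp
  then have gC: "g \<in> ?C" unfolding conj_class_def using one_closed by blast
  have "\<one> \<notin> ?C"
  proof
    assume "\<one> \<in> ?C"
    then obtain h where h: "h \<in> carrier G" "\<one> = h \<otimes> g \<otimes> inv h" by (auto simp: conj_class_def)
    then have "h \<otimes> g = h" using g by (metis inv_closed inv_equality inv_inv m_closed)
    then show False using h(1) g g1 by (metis l_cancel_one)
  qed
  define zs where "zs = adj z"
  have ad: "isadj zs z" and zsA: "zs \<in> Alg"
    using isadj_adj[OF corner_complex_linear[OF Alg_corner[OF z(1)]]] Alg_adj[OF z(1)] by (simp_all add: zs_def)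
  have zs: "L k o\<^sub>L zs = zs o\<^sub>L L k" if k: "k \<in> carrier G" for k
  proof -
    have ik: "isadj (L k) (Ls k)" by (rule isadj_sym[OF isadj_Ls[OF k]])
    have "Ls k o\<^sub>L z = z o\<^sub>L Ls k"
      using z(2)[of "inv k"] k corner_complex_linear[OF Alg_corner[OF z(1)]]
      by (simp add: Ls_def cop_compose_left cop_compose_right)
    then have "isadj (zs o\<^sub>L L k) (z o\<^sub>L Ls k)" "isadj (L k o\<^sub>L zs) (z o\<^sub>L Ls k)"
      using isadj_compose[OF ik ad] isadj_compose[OF ad ik] by simp_all
    then show ?thesis by (metis isadj_unique)
  qed
  have swap: "vector_functional ?e (L g) = 0" if "g \<in> carrier G" "g \<noteq> \<one>" for g using vector_functional_one_L that by simp
  have Pe: "P ?e = ?e" by (metis L_delta L_one one_closed)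
  define \<zeta> where "\<zeta> = zs ?e"
  have P\<zeta>: "P \<zeta> = \<zeta>" unfolding \<zeta>_def by (rule corner_left_apply[OF Alg_corner[OF zsA]])
  have \<zeta>1: "fn \<zeta> \<one> = 0"
  proof -
    have "fn \<zeta> \<one> = cinner ?e (z ?e)"
      using isadjD[OF isadj_sym[OF ad], of ?e ?e] by (simp add: \<zeta>_def cinner_delta_right)
    then show ?thesis using \<open>\<one> \<notin> ?C\<close> by (simp add: cinner_delta_left ze fn_finite_combination[OF fin])
  qed
  define v where "v a = cscale (cnj a) ?e + \<zeta>" for a
  have van: "vector_functional (v a) (L g) = 0" if a: "a \<noteq> 0" for a
  proof (rule unique_trace_vector_functional[OF u _ _ _ g g1])
    show "P (v a) = v a" using Pe P\<zeta> by (simp add: v_def blinfun.add_right complex_linear_apply[OF complex_linear_proj])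
    have "fn (v a) \<one> = cnj a" by (simp add: v_def fn_delta \<zeta>1)
    then show "v a \<noteq> 0" using a by auto
    define w where "w = cop a P + z"
    define ws where "ws = cop (cnj a) P + zs"
    have wws: "isadj ws w"
      unfolding w_def ws_def by (rule isadj_add[OF isadj_cop[OF isadj_proj] ad])
    have wA: "w \<in> Alg" "ws \<in> Alg" unfolding w_def ws_def by (simp_all add: Alg_add Alg_cop Alg_P z zsA)
    have va: "v a = ws ?e" by (simp add: v_def ws_def \<zeta>_def blinfun.add_left Pe)
    have comm: "L k o\<^sub>L w = w o\<^sub>L L k" "L k o\<^sub>L ws = ws o\<^sub>L L k" if k: "k \<in> carrier G" for k
      using z(2)[OF k] zs[OF k] corner_left[OF L_corner[OF k]] corner_right[OF L_corner[OF k]] complex_linear_L[OF k]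
      by (simp_all add: w_def ws_def oL.add_left oL.add_right cop_compose_left cop_compose_right)
    fix k h assume k: "k \<in> carrier G" and h: "h \<in> carrier G"
    have reduce: "vector_functional (v a) (L k o\<^sub>L L h) = vector_functional ?e (L k o\<^sub>L (L h o\<^sub>L (w o\<^sub>L ws)))"
      if k: "k \<in> carrier G" and h: "h \<in> carrier G" for k h
    proof -
      have "vector_functional (v a) (L k o\<^sub>L L h) = cinner ((w o\<^sub>L (L k o\<^sub>L L h)) (ws ?e)) ?e"
        by (simp add: vector_functional_def va isadjD[OF wws, symmetric])
      also have "w o\<^sub>L (L k o\<^sub>L L h) = L k o\<^sub>L (L h o\<^sub>L w)"
        by (metis comm(1) k h oL_assoc)
      finally show ?thesis by (simp add: vector_functional_def)
    qed
    have "vector_functional ?e (L k o\<^sub>L (L h o\<^sub>L (w o\<^sub>L ws))) = vector_functional ?e ((L h o\<^sub>L (w o\<^sub>L ws)) o\<^sub>L L k)"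
      by (rule vector_functional_one_commute) (simp_all add: Alg_compose Alg_L k h wA)
    also have "(L h o\<^sub>L (w o\<^sub>L ws)) o\<^sub>L L k = L h o\<^sub>L (L k o\<^sub>L (w o\<^sub>L ws))"
      by (metis comm k oL_assoc)
    finally show "vector_functional (v a) (L k o\<^sub>L L h) = vector_functional (v a) (L h o\<^sub>L L k)"
      using reduce k h by simp
  qed
  define p q s where "p = cinner (L g ?e) \<zeta>" and "q = cinner (L g \<zeta>) ?e" and "s = cinner (L g \<zeta>) \<zeta>"
  have "vector_functional (v a) (L g) = cnj a * p + a * q + s" for a
    using swap[OF g g1] complex_linear_L[OF g]
    by (simp add: v_def vector_functional_def p_def q_def s_def blinfun.add_right complex_linear_apply cinner_add_left cinner_add_right)
  then have e: "cnj a * p + a * q + s = 0" if "a \<noteq> 0" for a using van[OF that] by simp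
  \<comment> \<open>The three scalars separate the coefficients \<open>p\<close>, \<open>q\<close> and \<open>s\<close>.\<close>
  have "q = 0"
    using e[of 1] e[of "-1"] e[of \<i>] by (simp add: complex_eq_iff)
  moreover have "q = cinner (zs (L g ?e)) ?e"
    using zs[OF g] by (metis blinfun_apply_blinfun_compose q_def \<zeta>_def)
  moreover have "cinner (zs (L g ?e)) ?e = cnj (c g)"
    using isadjD[OF isadj_sym[OF ad]] gC
    by (simp add: L_delta[OF g] cinner_delta_left ze fn_finite_combination[OF fin])
  ultimately show False using c[OF gC] by simp
qed

end

section \<open>Amenable normal subgroups give traces\<close>

text \<open>The hypothesis \<open>super\<close> says that averaging \<open>w\<close> over \<open>S\<close> multiplies it by at most \<open>1 / \<rho>\<close>, pointwise. The
function \<open>log w\<close> need not be bounded, but its differences \<open>c s\<close> are. Their means cancel in the pairs \<open>s\<close>,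
\<open>inv s\<close>, since \<open>c (inv s)\<close> is minus a translate of \<open>c s\<close>, while concavity of the logarithm makes the sum of the
\<open>c s\<close> at most \<open>- n log \<rho> < 0\<close> everywhere.\<close>
lemma (in group) no_spectral_gap_function:
  assumes am: "amenable G"
    and S: "finite S" "S \<noteq> {}" "S \<subseteq> carrier G" "\<And>s. s \<in> S \<Longrightarrow> inv s \<in> S"
    and w: "\<And>x. x \<in> carrier G \<Longrightarrow> 0 < w x" and \<rho>: "1 < \<rho>"
    and super: "\<And>x. x \<in> carrier G \<Longrightarrow> \<rho> * (\<Sum>s\<in>S. w (inv s \<otimes> x)) \<le> real (card S) * w x"
  shows False
proof -
  obtain m where m: "invariant_mean G m" using am unfolding amenable_def by blast
  define m' where "m' f = (if bdd (carrier G) f then m f else 0)" for f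
  have m': "m' \<in> means (carrier G)" using invariant_mean_imp_means[OF m] by (simp add: m'_def[abs_def])
  define n where "n = real (card S)"
  have n: "n > 0" using S by (simp add: n_def card_gt_0_iff)
  have SG: "s \<in> carrier G" if "s \<in> S" for s using that S by blast
  define c where "c s x = ln (w (inv s \<otimes> x)) - ln (w x)" for s x
  have harnack: "\<rho> * w (inv s \<otimes> x) \<le> n * w x" if s: "s \<in> S" and x: "x \<in> carrier G" for s x
  proof -
    have "w (inv s \<otimes> x) \<le> (\<Sum>s\<in>S. w (inv s \<otimes> x))"
      using S s x SG less_imp_le[OF w] by (intro member_le_sum) auto
    then have "\<rho> * w (inv s \<otimes> x) \<le> \<rho> * (\<Sum>s\<in>S. w (inv s \<otimes> x))"
      using \<rho> by (intro mult_left_mono) auto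
    then show ?thesis using super[OF x] by (simp add: n_def)
  qed
  have up: "c s x \<le> ln n - ln \<rho>" if s: "s \<in> S" and x: "x \<in> carrier G" for s x
  proof -
    have pos: "0 < w (inv s \<otimes> x)" "0 < w x" using w SG[OF s] x by simp_all
    have "ln (\<rho> * w (inv s \<otimes> x)) \<le> ln (n * w x)"
      using harnack[OF s x] pos \<rho> n by simp
    then show ?thesis using pos \<rho> n by (simp add: c_def ln_mult)
  qed
  have c_inv: "c (inv s) x = - c s (s \<otimes> x)" if s: "s \<in> S" and x: "x \<in> carrier G" for s x
    using SG[OF s] x by (simp add: c_def m_assoc[symmetric])
  have lo: "- (ln n - ln \<rho>) \<le> c s x" if s: "s \<in> S" and x: "x \<in> carrier G" for s x
  proof -
    have "c (inv s) (inv s \<otimes> x) \<le> ln n - ln \<rho>" using SG[OF s] x S(4)[OF s] by (intro up) simp_all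
    moreover have "c (inv s) (inv s \<otimes> x) = - c s x"
      using c_inv[OF s, of "inv s \<otimes> x"] SG[OF s] x by (simp add: m_assoc[symmetric])
    ultimately show ?thesis by linarith
  qed
  have cb: "bdd (carrier G) (c s)" if "s \<in> S" for s
  proof (rule bddI)
    show "\<bar>c s x\<bar> \<le> ln n - ln \<rho>" if "x \<in> carrier G" for x
      using up[OF \<open>s \<in> S\<close> that] lo[OF \<open>s \<in> S\<close> that] by linarith
  qed
  have anti: "m' (c (inv s)) = - m' (c s)" if s: "s \<in> S" for s
  proof -
    have "m' (c (inv s)) = m' (\<lambda>x. - 1 * c s (s \<otimes> x))"
      by (rule mean_cong[OF m']) (simp add: c_inv[OF s])
    also have "\<dots> = - 1 * m' (\<lambda>x. c s (s \<otimes> x))"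
      by (rule mean_scale[OF m' bdd_translate[OF cb[OF s] SG[OF s]]])
    also have "m' (\<lambda>x. c s (s \<otimes> x)) = m' (c s)"
      using invariant_mean_translate[OF m cb[OF s] SG[OF s]] cb[OF s] bdd_translate[OF cb[OF s] SG[OF s]]
      by (simp add: m'_def)
    finally show ?thesis by simp
  qed
  have "(\<Sum>s\<in>S. m' (c s)) = (\<Sum>s\<in>S. m' (c (inv s)))"
    by (rule sum.reindex_bij_witness[of _ "\<lambda>s. inv s" "\<lambda>s. inv s"]) (use S SG in auto)
  then have zero: "(\<Sum>s\<in>S. m' (c s)) = 0" using anti by (simp add: sum_negf)
  have le: "(\<Sum>s\<in>S. c s x) \<le> - n * ln \<rho>" if x: "x \<in> carrier G" for x
  proof -
    have wx: "w x > 0" using w x by simp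
    \<comment> \<open>The tangent of the logarithm at \<open>1 / \<rho>\<close>, in place of Jensen's inequality.\<close>
    have "c s x \<le> \<rho> * w (inv s \<otimes> x) / w x - 1 - ln \<rho>" if s: "s \<in> S" for s
    proof -
      have ws: "w (inv s \<otimes> x) > 0" using w SG[OF s] x by simp
      have "ln (\<rho> * w (inv s \<otimes> x) / w x) \<le> \<rho> * w (inv s \<otimes> x) / w x - 1"
        using ws wx \<rho> by (intro ln_le_minus_one) simp
      then show ?thesis using ws wx \<rho> by (simp add: c_def ln_mult ln_div)
    qed
    then have "(\<Sum>s\<in>S. c s x) \<le> (\<Sum>s\<in>S. \<rho> * w (inv s \<otimes> x) / w x - 1 - ln \<rho>)" by (rule sum_mono)
    also have "\<dots> = \<rho> * (\<Sum>s\<in>S. w (inv s \<otimes> x)) / w x - n - n * ln \<rho>"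
      by (simp add: sum_subtractf sum_distrib_left sum_divide_distrib n_def)
    also have "\<rho> * (\<Sum>s\<in>S. w (inv s \<otimes> x)) / w x \<le> n"
      using super[OF x] wx by (simp add: n_def field_simps)
    finally show ?thesis by simp
  qed
  have "m' (\<lambda>x. \<Sum>s\<in>S. c s x) \<le> m' (\<lambda>x. - n * ln \<rho>)"
    by (rule mean_mono[OF m']) (use cb le in auto)
  then have "0 \<le> - n * ln \<rho>" using zero mean_sum[OF m', of S c] cb by (simp add: mean_const[OF m'])
  moreover have "n * ln \<rho> > 0" using n \<rho> by simp
  ultimately show False by simp
qed

lemma (in group) amenable_subgroup:
  assumes am: "amenable G" and H: "subgroup H G" shows "amenable (G\<lparr>carrier := H\<rparr>)"
proof -
  obtain m where m: "invariant_mean G m" using am unfolding amenable_def by blast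
  define m' where "m' f = (if bdd (carrier G) f then m f else 0)" for f
  have m': "m' \<in> M" using invariant_mean_imp_means[OF m] by (simp add: m'_def[abs_def])
  show ?thesis
  proof (rule amenable_subgroup_of_fixed_mean[OF H m'])
    fix h assume h: "h \<in> H"
    then have hG: "h \<in> carrier G" using subgroup.subset[OF H] by blast
    show "translate h m' = m'"
    proof
      show "translate h m' f = m' f" for f
        using invariant_mean_translate[OF m _ hG, of f] hG by (simp add: translate_def m'_def)
    qed
  qed
qed

locale group_algebra = twisted_group G "\<lambda>_ _. 1" for G (structure)
begin

lemma fn_L1: "g \<in> carrier G \<Longrightarrow> fn (L g v) h = (if h \<in> carrier G then fn v (inv g \<otimes> h) else 0)"
  by (simp add: fn_L)

lemma norm_L_apply: assumes "g \<in> carrier G" "P v = v" shows "norm (L g v) = norm v"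
proof -
  have "complex_of_real ((norm (L g v))\<^sup>2) = complex_of_real ((norm v)\<^sup>2)"
    using cinner_L_L[OF assms(1), of v v] assms(2) by (simp only: cinner_self_norm)
  then have "(norm (L g v))\<^sup>2 = (norm v)\<^sup>2" by (simp only: of_real_eq_iff)
  then show ?thesis by simp
qed

text \<open>By the parallelogram law the two vectors \<open>v\<close> and \<open>L s v\<close> of the sum already lose a definite amount of
norm.\<close>
lemma norm_average_le:
  assumes S: "finite S" "S \<subseteq> carrier G" "\<one> \<in> S" and s: "s \<in> S" "s \<noteq> \<one>"
    and v: "P v = v" "norm v = 1" and far: "\<epsilon> \<le> norm (L s v - v)" "0 \<le> \<epsilon>"
  shows "norm (\<Sum>t\<in>S. L t v) \<le> real (card S) - 2 + sqrt (4 - \<epsilon>\<^sup>2)"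
proof -
  have L1: "L \<one> v = v" using v(1) by (simp add: L_one)
  have nL: "norm (L t v) = 1" if "t \<in> S" for t using norm_L_apply[of t v] that S v by auto
  have "(\<Sum>t\<in>S. L t v) = L s v + (v + (\<Sum>t\<in>S - {s} - {\<one>}. L t v))"
    using S s L1 sum.remove[OF S(1) s(1), of "\<lambda>t. L t v"] sum.remove[of "S - {s}" \<one> "\<lambda>t. L t v"] by simp
  then have "norm (\<Sum>t\<in>S. L t v) \<le> norm (L s v + v) + norm (\<Sum>t\<in>S - {s} - {\<one>}. L t v)"
    using norm_triangle_ineq[of "L s v + v" "\<Sum>t\<in>S - {s} - {\<one>}. L t v"] by (simp add: add.assoc)
  also have "norm (\<Sum>t\<in>S - {s} - {\<one>}. L t v) \<le> real (card S) - 2"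
  proof -
    have "norm (\<Sum>t\<in>S - {s} - {\<one>}. L t v) \<le> (\<Sum>t\<in>S - {s} - {\<one>}. 1)"
      by (rule order_trans[OF norm_sum]) (rule sum_mono, simp add: nL)
    also have "\<dots> = real (card S) - 2"
    proof -
      have "card S = Suc (Suc (card (S - {s} - {\<one>})))"
        using S s by (metis Diff_iff card.remove finite_Diff singletonD)
      then show ?thesis by simp
    qed
    finally show ?thesis .
  qed
  also have "norm (L s v + v) \<le> sqrt (4 - \<epsilon>\<^sup>2)"
  proof (rule real_le_rsqrt)
    have "(norm (L s v + v))\<^sup>2 + (norm (L s v - v))\<^sup>2 = 2 * (norm (L s v))\<^sup>2 + 2 * (norm v)\<^sup>2"
      by (simp add: power2_norm_eq_inner inner_add_left inner_add_right inner_diff_left inner_diff_right inner_commute)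
    moreover have "\<epsilon>\<^sup>2 \<le> (norm (L s v - v))\<^sup>2" using far by (intro power_mono) simp_all
    ultimately show "(norm (L s v + v))\<^sup>2 \<le> 4 - \<epsilon>\<^sup>2" using nL[OF s(1)] v(2) by simp
  qed
  finally show ?thesis by simp
qed

text \<open>Otherwise the averaging operator \<open>A\<close> over a symmetric set \<open>S\<close> has norm at most \<open>r < 1\<close> on vectors supported in \<open>N\<close>. The
series \<open>w = \<Sum> \<rho>\<^sup>k A\<^sup>k \<delta>\<close> then converges for some \<open>\<rho> > 1\<close>, is positive on the subgroup generated by
\<open>S\<close> and satisfies \<open>\<rho> A w \<le> w\<close>, which amenability excludes.\<close>
lemma almost_invariant_vector:
  assumes N: "subgroup N G" and am: "amenable (G\<lparr>carrier := N\<rparr>)"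
    and F: "finite F" "F \<subseteq> N" and e: "\<epsilon> > 0"
  shows "\<exists>v. proj N v = v \<and> norm v = 1 \<and> (\<forall>n\<in>F. norm (L n v - v) < \<epsilon>)"
proof (rule ccontr)
  assume neg: "\<not> ?thesis"
  \<comment> \<open>Keeps the square root below real and makes \<open>r\<close> nonnegative.\<close>
  define \<epsilon>' where "\<epsilon>' = min \<epsilon> 1"
  have e': "\<epsilon>' > 0" "\<epsilon>' \<le> \<epsilon>" "\<epsilon>' \<le> 1" using e by (auto simp: \<epsilon>'_def)
  have far: "\<exists>n\<in>F. \<epsilon>' \<le> norm (L n v - v)" if "proj N v = v" "norm v = 1" for v
  proof (rule ccontr)
    assume "\<not> (\<exists>n\<in>F. \<epsilon>' \<le> norm (L n v - v))"
    then have "\<forall>n\<in>F. norm (L n v - v) < \<epsilon>" using e'(2) by force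
    then show False using neg that by blast
  qed
  have NG: "N \<subseteq> carrier G" using N by (rule subgroup.subset)
  define S where "S = insert \<one> (F \<union> (\<lambda>s. inv s) ` F)"
  have S: "finite S" "S \<subseteq> N" "\<one> \<in> S"
    using F subgroup.one_closed[OF N] subgroup.m_inv_closed[OF N] by (auto simp: S_def)
  have SG: "S \<subseteq> carrier G" using S NG by blast
  have Sinv: "inv s \<in> S" if "s \<in> S" for s
    using that F NG by (auto simp: S_def subset_iff)
  define n where "n = real (card S)"
  have n1: "n \<ge> 1" using S by (simp add: n_def Suc_le_eq card_gt_0_iff) blast
  define A where "A v = (1 / n) *\<^sub>R (\<Sum>t\<in>S. L t v)" for v
  \<comment> \<open>The bound of \<open>norm_average_le\<close>, divided by the number of summands.\<close>
  define r where "r = (n - 2 + sqrt (4 - \<epsilon>'\<^sup>2)) / n"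
  have sq: "sqrt (4 - \<epsilon>'\<^sup>2) < 2" "1 \<le> sqrt (4 - \<epsilon>'\<^sup>2)"
  proof -
    have "sqrt (4 - \<epsilon>'\<^sup>2) < sqrt 4" using e' by (intro real_sqrt_less_mono) simp
    then show "sqrt (4 - \<epsilon>'\<^sup>2) < 2" by simp
    have "\<epsilon>'\<^sup>2 \<le> 1" using e' by (simp add: power_le_one)
    then show "1 \<le> sqrt (4 - \<epsilon>'\<^sup>2)" by simp
  qed
  have r: "0 \<le> r" "r < 1" 
  proof -
    have "0 \<le> n - 2 + sqrt (4 - \<epsilon>'\<^sup>2)" "n - 2 + sqrt (4 - \<epsilon>'\<^sup>2) < n" using sq n1 by linarith+
    then show "0 \<le> r" "r < 1" using n1 unfolding r_def by simp_all
  qed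
  have PN: "P v = v" if "proj N v = v" for v
  proof -
    have "P (proj N v) = proj N v" using NG by (intro l2_eqI) auto
    then show ?thesis using that by simp
  qed
  have An: "norm (A v) \<le> r * norm v" if v: "proj N v = v" for v
  proof (cases "norm v = 0")
    case False
    define v' where "v' = inverse (norm v) *\<^sub>R v"
    have v': "proj N v' = v'" "norm v' = 1" using v False by (simp_all add: v'_def blinfun.scaleR_right)
    obtain s where s: "s \<in> F" "\<epsilon>' \<le> norm (L s v' - v')" using far[OF v'] by blast
    have "s \<noteq> \<one>" using s(2) e' PN[OF v'(1)] by (auto simp: L_one)
    then have "norm (\<Sum>t\<in>S. L t v') \<le> n - 2 + sqrt (4 - \<epsilon>'\<^sup>2)"
      unfolding n_def using s e' S PN[OF v'(1)] v' SG by (intro norm_average_le[of S s]) (auto simp: S_def)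
    moreover have "(\<Sum>t\<in>S. L t v) = norm v *\<^sub>R (\<Sum>t\<in>S. L t v')"
      using False by (simp add: v'_def blinfun.scaleR_right scaleR_sum_right)
    ultimately have "norm (\<Sum>t\<in>S. L t v) \<le> norm v * (n - 2 + sqrt (4 - \<epsilon>'\<^sup>2))"
      by (simp add: mult_left_mono)
    then show ?thesis using n1 by (simp add: A_def r_def field_simps)
  qed (simp add: A_def blinfun.zero_right)
  have AN: "proj N (A v) = A v" if v: "proj N v = v" for v
  proof -
    have fv: "fn v x = 0" if "x \<notin> N" for x using v that by (metis fn_proj)
    have "fn (L t v) x = 0" if t: "t \<in> S" and x: "x \<notin> N" for t x
    proof (cases "x \<in> carrier G")
      case True
      have tN: "t \<in> N" using t S by blast
      have "inv t \<otimes> x \<notin> N"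
      proof
        assume "inv t \<otimes> x \<in> N"
        then have "t \<otimes> (inv t \<otimes> x) \<in> N" using tN N by (simp add: subgroup.m_closed)
        then show False using x True tN NG by (auto simp: m_assoc[symmetric])
      qed
      then show ?thesis using fv True tN NG by (auto simp: fn_L1)
    qed (use t SG in \<open>auto simp: fn_L1\<close>)
    then have "proj N (L t v) = L t v" if "t \<in> S" for t
      using that by (intro l2_eqI) simp
    then show ?thesis by (simp add: A_def blinfun.scaleR_right blinfun.sum_right)
  qed
  define a where "a k = (A ^^ k) (delta \<one>)" for k
  have a0: "a 0 = delta \<one>" and aS: "a (Suc k) = A (a k)" for k by (simp_all add: a_def)
  have one_N: "\<one> \<in> N" using S by blast
  have aN: "proj N (a k) = a k" for k
  proof (induction k)
    case 0
    show ?case unfolding a0 by (rule l2_eqI) (use one_N in \<open>simp add: fn_delta\<close>)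
  qed (simp add: aS AN)
  have anorm: "norm (a k) \<le> r ^ k * norm (delta \<one> :: 'a l2)" for k
  proof (induction k)
    case (Suc k)
    have "norm (a (Suc k)) \<le> r * norm (a k)" unfolding aS by (rule An[OF aN])
    also have "\<dots> \<le> r * (r ^ k * norm (delta \<one> :: 'a l2))" using Suc r by (intro mult_left_mono)
    finally show ?case by (simp add: mult.assoc)
  qed (simp add: a0)
  \<comment> \<open>Any \<open>\<rho> > 1\<close> with \<open>\<rho> r < 1\<close> would do.\<close>
  define \<rho> where "\<rho> = 2 / (1 + r)"
  have \<rho>: "1 < \<rho>" "\<rho> * r < 1" "0 \<le> \<rho> * r" using r by (simp_all add: \<rho>_def field_simps)
  have summ: "summable (\<lambda>k. \<rho> ^ k *\<^sub>R a k)"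
  proof (rule summable_comparison_test')
    show "summable (\<lambda>k. (\<rho> * r) ^ k * norm (delta \<one> :: 'a l2))"
      using \<rho> by (intro summable_mult2 summable_geometric) simp
    show "norm (\<rho> ^ k *\<^sub>R a k) \<le> (\<rho> * r) ^ k * norm (delta \<one> :: 'a l2)" if "k \<ge> 0" for k
      using mult_left_mono[OF anorm[of k], of "\<rho> ^ k"] \<rho> by (simp add: power_mult_distrib mult.assoc)
  qed
  define u where "u = (\<Sum>k. \<rho> ^ k *\<^sub>R a k)"
  have fa: "fn (A v) x = (1 / n) * (\<Sum>t\<in>S. fn v (inv t \<otimes> x))" if x: "x \<in> carrier G" for v x
  proof -
    have "fn (\<Sum>t\<in>T. L t v) x = (\<Sum>t\<in>T. fn v (inv t \<otimes> x))" if "finite T" "T \<subseteq> S" for T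
      using that
    proof (induction T rule: finite_induct)
      case (insert t T)
      then show ?case using SG x by (simp add: fn_L1 subset_iff)
    qed simp
    then show ?thesis using S by (simp add: A_def)
  qed
  have apos: "fn (a k) x \<in> \<real> \<and> 0 \<le> Re (fn (a k) x)" for k x
  proof (induction k arbitrary: x)
    case 0
    then show ?case by (simp add: a0 fn_delta)
  next
    case (Suc k)
    show ?case
    proof (cases "x \<in> carrier G")
      case True
      have "(\<Sum>t\<in>S. fn (a k) (inv t \<otimes> x)) \<in> \<real>" using Suc by (intro sum_in_Reals) blast
      moreover have "0 \<le> (\<Sum>t\<in>S. Re (fn (a k) (inv t \<otimes> x)))" using Suc by (intro sum_nonneg) blast
      ultimately show ?thesis using n1 by (simp add: aS fa[OF True])
    next
      case False
      then have "x \<notin> N" using NG by blast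
      then have "fn (a (Suc k)) x = 0" using aN[of "Suc k"] by (metis fn_proj)
      then show ?thesis by simp
    qed
  qed
  have coord: "bounded_linear (\<lambda>v. Re (fn v x))" for x :: 'a
    using bounded_linear_compose[OF bounded_linear_Re bounded_bilinear.bounded_linear_left[OF bounded_bilinear_cinner, of "delta x"]]
    by (simp add: cinner_delta_right)
  define w where "w x = Re (fn u x)" for x
  have w_sums: "(\<lambda>k. \<rho> ^ k * Re (fn (a k) x)) sums w x" for x
    using bounded_linear.sums[OF coord summable_sums[OF summ], of x] by (simp add: w_def u_def)
  have w_nonneg: "0 \<le> w x" for x
    by (rule sums_le[OF _ sums_zero w_sums]) (use apos \<rho> in simp)
  have w_eq: "w x = Re (fn (delta \<one>) x) + \<rho> / n * (\<Sum>t\<in>S. w (inv t \<otimes> x))" if x: "x \<in> carrier G" for x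
  proof -
    have "(\<lambda>k. \<rho> / n * (\<Sum>t\<in>S. \<rho> ^ k * Re (fn (a k) (inv t \<otimes> x)))) sums (\<rho> / n * (\<Sum>t\<in>S. w (inv t \<otimes> x)))"
      by (intro sums_mult sums_sum w_sums)
    moreover have "\<rho> ^ Suc k * Re (fn (a (Suc k)) x) = \<rho> / n * (\<Sum>t\<in>S. \<rho> ^ k * Re (fn (a k) (inv t \<otimes> x)))" for k
      by (simp add: aS fa[OF x] sum_distrib_left mult.assoc mult.left_commute)
    ultimately have "(\<lambda>k. \<rho> ^ Suc k * Re (fn (a (Suc k)) x)) sums (\<rho> / n * (\<Sum>t\<in>S. w (inv t \<otimes> x)))" by simp
    then have "(\<lambda>k. \<rho> ^ k * Re (fn (a k) x)) sums (\<rho> / n * (\<Sum>t\<in>S. w (inv t \<otimes> x)) + \<rho> ^ 0 * Re (fn (a 0) x))"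
      by (rule sums_Suc)
    from sums_unique2[OF w_sums this] show ?thesis by (simp add: a0)
  qed
  have delta_nonneg: "0 \<le> Re (fn (delta \<one>) x)" for x :: 'a by (simp add: fn_delta)
  \<comment> \<open>Positivity of \<open>w\<close> is guaranteed only here, so the mean has to be restricted to this subgroup.\<close>
  define H where "H = generate G S"
  have H: "subgroup H G" unfolding H_def by (rule generate_is_subgroup[OF SG])
  have HN: "H \<subseteq> N" unfolding H_def by (rule generate_subgroup_incl[OF S(2) N])
  have SH: "S \<subseteq> H" unfolding H_def by (auto intro: generate.incl)
  have HG: "H \<subseteq> carrier G" using H by (rule subgroup.subset)
  have step: "0 < w (s \<otimes> x)" if s: "s \<in> S" and x: "x \<in> carrier G" "0 < w x" for s x
  proof -
    have sG: "s \<in> carrier G" using s SG by blast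
    have "w (inv s \<otimes> (s \<otimes> x)) \<le> (\<Sum>t\<in>S. w (inv t \<otimes> (s \<otimes> x)))"
      using s S(1) w_nonneg by (intro member_le_sum) auto
    then have "0 < (\<Sum>t\<in>S. w (inv t \<otimes> (s \<otimes> x)))" using sG x by (simp add: m_assoc[symmetric])
    then have "0 < \<rho> / n * (\<Sum>t\<in>S. w (inv t \<otimes> (s \<otimes> x)))" using \<rho> n1 by simp
    then show ?thesis using w_eq[of "s \<otimes> x"] delta_nonneg[of "s \<otimes> x"] sG x(1) by simp
  qed
  have genpos: "0 < w (h \<otimes> x)" if "h \<in> H" "x \<in> carrier G" "0 < w x" for h x
    using that unfolding H_def
  proof (induction arbitrary: x rule: generate.induct)
    case (inv h)
    then show ?case using step[OF Sinv] by blast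
  next
    case (eng h1 h2)
    have G: "h1 \<in> carrier G" "h2 \<in> carrier G"
      using eng(1,2) generate_in_carrier[OF SG] by auto
    show ?case using eng G by (simp add: m_assoc)
  qed (simp_all add: step)
  have w1: "0 < w \<one>"
    using w_eq[of \<one>] w_nonneg \<rho> n1 by (simp add: fn_delta sum_nonneg add_pos_nonneg)
  have wH: "0 < w h" if "h \<in> H" for h using genpos[OF that one_closed w1] that HG by auto
  have amH: "amenable (G\<lparr>carrier := H\<rparr>)"
  proof -
    have "subgroup H (G\<lparr>carrier := N\<rparr>)" using subgroup_incl[OF H N HN] .
    from group.amenable_subgroup[OF subgroup_imp_group[OF N] am this] show ?thesis by simp
  qed
  show False
  proof (rule group.no_spectral_gap_function[OF subgroup_imp_group[OF H] amH S(1)])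
    show "S \<noteq> {}" using S by blast
    show "S \<subseteq> carrier (G\<lparr>carrier := H\<rparr>)" using SH by simp
    have invH: "inv\<^bsub>G\<lparr>carrier := H\<rparr>\<^esub> s = inv s" if "s \<in> H" for s by (rule m_inv_consistent[OF H that])
    show "inv\<^bsub>G\<lparr>carrier := H\<rparr>\<^esub> s \<in> S" if "s \<in> S" for s using that SH Sinv invH by auto
    show "0 < w x" if "x \<in> carrier (G\<lparr>carrier := H\<rparr>)" for x using that wH by simp
    show "1 < \<rho>" by (rule \<rho>(1))
    fix x assume "x \<in> carrier (G\<lparr>carrier := H\<rparr>)"
    then have x: "x \<in> carrier G" using HG by auto
    have "(\<Sum>s\<in>S. w (inv\<^bsub>G\<lparr>carrier := H\<rparr>\<^esub> s \<otimes> x)) = (\<Sum>s\<in>S. w (inv s \<otimes> x))"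
      by (rule sum.cong[OF refl]) (use SH invH in auto)
    moreover have "\<rho> / n * (\<Sum>t\<in>S. w (inv t \<otimes> x)) \<le> w x" using w_eq[OF x] delta_nonneg[of x] by simp
    ultimately show "\<rho> * (\<Sum>s\<in>S. w (inv\<^bsub>G\<lparr>carrier := H\<rparr>\<^esub> s \<otimes>\<^bsub>G\<lparr>carrier := H\<rparr>\<^esub> x)) \<le> real (card S) * w x"
      using n1 by (simp add: n_def[symmetric] field_simps)
  qed
qed

text \<open>A limit point of the vector functionals of almost invariant unit vectors supported in \<open>N\<close>. Off \<open>N\<close> the
translated vectors have disjoint supports, on \<open>N\<close> the values tend to 1.\<close>
lemma trace_of_amenable_normal_subgroup:
  assumes N: "N \<lhd> G" and am: "amenable (G\<lparr>carrier := N\<rparr>)"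
  obtains \<phi> where "bounded_linear \<phi>" "\<And>c T. \<phi> (cop c T) = c * \<phi> T"
      "\<And>S T. isadj S T \<Longrightarrow> \<phi> (S o\<^sub>L T) \<in> \<real>\<^sub>\<ge>\<^sub>0" "\<phi> P = 1"
      "\<And>g. g \<in> carrier G \<Longrightarrow> \<phi> (L g) = (if g \<in> N then 1 else 0)"
proof -
  have sN: "subgroup N G" using N by (rule normal_imp_subgroup)
  have NG: "N \<subseteq> carrier G" using sN by (rule subgroup.subset)
  define K where "K = {\<phi> :: ('a l2 \<Rightarrow>\<^sub>L 'a l2) \<Rightarrow> complex.
    (\<forall>T. cmod (\<phi> T) \<le> norm T) \<and> (\<forall>S T. \<phi> (S + T) = \<phi> S + \<phi> T) \<and> (\<forall>c T. \<phi> (cop c T) = c * \<phi> T) \<and>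
    (\<forall>S T. isadj S T \<longrightarrow> 0 \<le> Re (\<phi> (S o\<^sub>L T)) \<and> Im (\<phi> (S o\<^sub>L T)) = 0) \<and>
    \<phi> P = 1 \<and> (\<forall>g. g \<in> carrier G - N \<longrightarrow> \<phi> (L g) = 0)}"
  have clK: "closed K"
    unfolding K_def
    by (intro closed_Collect_conj closed_Collect_all closed_Collect_imp closed_Collect_eq
      closed_Collect_le open_Collect_const continuous_intros)
  have co: "compact {\<phi> :: ('a l2 \<Rightarrow>\<^sub>L 'a l2) \<Rightarrow> complex. \<forall>T. \<phi> T \<in> cball 0 (norm T)}"
    by (rule compact_functions) simp
  have sub: "K \<subseteq> {\<phi>. \<forall>T. \<phi> T \<in> cball 0 (norm T)}"
    unfolding K_def by auto
  have coK: "compact K" using compact_Int_closed[OF co clK] by (simp only: Int_absorb1[OF sub])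
  \<comment> \<open>Pairs of an element of \<open>N\<close> and a tolerance.\<close>
  define C where "C p = {\<phi> :: ('a l2 \<Rightarrow>\<^sub>L 'a l2) \<Rightarrow> complex. cmod (\<phi> (L (fst p)) - 1) \<le> snd p}" for p
  have "K \<inter> (\<Inter>p\<in>N \<times> {0<..}. C p) \<noteq> {}"
  proof (rule compact_imp_fip_image[OF coK])
    show "closed (C p)" for p unfolding C_def by (intro closed_Collect_le continuous_intros)
    fix I :: "('a \<times> real) set" assume I: "finite I" "I \<subseteq> N \<times> {0<..}"
    define \<epsilon> where "\<epsilon> = Min (insert 1 (snd ` I))"
    have e: "\<epsilon> > 0" unfolding \<epsilon>_def using I by (subst Min_gr_iff) auto
    have eI: "\<epsilon> \<le> snd p" if "p \<in> I" for p unfolding \<epsilon>_def using I that by (intro Min_le) auto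
    have "finite (fst ` I)" "fst ` I \<subseteq> N" using I by auto
    from almost_invariant_vector[OF sN am this e]
    obtain v where v: "proj N v = v" "norm v = 1" "\<forall>n\<in>fst ` I. norm (L n v - v) < \<epsilon>" by blast
    have Pv: "P v = v"
    proof -
      have "P (proj N v) = proj N v" using NG by (intro l2_eqI) auto
      then show ?thesis using v(1) by simp
    qed
    have vN: "fn v x = 0" if "x \<notin> N" for x using v(1) that by (metis fn_proj)
    have vv: "cinner v v = 1" using v(2) by (simp add: cinner_self_norm)
    have "vector_functional v \<in> K"
      unfolding K_def
    proof (intro CollectI conjI allI impI)
      show "cmod (vector_functional v T) \<le> norm T" for T
        using cmod_cinner_le[of "T v" v] norm_blinfun[of T v] v(2) by (simp add: vector_functional_def)
      show "vector_functional v (S + T) = vector_functional v S + vector_functional v T" for S T by (simp add: vector_functional_def blinfun.add_left cinner_add_left)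
      show "vector_functional v (cop c T) = c * vector_functional v T" for c T by (rule vector_functional_cop)
      show "vector_functional v P = 1" by (simp add: vector_functional_def Pv vv)
      show "0 \<le> Re (vector_functional v (S o\<^sub>L T))" "Im (vector_functional v (S o\<^sub>L T)) = 0" if "isadj S T" for S T
        unfolding vector_functional_pos[OF that] by simp_all
      fix g assume g: "g \<in> carrier G - N"
      have "fn (L g v) x * cnj (fn v x) = 0" for x
      proof (cases "x \<in> N")
        case True
        then have xG: "x \<in> carrier G" using NG by blast
        have "inv g \<otimes> x \<notin> N"
        proof
          assume "inv g \<otimes> x \<in> N"
          then have "x \<otimes> inv (inv g \<otimes> x) \<in> N"
            using True sN by (simp add: subgroup.m_closed subgroup.m_inv_closed)
          moreover have "x \<otimes> inv (inv g \<otimes> x) = g" using g xG by (simp add: inv_mult_group m_assoc[symmetric])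
          ultimately show False using g by simp
        qed
        then show ?thesis using vN g by (simp add: fn_L1)
      qed (simp add: vN)
      then show "vector_functional v (L g) = 0" unfolding vector_functional_def cinner_def by (simp only: infsum_0_simp)
    qed
    moreover have "vector_functional v \<in> C p" if p: "p \<in> I" for p
    proof -
      have "vector_functional v (L (fst p)) - 1 = cinner (L (fst p) v - v) v"
        using vv bounded_bilinear.diff_left[OF bounded_bilinear_cinner, of "L (fst p) v" v v] by (simp add: vector_functional_def)
      then have "cmod (vector_functional v (L (fst p)) - 1) \<le> norm (L (fst p) v - v)"
        using cmod_cinner_le[of "L (fst p) v - v" v] v(2) by simp
      also have "\<dots> \<le> snd p" using v(3) p eI[OF p] by force
      finally show ?thesis by (simp add: C_def)
    qed
    ultimately show "K \<inter> (\<Inter>p\<in>I. C p) \<noteq> {}" by blast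
  qed
  then obtain \<phi> where phi: "\<phi> \<in> K" "\<And>p. p \<in> N \<times> {0<..} \<Longrightarrow> \<phi> \<in> C p" by blast
  have one: "\<phi> (L n) = 1" if n: "n \<in> N" for n
  proof -
    have "cmod (\<phi> (L n) - 1) \<le> 0 + e" if "e > 0" for e
      using phi(2)[of "(n, e)"] n that by (simp add: C_def)
    then have "cmod (\<phi> (L n) - 1) \<le> 0" by (rule field_le_epsilon)
    then show ?thesis by simp
  qed
  show thesis
  proof (rule that)
    show cop: "\<phi> (cop c T) = c * \<phi> T" for c T using phi(1) by (simp add: K_def)
    show "bounded_linear \<phi>"
    proof (rule bounded_linear_intro[of _ 1])
      show "\<phi> (S + T) = \<phi> S + \<phi> T" for S T using phi(1) by (simp add: K_def)
      show "\<phi> (r *\<^sub>R T) = r *\<^sub>R \<phi> T" for r T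
        using cop[of "complex_of_real r" T] by (simp add: cop_of_real scaleR_conv_of_real)
      show "norm (\<phi> T) \<le> norm T * 1" for T using phi(1) by (simp add: K_def)
    qed
    show "\<phi> (S o\<^sub>L T) \<in> \<real>\<^sub>\<ge>\<^sub>0" if "isadj S T" for S T
      using phi(1) that by (simp add: K_def complex_nonneg_Reals_iff)
    show "\<phi> P = 1" using phi(1) by (simp add: K_def)
    show "\<phi> (L g) = (if g \<in> N then 1 else 0)" if "g \<in> carrier G" for g
      using phi(1) that one by (simp add: K_def)
  qed
qed

theorem amenable_normal_trivial_if_unique_trace:
  assumes u: "unique_trace_property G (\<lambda>_ _. 1)" and N: "N \<lhd> G" and am: "amenable (G\<lparr>carrier := N\<rparr>)"
  shows "N \<subseteq> {\<one>}"
proof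
  fix n assume n: "n \<in> N"
  then have nG: "n \<in> carrier G" using subgroup.subset[OF normal_imp_subgroup[OF N]] by blast
  obtain \<phi> where phi: "bounded_linear \<phi>" "\<And>c T. \<phi> (cop c T) = c * \<phi> T"
      "\<And>S T. isadj S T \<Longrightarrow> \<phi> (S o\<^sub>L T) \<in> \<real>\<^sub>\<ge>\<^sub>0" "\<phi> P = 1"
    and val: "\<And>g. g \<in> carrier G \<Longrightarrow> \<phi> (L g) = (if g \<in> N then 1 else 0)"
    using trace_of_amenable_normal_subgroup[OF N am] by blast
  have swap: "h \<otimes> g \<in> N" if "g \<in> carrier G" "h \<in> carrier G" "g \<otimes> h \<in> N" for g h
  proof -
    have "inv g \<otimes> (g \<otimes> h) \<otimes> g \<in> N" using normal.inv_op_closed1[OF N that(1,3)] .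
    then show ?thesis using that by (simp add: m_assoc[symmetric])
  qed
  have comm: "\<phi> (L g o\<^sub>L L h) = \<phi> (L h o\<^sub>L L g)" if "g \<in> carrier G" "h \<in> carrier G" for g h
    using that swap[of g h] swap[of h g] by (auto simp: L_mult val)
  show "n \<in> {\<one>}"
    using unique_trace_functional[OF u phi comm nG] val[OF nG] n by (cases "n = \<one>") simp_all
qed

end

section \<open>The class of groups with Kleppner's characterization of unique trace\<close>

lemma (in group) group_algebra_if_group: "group_algebra G"
  by unfold_locales (simp add: cocycles2_def)

text \<open>If the two subgroups agree, the quotient has a trivial amenable radical and traces vanish off it. Conversely the
image of the amenable radical of \<open>G\<close> in the quotient by the FC-hypercenter is amenable and normal, hence
trivial if the quotient has only one trace.\<close>
lemma (in group) FC_hypercenter_eq_amenable_radical_iff: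
  "FC_hypercenter G = amenable_radical G \<longleftrightarrow> group_unique_trace_property (ICC_quot G)"
proof
  assume "FC_hypercenter G = amenable_radical G"
  then have Q: "ICC_quot G = G Mod rad" by (simp add: ICC_quot_def amenable_radical_eq_rad)
  interpret N: normal rad G by (rule normal_rad)
  interpret Q: group "G Mod rad" by (rule N.factorgroup_is_group)
  interpret QA: group_algebra "G Mod rad" by (rule Q.group_algebra_if_group)
  have "Q.rad \<subseteq> {rad}"
    by (rule amenable_normal_quotient_rad_trivial[OF Q.normal_rad Q.amenable_rad])
  then have "unique_trace_property (G Mod rad) (\<lambda>_ _. 1)"
    by (intro QA.unique_trace_if_vanishing QA.trace_vanishes_off_rad) auto
  then show "group_unique_trace_property (ICC_quot G)"
    by (simp add: group_unique_trace_property_def Q)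
next
  let ?F = "FC_hypercenter G"
  assume u: "group_unique_trace_property (ICC_quot G)"
  interpret N: normal ?F G by (rule normal_FC_hypercenter)
  interpret Q: group "G Mod ?F" by (rule N.factorgroup_is_group)
  interpret QA: group_algebra "G Mod ?F" by (rule Q.group_algebra_if_group)
  have "(\<lambda>a. ?F #> a) ` rad \<subseteq> {\<one>\<^bsub>G Mod ?F\<^esub>}"
    by (rule QA.amenable_normal_trivial_if_unique_trace[OF _ amenable_image[OF normal_FC_hypercenter normal_rad amenable_rad]])
      (use u in \<open>simp add: group_unique_trace_property_def ICC_quot_def\<close>)
  then have "g \<in> ?F" if "g \<in> rad" for g
    using that coset_join1[OF _ _ N.is_subgroup, of g] subgroup.mem_carrier[OF subgroup_rad] by auto
  then show "?F = amenable_radical G"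
    using FC_hypercenter_subset_rad by (auto simp: amenable_radical_eq_rad)
qed

theorem theorem3p7:
  fixes G :: "('a, 'b) monoid_scheme"
  assumes "group G"
  shows "(FC_hypercenter G = amenable_radical G \<longleftrightarrow> group_unique_trace_property (ICC_quot G)) \<and>
    (FC_hypercenter G = amenable_radical G \<longrightarrow>
       (\<forall>\<sigma> \<in> cocycles2 G. Kleppner G \<sigma> \<longrightarrow> unique_trace_property G \<sigma>) \<and>
       G \<in> K_UT)"
proof (intro conjI impI ballI)
  interpret group G by (rule assms)
  show "FC_hypercenter G = amenable_radical G \<longleftrightarrow> group_unique_trace_property (ICC_quot G)"
    by (rule FC_hypercenter_eq_amenable_radical_iff)
  assume eq: "FC_hypercenter G = amenable_radical G"
  have tw: "twisted_group G \<sigma>" if "\<sigma> \<in> cocycles2 G" for \<sigma>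
    using that by unfold_locales
  show suff: "unique_trace_property G \<sigma>" if "\<sigma> \<in> cocycles2 G" "Kleppner G \<sigma>" for \<sigma>
    by (rule twisted_group.unique_trace_if_Kleppner[OF tw eq]) (use that in simp_all)
  show "G \<in> K_UT"
    unfolding K_UT_def using suff twisted_group.Kleppner_if_unique_trace[OF tw] assms by blast
qed

end
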